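(* Let $(W,S)$ be a right-angled Coxeter system (with $S$ finite), let $i:S\to I$ be any function that is constant on conjugacy classes, and assume that the nerve of $(W,S)$ is an Eulerian $k$-sphere. Then the standard growth series $\gamma(\mathbf{t})$ and the standard complete growth series $\tilde\gamma(\mathbf{t})$ satisfy $$\gamma(\mathbf{t}^{-1})=(-1)^{k+1}\gamma(\mathbf{t})\qquad\text{and}\qquad \tilde\gamma(\mathbf{t}^{-1})=(-1)^{k+1}\tilde\gamma(\mathbf{t}),$$ where $\mathbf{t}^{-1}$ denotes the $I$-tuple $(t_i^{-1})_{i\in I}$.
   Context: A Coxeter system $(W,S)$: $W=\langle S\mid (ss')^{m(s,s')}=1\rangle$ (one relation for each pair with $m(s,s')<\infty$), $m$ symmetric with values in $\{1,2,\dots,\infty\}$, $m(s,s')=1$ iff $s=s'$; right-angled means $m(s,s')\in\{2,\infty\}$ for $s\ne s'$. The nerve is the abstract simplicial complex of all subsets $\sigma\subset S$ (including $\emptyset$) that generate a finite subgroup of $W$. For a finite simplicial complex $K$ (empty simplex included, of dimension $-1$), $\bar{\boldsymbol\chi}(K)=\sum_{\sigma\in K}(-1)^{\dim\sigma}$. $K$ is an Eulerian $k$-sphere if $\bar{\boldsymbol\chi}(K)=(-1)^k$ and $\bar{\boldsymbol\chi}(\mathrm{Lk}(\sigma))=(-1)^{k-1-\dim\sigma}$ for every simplex $\sigma$ of $K$. "Constant on conjugacy classes" means $i(s)=i(s')$ whenever $s,s'\in S$ are conjugate in $W$. $\mathbf{t}=(t_i)_{i\in I}$ is a tuple of commuting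 indeterminates. For $w\in W$ with reduced expression $s_1\cdots s_n$, put $t^w=\prod_{j}t_{i(s_j)}$ (independent of the reduced expression). Then $\gamma(\mathbf{t})=\sum_{w\in W}t^w\in\mathbb{Q}[[\mathbf{t}]]$ and $\tilde\gamma(\mathbf{t})=\sum_{w\in W}w\,t^w\in\mathbb{Q}[W][[\mathbf{t}]]$, where $\mathbb{Q}[W]$ is the group ring and the $t_i$ commute with coefficients. Both series are rational. Meaning of the substitution $\mathbf{t}\mapsto\mathbf{t}^{-1}$: $\gamma$ is (the expansion of) a rational function in $\mathbb{Q}(\mathbf{t})$, and $\gamma(\mathbf{t}^{-1})$ is the rational function obtained by replacing each $t_i$ by $t_i^{-1}$. For $\tilde\gamma$ (and equivalently for $\gamma$): with $R=\mathbb{Q}[W]$, consider expressions $\tilde\gamma(\mathbf{t})=A(I-Q(\mathbf{t}))^{-1}B$ with $A\in\mathbb{Q}^{1\times n}$, $B\in\mathbb{Q}^{n\times 1}$ and $Q(\mathbf{t})$ an $n\times n$ matrix over $R[\mathbf{t}]$ whose entries have zero constant term; $\tilde\gamma(\mathbf{t}^{-1})$ means $A(I-Q(\mathbf{t}^{-1}))^{-1}B$ for such an expression for which $I-Q(\mathbf{t}^{-1})$ is invertible over the Laurent series ring $R[[\mathbf{t}]][t_i^{-1}: i\in I]$. The claim includes that such an expression exists; the resulting value does not depend on the choice of such an expression. *)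

theory Defs
  imports
    Complex_Main
    "HOL-Library.Poly_Mapping"
    "HOL-Library.Extended_Nat"
    "Jordan_Normal_Form.Matrix"
begin

section \<open>Group presentations and Coxeter systems\<close>

text \<open>
  A group is a type of class \<open>group_add\<close>. This class is not commutative, but it is written
  additively: \<open>u + v\<close> is the product \<open>uv\<close>, \<open>0\<close> the identity, \<open>- u\<close> the inverse. With this
  convention the group ring \<open>\<rat>[W]\<close> is the library's convolution ring \<open>'w \<Rightarrow>\<^sub>0 rat\<close>, in which
  the group element \<open>w\<close> is \<open>Poly_Mapping.single w 1\<close>.

  In a group word the letter \<open>(s, True)\<close> stands for \<open>s\<close> and \<open>(s, False)\<close> for its inverse.
\<close>

type_synonym 'a group_word = "('a \<times> bool) list"

definition word_value :: "'w::group_add group_word \<Rightarrow> 'w" where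
  "word_value u = sum_list (map (\<lambda>(s, b). if b then s else - s) u)"

definition generated_subgroup :: "'w::group_add set \<Rightarrow> 'w set" where
  "generated_subgroup X = word_value ` lists (X \<times> UNIV)"

inductive presented_eq ::
  "'a set \<Rightarrow> 'a group_word set \<Rightarrow> 'a group_word \<Rightarrow> 'a group_word \<Rightarrow> bool"
  for S :: "'a set" and Rel :: "'a group_word set" where
  refl: "u \<in> lists (S \<times> UNIV) \<Longrightarrow> presented_eq S Rel u u"
| sym: "presented_eq S Rel u v \<Longrightarrow> presented_eq S Rel v u"
| trans: "presented_eq S Rel u v \<Longrightarrow> presented_eq S Rel v w \<Longrightarrow> presented_eq S Rel u w"
| cancel: "u \<in> lists (S \<times> UNIV) \<Longrightarrow> v \<in> lists (S \<times> UNIV) \<Longrightarrow> s \<in> S \<Longrightarrow>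
    presented_eq S Rel (u @ [(s, b), (s, \<not> b)] @ v) (u @ v)"
| relator: "u \<in> lists (S \<times> UNIV) \<Longrightarrow> v \<in> lists (S \<times> UNIV) \<Longrightarrow> r \<in> Rel \<Longrightarrow>
    presented_eq S Rel (u @ r @ v) (u @ v)"

text \<open>The ambient group (the whole type) is \<open>\<langle>S | Rel\<rangle>\<close>, via the inclusion of \<open>S\<close>.\<close>

definition has_presentation :: "'w::group_add set \<Rightarrow> 'w group_word set \<Rightarrow> bool" where
  "has_presentation S Rel \<longleftrightarrow>
     generated_subgroup S = UNIV \<and>
     (\<forall>u \<in> lists (S \<times> UNIV). \<forall>v \<in> lists (S \<times> UNIV).
        word_value u = word_value v \<longleftrightarrow> presented_eq S Rel u v)"

definition coxeter_relators :: "'w set \<Rightarrow> ('w \<Rightarrow> 'w \<Rightarrow> enat) \<Rightarrow> 'w group_word set" where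
  "coxeter_relators S m =
     {concat (replicate n [(s, True), (s', True)]) | s s' n. s \<in> S \<and> s' \<in> S \<and> m s s' = enat n}"

definition coxeter_system :: "'w::group_add set \<Rightarrow> ('w \<Rightarrow> 'w \<Rightarrow> enat) \<Rightarrow> bool" where
  "coxeter_system S m \<longleftrightarrow>
     (\<forall>s\<in>S. \<forall>s'\<in>S. m s s' = m s' s \<and> 1 \<le> m s s' \<and> (m s s' = 1 \<longleftrightarrow> s = s')) \<and>
     has_presentation S (coxeter_relators S m)"

definition right_angled :: "'w set \<Rightarrow> ('w \<Rightarrow> 'w \<Rightarrow> enat) \<Rightarrow> bool" where
  "right_angled S m \<longleftrightarrow> (\<forall>s\<in>S. \<forall>s'\<in>S. s \<noteq> s' \<longrightarrow> m s s' \<in> {2, \<infinity>})"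

definition constant_on_conjugacy_classes :: "'w::group_add set \<Rightarrow> ('w \<Rightarrow> 'i) \<Rightarrow> bool" where
  "constant_on_conjugacy_classes S i \<longleftrightarrow>
     (\<forall>s\<in>S. \<forall>s'\<in>S. (\<exists>w. s' = w + s + (- w)) \<longrightarrow> i s = i s')"


section \<open>The nerve and Eulerian spheres\<close>

definition nerve :: "'w::group_add set \<Rightarrow> 'w set set" where
  "nerve S = {\<sigma>. \<sigma> \<subseteq> S \<and> finite (generated_subgroup \<sigma>)}"

text \<open>\<open>neg_one_power k\<close> is $(-1)^k$ for an arbitrary integer exponent, in any ring.\<close>

definition neg_one_power :: "int \<Rightarrow> 'a::ring_1" where
  "neg_one_power k = (if even k then 1 else - 1)"

definition simplex_dim :: "'a set \<Rightarrow> int" where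
  "simplex_dim \<sigma> = int (card \<sigma>) - 1"

definition euler_bar :: "'a set set \<Rightarrow> int" where
  "euler_bar K = (\<Sum>\<sigma>\<in>K. neg_one_power (simplex_dim \<sigma>))"

definition link :: "'a set set \<Rightarrow> 'a set \<Rightarrow> 'a set set" where
  "link K \<sigma> = {\<tau> \<in> K. \<tau> \<inter> \<sigma> = {} \<and> \<tau> \<union> \<sigma> \<in> K}"

text \<open>The dimension \<open>k\<close> is an integer, so that the complex \<open>{\<emptyset>}\<close> is a sphere of dimension \<open>-1\<close>.\<close>

definition eulerian_sphere :: "int \<Rightarrow> 'a set set \<Rightarrow> bool" where
  "eulerian_sphere k K \<longleftrightarrow>
     euler_bar K = neg_one_power k \<and>
     (\<forall>\<sigma>\<in>K. euler_bar (link K \<sigma>) = neg_one_power (k - 1 - simplex_dim \<sigma>))"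


section \<open>The ring \<open>R[[t]][t\<^sub>i\<^sup>-\<^sup>1]\<close>\<close>

text \<open>
  Families \<open>(f c)\<close> of coefficients, indexed by integer exponent vectors \<open>c\<close>, whose support is
  bounded below by one exponent vector \<open>N\<close>; these are exactly the products of the monomial
  with exponent \<open>N\<close> and a power series. All exponent vectors are finitely supported, so the set
  \<open>'i\<close> of indices may be infinite; the coefficient ring need not be commutative, and the
  indeterminates commute with the coefficients.
\<close>

definition bounded_support :: "(('i \<Rightarrow>\<^sub>0 int) \<Rightarrow> 'r::zero) \<Rightarrow> ('i \<Rightarrow>\<^sub>0 int) \<Rightarrow> bool" where
  "bounded_support f N \<longleftrightarrow> (\<forall>c. f c \<noteq> 0 \<longrightarrow> (\<forall>i. Poly_Mapping.lookup N i \<le> Poly_Mapping.lookup c i))"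

typedef (overloaded) ('i, 'r) laurent =
  "{f :: ('i \<Rightarrow>\<^sub>0 int) \<Rightarrow> 'r::zero. \<exists>N. bounded_support f N}"
  morphisms laurent_coeff Abs_laurent
  by (rule exI[of _ "\<lambda>_. 0"]) (simp add: bounded_support_def)

setup_lifting type_definition_laurent

lemma finite_exponents_between:
  fixes M N :: "'i \<Rightarrow>\<^sub>0 int"
  shows "finite {c. \<forall>i. Poly_Mapping.lookup M i \<le> Poly_Mapping.lookup c i \<and>
        Poly_Mapping.lookup c i \<le> Poly_Mapping.lookup N i}" (is "finite ?A")
proof -
  let ?K = "Poly_Mapping.keys M \<union> Poly_Mapping.keys N"
  let ?r = "\<lambda>c. restrict (Poly_Mapping.lookup c) ?K"
  have sub: "?r ` ?A \<subseteq> (\<Pi>\<^sub>E i\<in>?K. {Poly_Mapping.lookup M i..Poly_Mapping.lookup N i})"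
    by (auto simp: restrict_def PiE_def extensional_def)
  have "finite (\<Pi>\<^sub>E i\<in>?K. {Poly_Mapping.lookup M i..Poly_Mapping.lookup N i})"
    by (intro finite_PiE) auto
  with sub have fin: "finite (?r ` ?A)"
    by (rule finite_subset)
  have "inj_on ?r ?A"
  proof (rule inj_onI)
    fix c d assume c: "c \<in> ?A" and d: "d \<in> ?A" and eq: "?r c = ?r d"
    show "c = d"
    proof (rule poly_mapping_eqI)
      fix i show "Poly_Mapping.lookup c i = Poly_Mapping.lookup d i"
      proof (cases "i \<in> ?K")
        case True
        then show ?thesis using fun_cong[OF eq, of i] by simp
      next
        case False
        then have "Poly_Mapping.lookup M i = 0" "Poly_Mapping.lookup N i = 0"
          by (auto simp: in_keys_iff)
        moreover have "Poly_Mapping.lookup M i \<le> Poly_Mapping.lookup c i \<and>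
              Poly_Mapping.lookup c i \<le> Poly_Mapping.lookup N i"
          "Poly_Mapping.lookup M i \<le> Poly_Mapping.lookup d i \<and>
                Poly_Mapping.lookup d i \<le> Poly_Mapping.lookup N i"
          using c d by auto
        ultimately show ?thesis
          by auto
      qed
    qed
  qed
  with fin show ?thesis
    by (rule finite_imageD)
qed

lemma finite_conv_support:
  fixes f g :: "('i \<Rightarrow>\<^sub>0 int) \<Rightarrow> 'r::zero"
  assumes "bounded_support f M" "bounded_support g N"
  shows "finite {a. f a \<noteq> 0 \<and> g (c - a) \<noteq> 0}"
proof (rule finite_subset[OF _ finite_exponents_between[of M "c - N"]])
  show "{a. f a \<noteq> 0 \<and> g (c - a) \<noteq> 0} \<subseteq>
      {a. \<forall>i. Poly_Mapping.lookup M i \<le> Poly_Mapping.lookup a i \<and>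
            Poly_Mapping.lookup a i \<le> Poly_Mapping.lookup (c - N) i}"
  proof safe
    fix a i assume "f a \<noteq> 0" "g (c - a) \<noteq> 0"
    with assms have "Poly_Mapping.lookup M i \<le> Poly_Mapping.lookup a i"
      "Poly_Mapping.lookup N i \<le> Poly_Mapping.lookup (c - a) i"
      by (auto simp: bounded_support_def)
    then show "Poly_Mapping.lookup M i \<le> Poly_Mapping.lookup a i"
      "Poly_Mapping.lookup a i \<le> Poly_Mapping.lookup (c - N) i"
      by (simp_all add: lookup_minus)
  qed
qed

definition conv ::
  "(('i \<Rightarrow>\<^sub>0 int) \<Rightarrow> 'r::semiring_0) \<Rightarrow> (('i \<Rightarrow>\<^sub>0 int) \<Rightarrow> 'r) \<Rightarrow> ('i \<Rightarrow>\<^sub>0 int) \<Rightarrow> 'r" where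
  "conv f g c = (\<Sum>a | f a \<noteq> 0 \<and> g (c - a) \<noteq> 0. f a * g (c - a))"

lemma conv_eq_sum:
  assumes "finite F" "{a. f a \<noteq> 0 \<and> g (c - a) \<noteq> 0} \<subseteq> F"
  shows "conv f g c = (\<Sum>a\<in>F. f a * g (c - a))"
  unfolding conv_def using assms by (intro sum.mono_neutral_left) auto

lemma bounded_support_conv:
  assumes "bounded_support f M" "bounded_support g N"
  shows "bounded_support (conv f g) (M + N)"
  unfolding bounded_support_def
proof (intro allI impI)
  fix c i assume "conv f g c \<noteq> 0"
  then have "\<exists>a. f a \<noteq> 0 \<and> g (c - a) \<noteq> 0"
    unfolding conv_def by (rule contrapos_np) (rule sum.neutral, auto)
  then obtain a where "f a \<noteq> 0" "g (c - a) \<noteq> 0"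
    by blast
  with assms have "Poly_Mapping.lookup M i \<le> Poly_Mapping.lookup a i"
    "Poly_Mapping.lookup N i \<le> Poly_Mapping.lookup (c - a) i"
    by (auto simp: bounded_support_def)
  then show "Poly_Mapping.lookup (M + N) i \<le> Poly_Mapping.lookup c i"
    by (simp add: lookup_minus lookup_add)
qed

lemma bounded_support_common:
  fixes f g :: "('i \<Rightarrow>\<^sub>0 int) \<Rightarrow> 'r::zero"
  assumes "bounded_support f M" "bounded_support g N"
  shows "\<exists>L. bounded_support f L \<and> bounded_support g L"
proof -
  define L :: "'i \<Rightarrow>\<^sub>0 int" where "L = Abs_poly_mapping (\<lambda>i. min (Poly_Mapping.lookup M i) (Poly_Mapping.lookup N i))"
  have "finite {i. min (Poly_Mapping.lookup M i) (Poly_Mapping.lookup N i) \<noteq> 0}"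
    by (rule finite_subset[of _ "Poly_Mapping.keys M \<union> Poly_Mapping.keys N"]) (auto simp: in_keys_iff min_def)
  then have "Poly_Mapping.lookup L i = min (Poly_Mapping.lookup M i) (Poly_Mapping.lookup N i)" for i
    by (simp add: L_def)
  with assms show ?thesis
    by (intro exI[of _ L]) (auto simp: bounded_support_def min_le_iff_disj)
qed

lemma conv_assoc:
  assumes f: "bounded_support f L" and g: "bounded_support g M" and h: "bounded_support h N"
  shows "conv (conv f g) h c = conv f (conv g h) c"
proof -
  define F where "F = {a. \<forall>i. Poly_Mapping.lookup L i \<le> Poly_Mapping.lookup a i \<and>
        Poly_Mapping.lookup a i \<le> Poly_Mapping.lookup (c - N - M) i}"
  define G where "G = {b. \<forall>i. Poly_Mapping.lookup M i \<le> Poly_Mapping.lookup b i \<and>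
        Poly_Mapping.lookup b i \<le> Poly_Mapping.lookup (c - N - L) i}"
  define E where "E = {e. \<forall>i. Poly_Mapping.lookup (L + M) i \<le> Poly_Mapping.lookup e i \<and>
        Poly_Mapping.lookup e i \<le> Poly_Mapping.lookup (c - N) i}"
  have fin: "finite F" "finite G" "finite E"
    unfolding F_def G_def E_def by (rule finite_exponents_between)+
  have bd: "Poly_Mapping.lookup L i \<le> Poly_Mapping.lookup a i" if "f a \<noteq> 0" for a i
    using f that by (auto simp: bounded_support_def)
  have bdg: "Poly_Mapping.lookup M i \<le> Poly_Mapping.lookup a i" if "g a \<noteq> 0" for a i
    using g that by (auto simp: bounded_support_def)
  have bdh: "Poly_Mapping.lookup N i \<le> Poly_Mapping.lookup a i" if "h a \<noteq> 0" for a i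
    using h that by (auto simp: bounded_support_def)
  have bdfg: "Poly_Mapping.lookup (L + M) i \<le> Poly_Mapping.lookup a i" if "conv f g a \<noteq> 0" for a i
    using bounded_support_conv[OF f g] that unfolding bounded_support_def by blast
  have bdgh: "Poly_Mapping.lookup (M + N) i \<le> Poly_Mapping.lookup a i" if "conv g h a \<noteq> 0" for a i
    using bounded_support_conv[OF g h] that unfolding bounded_support_def by blast
  have "conv (conv f g) h c = (\<Sum>e\<in>E. conv f g e * h (c - e))"
  proof (rule conv_eq_sum[OF fin(3)])
    show "{a. conv f g a \<noteq> 0 \<and> h (c - a) \<noteq> 0} \<subseteq> E"
    proof safe
      fix e assume "conv f g e \<noteq> 0" "h (c - e) \<noteq> 0"
      then have *: "Poly_Mapping.lookup (L + M) i \<le> Poly_Mapping.lookup e i"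
        "Poly_Mapping.lookup N i \<le> Poly_Mapping.lookup (c - e) i" for i
        using bdfg bdh by auto
      have "Poly_Mapping.lookup (L + M) i \<le> Poly_Mapping.lookup e i \<and>
          Poly_Mapping.lookup e i \<le> Poly_Mapping.lookup (c - N) i" for i
        using *[of i] by (simp add: lookup_minus)
      then show "e \<in> E"
        by (simp add: E_def)
    qed
  qed
  also have "\<dots> = (\<Sum>e\<in>E. \<Sum>a\<in>F. f a * g (e - a) * h (c - e))"
  proof (rule sum.cong[OF HOL.refl])
    fix e assume e: "e \<in> E"
    have "{a. f a \<noteq> 0 \<and> g (e - a) \<noteq> 0} \<subseteq> F"
    proof safe
      fix a assume "f a \<noteq> 0" "g (e - a) \<noteq> 0"
      then have *: "Poly_Mapping.lookup L i \<le> Poly_Mapping.lookup a i"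
        "Poly_Mapping.lookup M i \<le> Poly_Mapping.lookup (e - a) i"
        "Poly_Mapping.lookup e i \<le> Poly_Mapping.lookup (c - N) i" for i
        using bd bdg e by (auto simp: E_def)
      have "Poly_Mapping.lookup L i \<le> Poly_Mapping.lookup a i \<and>
          Poly_Mapping.lookup a i \<le> Poly_Mapping.lookup (c - N - M) i" for i
        using *[of i] by (simp add: lookup_minus lookup_add)
      then show "a \<in> F"
        by (simp add: F_def)
    qed
    then have "conv f g e = (\<Sum>a\<in>F. f a * g (e - a))"
      by (rule conv_eq_sum[OF fin(1)])
    then show "conv f g e * h (c - e) = (\<Sum>a\<in>F. f a * g (e - a) * h (c - e))"
      by (simp add: sum_distrib_right)
  qed
  also have "\<dots> = (\<Sum>a\<in>F. \<Sum>e\<in>E. f a * g (e - a) * h (c - e))"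
    by (rule sum.swap)
  also have "\<dots> = (\<Sum>a\<in>F. \<Sum>b\<in>G. f a * g b * h (c - a - b))"
  proof (rule sum.cong[OF HOL.refl])
    fix a assume a: "a \<in> F"
    have *: "(\<Sum>e\<in>E. f a * g (e - a) * h (c - e)) =
        (\<Sum>e | g (e - a) \<noteq> 0 \<and> h (c - e) \<noteq> 0. f a * g (e - a) * h (c - e))" if "f a \<noteq> 0"
    proof (rule sum.mono_neutral_right[OF fin(3)])
      show "{e. g (e - a) \<noteq> 0 \<and> h (c - e) \<noteq> 0} \<subseteq> E"
      proof safe
        fix e assume "g (e - a) \<noteq> 0" "h (c - e) \<noteq> 0"
        with that have *: "Poly_Mapping.lookup L i \<le> Poly_Mapping.lookup a i"
          "Poly_Mapping.lookup M i \<le> Poly_Mapping.lookup (e - a) i"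
          "Poly_Mapping.lookup N i \<le> Poly_Mapping.lookup (c - e) i" for i
          using bd bdg bdh by auto
        have "Poly_Mapping.lookup (L + M) i \<le> Poly_Mapping.lookup e i \<and>
            Poly_Mapping.lookup e i \<le> Poly_Mapping.lookup (c - N) i" for i
          using *[of i] by (simp add: lookup_minus lookup_add)
        then show "e \<in> E"
          by (simp add: E_def)
      qed
    qed auto
    have **: "(\<Sum>b\<in>G. f a * g b * h (c - a - b)) =
        (\<Sum>b | g b \<noteq> 0 \<and> h (c - a - b) \<noteq> 0. f a * g b * h (c - a - b))" if "f a \<noteq> 0"
    proof (rule sum.mono_neutral_right[OF fin(2)])
      show "{b. g b \<noteq> 0 \<and> h (c - a - b) \<noteq> 0} \<subseteq> G"
      proof safe
        fix b assume "g b \<noteq> 0" "h (c - a - b) \<noteq> 0"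
        with that have *: "Poly_Mapping.lookup L i \<le> Poly_Mapping.lookup a i"
          "Poly_Mapping.lookup M i \<le> Poly_Mapping.lookup b i"
          "Poly_Mapping.lookup N i \<le> Poly_Mapping.lookup (c - a - b) i" for i
          using bd bdg bdh by auto
        have "Poly_Mapping.lookup M i \<le> Poly_Mapping.lookup b i \<and>
            Poly_Mapping.lookup b i \<le> Poly_Mapping.lookup (c - N - L) i" for i
          using *[of i] by (simp add: lookup_minus lookup_add)
        then show "b \<in> G"
          by (simp add: G_def)
      qed
    qed auto
    have "(\<Sum>e | g (e - a) \<noteq> 0 \<and> h (c - e) \<noteq> 0. f a * g (e - a) * h (c - e)) =
        (\<Sum>b | g b \<noteq> 0 \<and> h (c - a - b) \<noteq> 0. f a * g b * h (c - a - b))"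
      by (rule sum.reindex_bij_witness[of _ "\<lambda>b. b + a" "\<lambda>e. e - a"])
         (auto simp: algebra_simps)
    then show "(\<Sum>e\<in>E. f a * g (e - a) * h (c - e)) = (\<Sum>b\<in>G. f a * g b * h (c - a - b))"
      using * ** by (cases "f a = 0") simp_all
  qed
  also have "\<dots> = (\<Sum>a\<in>F. f a * conv g h (c - a))"
  proof (rule sum.cong[OF HOL.refl])
    fix a assume a: "a \<in> F"
    have "{b. g b \<noteq> 0 \<and> h (c - a - b) \<noteq> 0} \<subseteq> G"
    proof safe
      fix b assume "g b \<noteq> 0" "h (c - a - b) \<noteq> 0"
      then have *: "Poly_Mapping.lookup L i \<le> Poly_Mapping.lookup a i"
        "Poly_Mapping.lookup M i \<le> Poly_Mapping.lookup b i"
        "Poly_Mapping.lookup N i \<le> Poly_Mapping.lookup (c - a - b) i" for i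
        using bdg bdh a by (auto simp: F_def)
      have "Poly_Mapping.lookup M i \<le> Poly_Mapping.lookup b i \<and>
          Poly_Mapping.lookup b i \<le> Poly_Mapping.lookup (c - N - L) i" for i
        using *[of i] by (simp add: lookup_minus lookup_add)
      then show "b \<in> G"
        by (simp add: G_def)
    qed
    then have "conv g h (c - a) = (\<Sum>b\<in>G. g b * h (c - a - b))"
      by (rule conv_eq_sum[OF fin(2)])
    then show "(\<Sum>b\<in>G. f a * g b * h (c - a - b)) = f a * conv g h (c - a)"
      by (simp add: sum_distrib_left mult.assoc)
  qed
  also have "\<dots> = conv f (conv g h) c"
  proof (rule conv_eq_sum[OF fin(1), symmetric])
    show "{a. f a \<noteq> 0 \<and> conv g h (c - a) \<noteq> 0} \<subseteq> F"
    proof safe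
      fix a assume "f a \<noteq> 0" "conv g h (c - a) \<noteq> 0"
      then have *: "Poly_Mapping.lookup L i \<le> Poly_Mapping.lookup a i"
        "Poly_Mapping.lookup (M + N) i \<le> Poly_Mapping.lookup (c - a) i" for i
        using bd bdgh by auto
      have "Poly_Mapping.lookup L i \<le> Poly_Mapping.lookup a i \<and>
          Poly_Mapping.lookup a i \<le> Poly_Mapping.lookup (c - N - M) i" for i
        using *[of i] by (simp add: lookup_minus lookup_add)
      then show "a \<in> F"
        by (simp add: F_def)
    qed
  qed
  finally show ?thesis .
qed

lemma conv_add_left:
  assumes f: "bounded_support f L" and g: "bounded_support g M" and h: "bounded_support h N"
  shows "conv (\<lambda>a. f a + g a) h c = conv f h c + conv g h c"
proof -
  let ?F = "{a. f a \<noteq> 0 \<and> h (c - a) \<noteq> 0} \<union> {a. g a \<noteq> 0 \<and> h (c - a) \<noteq> 0}"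
  have fin: "finite ?F"
    using finite_conv_support[OF f h] finite_conv_support[OF g h] by simp
  have 1: "conv (\<lambda>a. f a + g a) h c = (\<Sum>a\<in>?F. (f a + g a) * h (c - a))"
    by (rule conv_eq_sum[OF fin]) auto
  have 2: "conv f h c = (\<Sum>a\<in>?F. f a * h (c - a))"
    by (rule conv_eq_sum[OF fin]) auto
  have 3: "conv g h c = (\<Sum>a\<in>?F. g a * h (c - a))"
    by (rule conv_eq_sum[OF fin]) auto
  show ?thesis
    unfolding 1 2 3 by (simp add: distrib_right sum.distrib)
qed

lemma conv_add_right:
  assumes f: "bounded_support f L" and g: "bounded_support g M" and h: "bounded_support h N"
  shows "conv f (\<lambda>a. g a + h a) c = conv f g c + conv f h c"
proof -
  let ?F = "{a. f a \<noteq> 0 \<and> g (c - a) \<noteq> 0} \<union> {a. f a \<noteq> 0 \<and> h (c - a) \<noteq> 0}"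
  have fin: "finite ?F"
    using finite_conv_support[OF f g] finite_conv_support[OF f h] by simp
  have 1: "conv f (\<lambda>a. g a + h a) c = (\<Sum>a\<in>?F. f a * (g (c - a) + h (c - a)))"
    by (rule conv_eq_sum[OF fin]) auto
  have 2: "conv f g c = (\<Sum>a\<in>?F. f a * g (c - a))"
    by (rule conv_eq_sum[OF fin]) auto
  have 3: "conv f h c = (\<Sum>a\<in>?F. f a * h (c - a))"
    by (rule conv_eq_sum[OF fin]) auto
  show ?thesis
    unfolding 1 2 3 by (simp add: distrib_left sum.distrib)
qed

lemma conv_one_left: "conv (\<lambda>a. if a = 0 then 1 else 0) (f :: _ \<Rightarrow> 'r::semiring_1) c = f c"
  by (subst conv_eq_sum[of "{0}"]) (auto split: if_splits)

lemma conv_one_right: "conv (f :: _ \<Rightarrow> 'r::semiring_1) (\<lambda>a. if a = 0 then 1 else 0) c = f c"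
  by (subst conv_eq_sum[of "{c}"]) (auto split: if_splits)

instantiation laurent :: (type, ring_1) ring_1
begin

lift_definition zero_laurent :: "('a, 'b) laurent" is "\<lambda>_. 0"
  by (simp add: bounded_support_def)

lift_definition one_laurent :: "('a, 'b) laurent" is "\<lambda>c. if c = 0 then 1 else 0"
  by (rule exI[of _ 0]) (simp add: bounded_support_def)

lift_definition plus_laurent :: "('a, 'b) laurent \<Rightarrow> ('a, 'b) laurent \<Rightarrow> ('a, 'b) laurent"
  is "\<lambda>f g c. f c + g c"
proof clarify
  fix f g :: "('a \<Rightarrow>\<^sub>0 int) \<Rightarrow> 'b" and M N
  assume "bounded_support f M" "bounded_support g N"
  from bounded_support_common[OF this]
  obtain L where "bounded_support f L" "bounded_support g L"
    by blast
  then have "bounded_support (\<lambda>c. f c + g c) L"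
    unfolding bounded_support_def by (metis add.right_neutral)
  then show "\<exists>N. bounded_support (\<lambda>c. f c + g c) N" ..
qed

lift_definition uminus_laurent :: "('a, 'b) laurent \<Rightarrow> ('a, 'b) laurent" is "\<lambda>f c. - f c"
  unfolding bounded_support_def by simp

definition minus_laurent :: "('a, 'b) laurent \<Rightarrow> ('a, 'b) laurent \<Rightarrow> ('a, 'b) laurent" where
  "minus_laurent f g = f + (- g)"

lift_definition times_laurent :: "('a, 'b) laurent \<Rightarrow> ('a, 'b) laurent \<Rightarrow> ('a, 'b) laurent"
  is conv
  using bounded_support_conv by blast

instance
proof
  fix f g h :: "('a, 'b) laurent"
  show "f * g * h = f * (g * h)"
    by transfer (auto simp: fun_eq_iff conv_assoc)
  show "f + g + h = f + (g + h)"
    by transfer (simp add: add.assoc)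
  show "f + g = g + f"
    by transfer (simp add: add.commute)
  show "0 + f = f"
    by transfer simp
  show "- f + f = 0"
    by transfer simp
  show "f - g = f + (- g)"
    by (rule minus_laurent_def)
  show "(f + g) * h = f * h + g * h"
    by transfer (auto simp: fun_eq_iff conv_add_left)
  show "f * (g + h) = f * g + f * h"
    by transfer (auto simp: fun_eq_iff conv_add_right)
  show "1 * f = f"
    by transfer (simp add: conv_one_left fun_eq_iff)
  show "f * 1 = f"
    by transfer (simp add: conv_one_right fun_eq_iff)
  show "(0 :: ('a, 'b) laurent) \<noteq> 1"
    by transfer (simp add: fun_eq_iff)
qed

end

definition laurent_monom :: "'r::zero \<Rightarrow> ('i \<Rightarrow>\<^sub>0 int) \<Rightarrow> ('i, 'r) laurent" where
  "laurent_monom r a = Abs_laurent (\<lambda>c. if c = a then r else 0)"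

lemma laurent_coeff_monom: "laurent_coeff (laurent_monom r a) c = (if c = a then r else 0)"
proof -
  have "bounded_support (\<lambda>c. if c = a then r else 0) a"
    by (simp add: bounded_support_def)
  then show ?thesis
    unfolding laurent_monom_def by (subst Abs_laurent_inverse) auto
qed

lemma laurent_monom_mult:
  "laurent_monom r a * laurent_monom s b = laurent_monom (r * s :: 'r::ring_1) (a + b)"
proof (rule laurent_coeff_inject[THEN iffD1], rule ext)
  fix c
  have "conv (laurent_coeff (laurent_monom r a)) (laurent_coeff (laurent_monom s b)) c =
      (\<Sum>d\<in>{a}. laurent_coeff (laurent_monom r a) d * laurent_coeff (laurent_monom s b) (c - d))"
    by (rule conv_eq_sum) (auto simp: laurent_coeff_monom split: if_splits)
  then show "laurent_coeff (laurent_monom r a * laurent_monom s b) c =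
      laurent_coeff (laurent_monom (r * s) (a + b)) c"
    by (auto simp: times_laurent.rep_eq laurent_coeff_monom algebra_simps)
qed


section \<open>Polynomials and the substitution \<open>t \<mapsto> t\<^sup>-\<^sup>1\<close>\<close>

text \<open>
  The polynomial ring \<open>R[t]\<close> is \<open>('i \<Rightarrow>\<^sub>0 nat) \<Rightarrow>\<^sub>0 R\<close>. For \<open>p\<close> in it, \<open>at_t p\<close> and \<open>at_t_inv p\<close>
  are the values \<open>p(t)\<close> and \<open>p(t\<^sup>-\<^sup>1)\<close> in \<open>R[[t]][t\<^sub>i\<^sup>-\<^sup>1]\<close>.
\<close>

definition int_exponent :: "('i \<Rightarrow>\<^sub>0 nat) \<Rightarrow> ('i \<Rightarrow>\<^sub>0 int)" where
  "int_exponent a = Poly_Mapping.map int a"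

definition at_t :: "(('i \<Rightarrow>\<^sub>0 nat) \<Rightarrow>\<^sub>0 'r::ring_1) \<Rightarrow> ('i, 'r) laurent" where
  "at_t p = (\<Sum>a\<in>Poly_Mapping.keys p. laurent_monom (Poly_Mapping.lookup p a) (int_exponent a))"

definition at_t_inv :: "(('i \<Rightarrow>\<^sub>0 nat) \<Rightarrow>\<^sub>0 'r::ring_1) \<Rightarrow> ('i, 'r) laurent" where
  "at_t_inv p = (\<Sum>a\<in>Poly_Mapping.keys p. laurent_monom (Poly_Mapping.lookup p a) (- int_exponent a))"

text \<open>
  The power series \<open>f\<close> is the expansion of the element \<open>p/q\<close> of \<open>\<rat>(t)\<close>. Elements of \<open>\<rat>(t)\<close> are
  handled as such fractions, and equality of two of them by cross-multiplication; the library's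
  type \<open>fract\<close> would force a linear order on the index type.
\<close>

definition expansion_of_fraction ::
  "('i, rat) laurent \<Rightarrow> (('i \<Rightarrow>\<^sub>0 nat) \<Rightarrow>\<^sub>0 rat) \<Rightarrow> (('i \<Rightarrow>\<^sub>0 nat) \<Rightarrow>\<^sub>0 rat) \<Rightarrow> bool" where
  "expansion_of_fraction f p q \<longleftrightarrow> q \<noteq> 0 \<and> at_t q * f = at_t p"

text \<open>The matrix inverse over a ring that need not be commutative.\<close>

definition inverse_matrix :: "'a::ring_1 mat \<Rightarrow> 'a mat" where
  "inverse_matrix M = (THE N. inverts_mat M N \<and> inverts_mat N M)"

definition rat_constant :: "rat \<Rightarrow> ('i, 'w::group_add \<Rightarrow>\<^sub>0 rat) laurent" where
  "rat_constant r = laurent_monom (Poly_Mapping.single 0 r) 0"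

text \<open>\<open>I - Q(t)\<close> and \<open>I - Q(t\<^sup>-\<^sup>1)\<close>, and then the value \<open>A M\<^sup>-\<^sup>1 B\<close>, for rational \<open>A\<close>, \<open>B\<close>.\<close>

definition kernel_at_t ::
  "(('i \<Rightarrow>\<^sub>0 nat) \<Rightarrow>\<^sub>0 ('w::group_add \<Rightarrow>\<^sub>0 rat)) mat \<Rightarrow> ('i, 'w \<Rightarrow>\<^sub>0 rat) laurent mat" where
  "kernel_at_t Q = 1\<^sub>m (dim_row Q) - map_mat at_t Q"

definition kernel_at_t_inv ::
  "(('i \<Rightarrow>\<^sub>0 nat) \<Rightarrow>\<^sub>0 ('w::group_add \<Rightarrow>\<^sub>0 rat)) mat \<Rightarrow> ('i, 'w \<Rightarrow>\<^sub>0 rat) laurent mat" where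
  "kernel_at_t_inv Q = 1\<^sub>m (dim_row Q) - map_mat at_t_inv Q"

definition sandwich ::
  "rat mat \<Rightarrow> ('i, 'w::group_add \<Rightarrow>\<^sub>0 rat) laurent mat \<Rightarrow> rat mat \<Rightarrow> ('i, 'w \<Rightarrow>\<^sub>0 rat) laurent" where
  "sandwich A M B = (map_mat rat_constant A * inverse_matrix M * map_mat rat_constant B) $$ (0, 0)"

text \<open>
  \<open>f = A (I - Q(t))\<^sup>-\<^sup>1 B\<close>. Since the entries of \<open>Q\<close> have zero constant term, \<open>I - Q(t)\<close> is
  invertible over \<open>R[[t]]\<close>.
\<close>

definition is_expression ::
  "('i, 'w::group_add \<Rightarrow>\<^sub>0 rat) laurent \<Rightarrow> nat \<Rightarrow> rat mat \<Rightarrow>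
   (('i \<Rightarrow>\<^sub>0 nat) \<Rightarrow>\<^sub>0 ('w \<Rightarrow>\<^sub>0 rat)) mat \<Rightarrow> rat mat \<Rightarrow> bool" where
  "is_expression f n A Q B \<longleftrightarrow>
     A \<in> carrier_mat 1 n \<and> Q \<in> carrier_mat n n \<and> B \<in> carrier_mat n 1 \<and>
     (\<forall>j<n. \<forall>l<n. Poly_Mapping.lookup (Q $$ (j, l)) 0 = 0) \<and>
     f = sandwich A (kernel_at_t Q) B"


section \<open>Growth series\<close>

definition reduced_expression :: "'w::group_add set \<Rightarrow> 'w \<Rightarrow> 'w list \<Rightarrow> bool" where
  "reduced_expression S w ss \<longleftrightarrow>
     ss \<in> lists S \<and> sum_list ss = w \<and>
     (\<forall>ss' \<in> lists S. sum_list ss' = w \<longrightarrow> length ss \<le> length ss')"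

text \<open>The exponent vector of the monomial \<open>t\<^sup>w\<close>, read off some reduced expression of \<open>w\<close>.\<close>

definition growth_exponent :: "'w::group_add set \<Rightarrow> ('w \<Rightarrow> 'i) \<Rightarrow> 'w \<Rightarrow> ('i \<Rightarrow>\<^sub>0 nat)" where
  "growth_exponent S i w =
     (let ss = (SOME ss. reduced_expression S w ss)
      in sum_list (map (\<lambda>s. Poly_Mapping.single (i s) 1) ss))"

text \<open>
  The series \<open>\<Sum>\<^sub>w coef(w) t\<^sup>w\<close>, with the terms of equal exponent collected; for finite \<open>S\<close> the
  inner sum is finite.
\<close>

definition weighted_growth ::
  "'w::group_add set \<Rightarrow> ('w \<Rightarrow> 'i) \<Rightarrow> ('w \<Rightarrow> 'r::comm_monoid_add) \<Rightarrow> ('i, 'r) laurent" where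
  "weighted_growth S i coef =
     Abs_laurent (\<lambda>c. \<Sum>w | int_exponent (growth_exponent S i w) = c. coef w)"

lemma laurent_coeff_weighted_growth:
  "laurent_coeff (weighted_growth S i coef) c =
     (\<Sum>w | int_exponent (growth_exponent S i w) = c. coef w)"
proof -
  have "bounded_support (\<lambda>c. \<Sum>w | int_exponent (growth_exponent S i w) = c. coef w) 0"
    unfolding bounded_support_def
  proof (intro allI impI)
    fix c j assume "(\<Sum>w | int_exponent (growth_exponent S i w) = c. coef w) \<noteq> 0"
    then have "{w. int_exponent (growth_exponent S i w) = c} \<noteq> {}"
      by (rule contrapos_nn) (simp only: sum.empty)
    then obtain w where "int_exponent (growth_exponent S i w) = c"
      by blast
    then show "Poly_Mapping.lookup 0 j \<le> Poly_Mapping.lookup c j"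
      by (auto simp: int_exponent_def Poly_Mapping.map.rep_eq when_def)
  qed
  then show ?thesis
    unfolding weighted_growth_def by (subst Abs_laurent_inverse) auto
qed

definition growth_series :: "'w::group_add set \<Rightarrow> ('w \<Rightarrow> 'i) \<Rightarrow> ('i, rat) laurent" where
  "growth_series S i = weighted_growth S i (\<lambda>w. 1)"

definition complete_growth_series ::
  "'w::group_add set \<Rightarrow> ('w \<Rightarrow> 'i) \<Rightarrow> ('i, 'w \<Rightarrow>\<^sub>0 rat) laurent" where
  "complete_growth_series S i = weighted_growth S i (\<lambda>w. Poly_Mapping.single w 1)"

end

theory Submission
  imports Defs "Jordan_Normal_Form.Determinant"
begin

text \<open>
  For a face \<open>\<sigma>\<close> of the nerve let \<open>H \<sigma>\<close> be the sum of \<open>w t\<^sup>w\<close> over all \<open>w\<close> whose right descent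
  set contains \<open>\<sigma>\<close>. Splitting off one generator gives \<open>H (\<sigma> \<union> {s}) = H \<sigma> s t / (1 + s t)\<close>, where
  \<open>t\<close> is the indeterminate of \<open>s\<close>, and inclusion-exclusion over the descent sets, which are exactly
  faces, gives \<open>\<Sum>\<^sub>\<sigma> (- 1)\<^bsup>card \<sigma>\<^esup> H \<sigma> = 1\<close>. Hence the complete growth series is the inverse of
  \<open>\<Sum>\<^sub>\<sigma> \<Prod>\<^bsub>s \<in> \<sigma>\<^esub> x\<^sub>s\<close> with \<open>x\<^sub>s = - s t / (1 + s t)\<close>. Inverting the indeterminates replaces \<open>x\<^sub>s\<close>
  by \<open>- 1 - x\<^sub>s\<close>; after expanding, the coefficient of \<open>\<Prod>\<^bsub>s \<in> \<tau>\<^esub> x\<^sub>s\<close> is an Euler characteristic of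
  the link of \<open>\<tau>\<close>, which the Eulerian sphere condition evaluates.

  That the value at the inverted indeterminates does not depend on the expression rests on
  residual finiteness: finite permutation representations separate the elements of the group ring,
  and over matrices with commuting entries Cramer's rule turns an identity of values into a
  polynomial identity, which survives the inversion.
\<close>

section \<open>Right-angled Coxeter groups\<close>

text \<open>Put \<open>y = s t\<close>. Since \<open>s\<close> is an involution, \<open>s\<close>
  times the inverse of \<open>t\<close> is the inverse of \<open>y\<close>, so inverting the
  indeterminates sends \<open>x = - y / (1 + y)\<close> to \<open>- 1 / (1 + y)\<close>, which is
  \<open>- 1 - x\<close>.

  Two obstacles shape the proof. The group is given by a presentation only, so nothing about lengths
  or descents is available at the start; both the well-definedness of descents and the finite
  representations come from explicit actions, for which the relations need checking on involutions
  and commuting pairs only. And the group ring need not be commutative: products over generators are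
  taken in a fixed order, and a fraction is used only over a central denominator. As
  \<open>(1 + y) (1 - y) = 1 - t^2\<close> is central, every \<open>x\<close> is written over it as
  \<open>(t^2 - y) / (1 - t^2)\<close>.

  The independence claim concerns arbitrary matrices \<open>Q\<close>, not only the one constructed
  for existence. It suffices that the polynomial relation satisfied by the series is inherited by
  every such value: at the inverted indeterminates its left factor is a unit, so it has just one
  solution.\<close>

locale racg =
  fixes S :: "'w::group_add set" and m :: "'w \<Rightarrow> 'w \<Rightarrow> enat"
  assumes finite_gens: "finite S"
    and coxeter: "coxeter_system S m"
    and right_angled: "right_angled S m"
begin

text \<open>The diagonal is included, because \<open>m a a = 1\<close>. A generator that commutes
  with all others still occurs in the pair with itself, so no generator is invisible to the
  projections.\<close>

definition nc :: "'w \<Rightarrow> 'w \<Rightarrow> bool" where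
  "nc a b \<longleftrightarrow> a \<in> S \<and> b \<in> S \<and> m a b \<noteq> 2"

lemma nc_sym: "nc a b \<Longrightarrow> nc b a"
  using coxeter by (auto simp: nc_def coxeter_system_def)

lemma nc_refl: "a \<in> S \<Longrightarrow> nc a a"
proof -
  assume a: "a \<in> S"
  then have "m a a = 1" using coxeter unfolding coxeter_system_def by blast
  then have "m a a \<noteq> 2" by simp
  with a show ?thesis by (simp add: nc_def)
qed

section \<open>Consequences of the Coxeter relations\<close>

lemma word_value_eq_iff:
  "u \<in> lists (S \<times> UNIV) \<Longrightarrow> v \<in> lists (S \<times> UNIV) \<Longrightarrow>
    word_value u = word_value v \<longleftrightarrow> presented_eq S (coxeter_relators S m) u v"
  using coxeter unfolding coxeter_system_def has_presentation_def by blast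

lemma alternating_in_lists:
  "s \<in> S \<Longrightarrow> s' \<in> S \<Longrightarrow> concat (replicate n [(s, True), (s', True)]) \<in> lists (S \<times> UNIV)"
  by (induction n) auto

lemma relator_trivial:
  assumes "s \<in> S" "s' \<in> S" "m s s' = enat n"
  shows "word_value (concat (replicate n [(s, True), (s', True)])) = 0"
proof -
  let ?r = "concat (replicate n [(s, True), (s', True)])"
  have r: "?r \<in> lists (S \<times> UNIV)" using assms by (intro alternating_in_lists)
  have "?r \<in> coxeter_relators S m" unfolding coxeter_relators_def using assms by blast
  from presented_eq.relator[OF _ _ this, of "[]" S "[]"]
  have "presented_eq S (coxeter_relators S m) ?r []" by simp
  then have "word_value ?r = word_value []" using word_value_eq_iff[OF r, of "[]"] by simp
  then show ?thesis by (simp add: word_value_def)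
qed

lemma gen_involution: "s \<in> S \<Longrightarrow> s + s = 0"
proof -
  assume s: "s \<in> S"
  then have "m s s = 1" using coxeter unfolding coxeter_system_def by blast
  then have "m s s = enat 1" by (simp add: one_enat_def)
  from relator_trivial[OF s s this] show ?thesis by (simp add: word_value_def)
qed

lemma gen_involution': "s \<in> S \<Longrightarrow> w + s + s = w"
  by (simp add: gen_involution add.assoc)

lemma gen_uminus: "s \<in> S \<Longrightarrow> - s = s"
  using gen_involution[of s] by (metis minus_unique)

lemma gens_commute:
  assumes "a \<in> S" "b \<in> S" "\<not> nc a b"
  shows "a + b = b + a"
proof -
  have "m a b = enat 2" using assms by (simp add: nc_def numeral_eq_enat)
  from relator_trivial[OF assms(1,2) this] have "a + (b + (a + b)) = 0"
    by (simp add: word_value_def numeral_2_eq_2)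
  then have "a + b = - (a + b)" by (metis add.assoc minus_unique)
  then show ?thesis using assms by (simp add: minus_add gen_uminus)
qed

lemma gens_commute':
  assumes "a \<in> S" "b \<in> S" "\<not> nc a b"
  shows "w + a + b = w + b + a"
  using gens_commute[OF assms] by (simp add: add.assoc)

text \<open>Hence the only relators are squares of generators and squares of products of two
  commuting generators; checking relations comes down to these two cases.\<close>

lemma m_cases:
  assumes "a \<in> S" "b \<in> S" "m a b = enat n"
  shows "a = b \<and> n = 1 \<or> a \<noteq> b \<and> n = 2 \<and> \<not> nc a b"
proof (cases "a = b")
  case True
  then have "m a b = 1" using coxeter assms(1) unfolding coxeter_system_def by blast
  then show ?thesis using assms True by (simp add: one_enat_def)
next
  case False
  then have "m a b \<in> {2, \<infinity>}" using right_angled assms unfolding right_angled_def by blast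
  then show ?thesis using assms False by (auto simp: nc_def numeral_eq_enat)
qed

lemma group_induct [case_names zero step]:
  assumes "P 0" and "\<And>w s. s \<in> S \<Longrightarrow> P w \<Longrightarrow> P (w + s)"
  shows "P (w :: 'w)"
proof -
  have "w \<in> generated_subgroup S"
    using coxeter unfolding coxeter_system_def has_presentation_def by auto
  then obtain u where u: "u \<in> lists (S \<times> UNIV)" "w = word_value u"
    unfolding generated_subgroup_def by blast
  have "P (word_value u)" using u(1)
  proof (induction u rule: rev_induct)
    case Nil then show ?case by (simp add: word_value_def assms)
  next
    case (snoc x xs)
    obtain s b where x: "x = (s, b)" by force
    then have "word_value (xs @ [x]) = word_value xs + s"
      using snoc.prems by (auto simp: word_value_def gen_uminus)
    then show ?case using snoc x assms(2) by auto
  qed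
  then show ?thesis by (simp add: u(2))
qed

text \<open>The universal property of the presentation, for right actions on a subset of a type.\<close>

lemma right_action_exists:
  fixes \<alpha> :: "'w \<Rightarrow> 'x \<Rightarrow> 'x"
  assumes closed: "\<And>s x. s \<in> S \<Longrightarrow> x \<in> X \<Longrightarrow> \<alpha> s x \<in> X"
    and inv: "\<And>s x. s \<in> S \<Longrightarrow> x \<in> X \<Longrightarrow> \<alpha> s (\<alpha> s x) = x"
    and comm: "\<And>a b x. a \<in> S \<Longrightarrow> b \<in> S \<Longrightarrow> a \<noteq> b \<Longrightarrow> \<not> nc a b \<Longrightarrow> x \<in> X \<Longrightarrow>
      \<alpha> a (\<alpha> b x) = \<alpha> b (\<alpha> a x)"
  obtains act where "\<And>x. x \<in> X \<Longrightarrow> act 0 x = x"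
    and "\<And>w x. x \<in> X \<Longrightarrow> act w x \<in> X"
    and "\<And>w s x. s \<in> S \<Longrightarrow> x \<in> X \<Longrightarrow> act (w + s) x = \<alpha> s (act w x)"
    and "\<And>v w x. x \<in> X \<Longrightarrow> act (v + w) x = act w (act v x)"
proof -
  \<comment> \<open>\<open>fold\<close> applies the first letter first, as a right action requires;
    a letter and its formal inverse act alike because generators are involutions.\<close>
  define F where "F u = fold (\<lambda>(s, b :: bool). \<alpha> s) u" for u
  have F_Nil: "F [] x = x" and F_app: "F (u @ v) x = F v (F u x)" for u v x
    by (auto simp: F_def)
  have F_Cons: "F ((s, b) # u) x = F u (\<alpha> s x)" for s b u x
    by (auto simp: F_def)
  have F_closed: "x \<in> X \<Longrightarrow> F u x \<in> X" if "u \<in> lists (S \<times> UNIV)" for u x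
    using that by (induction u arbitrary: x) (auto simp: F_Nil F_Cons closed)
  have rel: "F r x = x" if "r \<in> coxeter_relators S m" "x \<in> X" for r x
  proof -
    from that(1) obtain s s' n where r: "r = concat (replicate n [(s, True), (s', True)])"
      "s \<in> S" "s' \<in> S" "m s s' = enat n" unfolding coxeter_relators_def by blast
    from m_cases[OF r(2-)] show ?thesis
    proof (elim disjE conjE)
      assume "s = s'" "n = 1" then show ?thesis using r that(2) by (simp add: F_Nil F_Cons inv)
    next
      assume *: "n = 2" "\<not> nc s s'" "s \<noteq> s'"
      then have "F r x = \<alpha> s' (\<alpha> s (\<alpha> s' (\<alpha> s x)))"
        using r by (simp add: F_Nil F_Cons numeral_2_eq_2)
      also have "\<dots> = x" using comm[OF r(2,3) *(3,2)] r that(2) by (simp add: closed inv)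
      finally show ?thesis .
    qed
  qed
  have in_lists: "u \<in> lists (S \<times> UNIV) \<and> v \<in> lists (S \<times> UNIV)"
    if "presented_eq S (coxeter_relators S m) u v" for u v
    using that
  proof induction
    case (relator u v r)
    then have "r \<in> lists (S \<times> UNIV)"
      unfolding coxeter_relators_def using alternating_in_lists by blast
    with relator show ?case by simp
  qed auto
  have pres: "x \<in> X \<Longrightarrow> F u x = F v x"
    if "presented_eq S (coxeter_relators S m) u v" for u v x
    using that
  proof (induction arbitrary: x)
    case (cancel u v s b)
    then show ?case by (simp add: F_app F_Cons F_Nil inv F_closed)
  next
    case (relator u v r)
    then show ?case by (simp add: F_app rel F_closed)
  qed auto
  define word where "word w = (SOME u. u \<in> lists (S \<times> UNIV) \<and> word_value u = w)" for w :: 'w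
  have word: "word w \<in> lists (S \<times> UNIV) \<and> word_value (word w) = w" for w
  proof -
    have "w \<in> generated_subgroup S"
      using coxeter unfolding coxeter_system_def has_presentation_def by auto
    then have "\<exists>u. u \<in> lists (S \<times> UNIV) \<and> word_value u = w"
      unfolding generated_subgroup_def by blast
    then show ?thesis unfolding word_def by (rule someI_ex)
  qed
  define act where "act w x = F (word w) x" for w x
  have act_eq: "act w x = F u x" if "u \<in> lists (S \<times> UNIV)" "word_value u = w" "x \<in> X" for w u x
    unfolding act_def using pres word word_value_eq_iff that by blast
  show ?thesis
  proof
    fix x assume x: "x \<in> X"
    show "act 0 x = x" using act_eq[of "[]" 0 x] x by (simp add: word_value_def F_Nil)
  next
    fix w x assume x: "x \<in> X"
    then show "act w x \<in> X" unfolding act_def using F_closed word by blast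
  next
    fix w s x assume x: "x \<in> X" and s: "s \<in> S"
    have "act (w + s) x = F (word w @ [(s, True)]) x"
      by (rule act_eq) (use word[of w] s x in \<open>auto simp: word_value_def\<close>)
    then show "act (w + s) x = \<alpha> s (act w x)" by (simp add: F_app F_Cons F_Nil act_def)
  next
    fix v w x assume x: "x \<in> X"
    have "act (v + w) x = F (word v @ word w) x"
      by (rule act_eq) (use word[of w] word[of v] x in \<open>auto simp: word_value_def\<close>)
    then show "act (v + w) x = act w (act v x)" by (simp add: F_app act_def)
  qed
qed

text \<open>
  A reduced expression is projected to each pair \<open>(a, b)\<close> of noncommuting generators (including
  \<open>a = b\<close>), last letter first. The resulting words do not depend on the expression, and \<open>s\<close> is a
  descent if and only if it is the first letter of every word it can occur in.
\<close>

definition push :: "'w \<Rightarrow> ('w \<Rightarrow> 'w \<Rightarrow> 'w list) \<Rightarrow> 'w \<Rightarrow> 'w \<Rightarrow> 'w list" where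
  "push s f = (\<lambda>a b. if nc a b \<and> (a = s \<or> b = s) then s # f a b else f a b)"

definition pop :: "'w \<Rightarrow> ('w \<Rightarrow> 'w \<Rightarrow> 'w list) \<Rightarrow> 'w \<Rightarrow> 'w \<Rightarrow> 'w list" where
  "pop s f = (\<lambda>a b. if nc a b \<and> (a = s \<or> b = s) then tl (f a b) else f a b)"

definition on_top :: "'w \<Rightarrow> ('w \<Rightarrow> 'w \<Rightarrow> 'w list) \<Rightarrow> bool" where
  "on_top s f \<longleftrightarrow> (\<forall>a b. nc a b \<and> (a = s \<or> b = s) \<longrightarrow> (\<exists>l. f a b = s # l))"

lemma pop_push: "pop s (push s f) = f"
  by (auto simp: pop_def push_def fun_eq_iff)

lemma push_pop: "on_top s f \<Longrightarrow> push s (pop s f) = f"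
  by (fastforce simp: pop_def push_def on_top_def fun_eq_iff)

lemma on_top_push: "on_top s (push s f)"
  by (auto simp: on_top_def push_def)

context
  fixes a b
  assumes ab: "a \<noteq> b" "\<not> nc a b"
begin

text \<open>Words of pairs that contain \<open>a\<close> are untouched by operations of a generator
  \<open>b\<close> that commutes with \<open>a\<close>; all the commutation rules below rest on
  this.\<close>

lemma disjoint_pairs: "nc x y \<Longrightarrow> x = a \<or> y = a \<Longrightarrow> \<not> (x = b \<or> y = b)"
  using ab nc_sym by blast

lemma push_other: "nc x y \<Longrightarrow> x = a \<or> y = a \<Longrightarrow> push b f x y = f x y"
  using disjoint_pairs unfolding push_def by presburger

lemma pop_other: "nc x y \<Longrightarrow> x = a \<or> y = a \<Longrightarrow> pop b f x y = f x y"
  using disjoint_pairs unfolding pop_def by presburger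

lemma on_top_push_commute: "on_top a (push b f) = on_top a f"
  by (auto simp: on_top_def push_other)

lemma on_top_pop_commute: "on_top a (pop b f) = on_top a f"
  by (auto simp: on_top_def pop_other)

lemma push_commute: "push a (push b f) = push b (push a f)"
proof (intro ext)
  fix x y show "push a (push b f) x y = push b (push a f) x y"
    using disjoint_pairs[of x y] by (cases "nc x y \<and> (x = a \<or> y = a)") (auto simp: push_def)
qed

lemma pop_push_commute: "pop a (push b f) = push b (pop a f)"
proof (intro ext)
  fix x y show "pop a (push b f) x y = push b (pop a f) x y"
    using disjoint_pairs[of x y] by (cases "nc x y \<and> (x = a \<or> y = a)") (auto simp: push_def pop_def)
qed

lemma pop_commute: "pop a (pop b f) = pop b (pop a f)"
proof (intro ext)
  fix x y show "pop a (pop b f) x y = pop b (pop a f) x y"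
    using disjoint_pairs[of x y] by (cases "nc x y \<and> (x = a \<or> y = a)") (auto simp: pop_def)
qed

end

text \<open>Both letters would have to head the word of the pair \<open>(a, b)\<close>. Consequently
  distinct descents of one element commute.\<close>

lemma on_top_unique: "nc a b \<Longrightarrow> on_top a f \<Longrightarrow> on_top b f \<Longrightarrow> a = b"
  unfolding on_top_def by (metis list.inject)

text \<open>The second rule admits only letters that are not on top, that is, letters that do not
  cancel, so a derivation spells a reduced word of the group element. That an element has exactly
  one state is not built in; it is the content of \<open>state_exists\<close>.\<close>

inductive reach :: "('w \<Rightarrow> 'w \<Rightarrow> 'w list) \<Rightarrow> 'w \<Rightarrow> bool" where
  init: "reach (\<lambda>_ _. []) 0"
| step: "reach f w \<Longrightarrow> s \<in> S \<Longrightarrow> \<not> on_top s f \<Longrightarrow> reach (push s f) (w + s)"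

text \<open>A form of the exchange condition. If the last letter \<open>b\<close> differs from
  \<open>s\<close>, both are on top, hence they commute, and \<open>s\<close> was on top already
  before \<open>b\<close> was pushed; so \<open>s\<close> can be removed there and \<open>b\<close>
  pushed again. That \<open>s\<close> is not on top afterwards is what makes toggling an
  involution.\<close>

lemma reach_pop:
  assumes "reach f w" "s \<in> S" "on_top s f"
  shows "reach (pop s f) (w + s) \<and> \<not> on_top s (pop s f)"
  using assms
proof (induction arbitrary: s)
  case (init s)
  then show ?case using nc_refl[of s] by (auto simp: on_top_def)
next
  case (step f w b s)
  show ?case
  proof (cases "b = s")
    case True
    then show ?thesis using step by (simp add: pop_push gen_involution')
  next
    case False
    have n: "\<not> nc s b" using on_top_unique[of s b "push b f"] step.prems False on_top_push by auto
    then have n': "\<not> nc b s" using nc_sym by blast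
    have "on_top s f" using on_top_push_commute[of s b f] step.prems False n by auto
    then have IH: "reach (pop s f) (w + s)" "\<not> on_top s (pop s f)" using step by auto
    have "\<not> on_top b (pop s f)" using on_top_pop_commute[OF False n'] step by auto
    then have "reach (push b (pop s f)) (w + s + b)" using IH step by (intro reach.step) auto
    then show ?thesis
      using pop_push_commute[of s b f] on_top_push_commute[of s b "pop s f"] IH False n
        gens_commute'[of s b w] step by auto
  qed
qed

definition toggle :: "'w \<Rightarrow> ('w \<Rightarrow> 'w \<Rightarrow> 'w list) \<Rightarrow> 'w \<Rightarrow> 'w \<Rightarrow> 'w list" where
  "toggle s f = (if on_top s f then pop s f else push s f)"

lemma reach_toggle: "reach f w \<Longrightarrow> s \<in> S \<Longrightarrow> reach (toggle s f) (w + s)"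
  unfolding toggle_def using reach_pop reach.step by auto

lemma toggle_toggle: "reach f w \<Longrightarrow> s \<in> S \<Longrightarrow> toggle s (toggle s f) = f"
  unfolding toggle_def using reach_pop[of f w s] on_top_push pop_push push_pop by auto

lemma toggle_commute:
  assumes "a \<noteq> b" "\<not> nc a b"
  shows "toggle a (toggle b f) = toggle b (toggle a f)"
proof -
  have "b \<noteq> a" "\<not> nc b a" using assms nc_sym by auto
  note * = this assms
  show ?thesis unfolding toggle_def
    by (auto simp: on_top_push_commute * on_top_pop_commute push_commute[OF assms]
        pop_push_commute * pop_commute[OF assms])
qed

text \<open>Toggling models right multiplication by a generator. It is shown to be an involution on
  reachable states only, which is why the action is taken on a subset. The group therefore acts
  there, and the image of the empty state under \<open>w\<close> no longer refers to a word for
  \<open>w\<close>.\<close>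

lemma state_exists: "\<exists>st. \<forall>f w. reach f w \<longleftrightarrow> f = st w"
proof -
  obtain act where act: "\<And>x. x \<in> {f. \<exists>w. reach f w} \<Longrightarrow> act 0 x = x"
    "\<And>w s x. s \<in> S \<Longrightarrow> x \<in> {f. \<exists>w. reach f w} \<Longrightarrow> act (w + s) x = toggle s (act w x)"
    by (rule right_action_exists[of "{f. \<exists>w. reach f w}" toggle])
      (use reach_toggle toggle_toggle toggle_commute in \<open>blast+\<close>)
  let ?e = "\<lambda>_ _. []"
  have e: "?e \<in> {f. \<exists>w. reach f w}" using reach.init by blast
  have 1: "reach (act w ?e) w" for w
  proof (induction w rule: group_induct)
    case zero show ?case using act(1)[OF e] reach.init by simp
  next
    case (step w s) then show ?case using act(2)[OF _ e] reach_toggle by simp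
  qed
  have 2: "f = act w ?e" if "reach f w" for f w
    using that
  proof induction
    case init then show ?case using act(1)[OF e] by simp
  next
    case (step f w s) then show ?case using act(2)[OF _ e] by (simp add: toggle_def)
  qed
  show ?thesis by (rule exI[of _ "\<lambda>w. act w ?e"]) (use 1 2 in blast)
qed

definition state :: "'w \<Rightarrow> 'w \<Rightarrow> 'w \<Rightarrow> 'w list" where
  "state = (SOME st. \<forall>f w. reach f w \<longleftrightarrow> f = st w)"

lemma reach_iff: "reach f w \<longleftrightarrow> f = state w"
  using someI_ex[OF state_exists] unfolding state_def by blast

section \<open>Descents, length and exponent vectors\<close>

definition descents :: "'w \<Rightarrow> 'w set" where
  "descents w = {s \<in> S. on_top s (state w)}"

text \<open>The word of the diagonal pair \<open>(s, s)\<close> is a power of \<open>s\<close>, so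
  its length counts the occurrences of \<open>s\<close> in a reduced word.\<close>

definition len :: "'w \<Rightarrow> nat" where
  "len w = (\<Sum>s\<in>S. length (state w s s))"

definition exponent :: "('w \<Rightarrow> 'i) \<Rightarrow> 'w \<Rightarrow> ('i \<Rightarrow>\<^sub>0 nat)" where
  "exponent i w = (\<Sum>s\<in>S. Poly_Mapping.single (i s) (length (state w s s)))"

lemma descents_subset: "descents w \<subseteq> S"
  by (auto simp: descents_def)

lemma finite_descents: "finite (descents w)"
  using descents_subset finite_gens finite_subset by blast

lemma state_zero: "state 0 = (\<lambda>_ _. [])"
  using reach.init reach_iff by metis

lemma state_ascent: "s \<in> S \<Longrightarrow> s \<notin> descents w \<Longrightarrow> state (w + s) = push s (state w)"
  using reach.step[of "state w" w s] by (auto simp: reach_iff descents_def)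

lemma len_zero [simp]: "len 0 = 0"
  by (simp add: len_def state_zero)

lemma exponent_zero [simp]: "exponent i 0 = 0"
  by (simp add: exponent_def state_zero)

lemma len_ascent: assumes "s \<in> S" "s \<notin> descents w" shows "len (w + s) = Suc (len w)"
proof -
  have "len (w + s) = (\<Sum>a\<in>S. length (state w a a) + (if a = s then 1 else 0))"
    unfolding len_def state_ascent[OF assms] push_def using nc_refl by (intro sum.cong) auto
  then show ?thesis using assms finite_gens by (simp add: sum.distrib len_def)
qed

lemma exponent_ascent:
  assumes "s \<in> S" "s \<notin> descents w"
  shows "exponent i (w + s) = exponent i w + Poly_Mapping.single (i s) 1"
proof -
  have "exponent i (w + s) = (\<Sum>a\<in>S. Poly_Mapping.single (i a) (length (state w a a)) +
      (if a = s then Poly_Mapping.single (i a) 1 else 0))"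
    unfolding exponent_def state_ascent[OF assms] push_def using nc_refl
    by (intro sum.cong) (auto simp: single_add[symmetric])
  then show ?thesis using assms finite_gens by (simp add: sum.distrib exponent_def)
qed

lemma descent_after_ascent: "s \<in> S \<Longrightarrow> s \<notin> descents w \<Longrightarrow> s \<in> descents (w + s)"
  using state_ascent on_top_push by (auto simp: descents_def)

lemma ascent_after_descent: "s \<in> descents w \<Longrightarrow> s \<notin> descents (w + s)"
  using reach_pop[of "state w" w s] by (auto simp: reach_iff descents_def)

lemma descents_commute_ascent:
  assumes "s \<in> S" "s \<notin> descents w" "b \<noteq> s" "\<not> nc b s"
  shows "b \<in> descents (w + s) \<longleftrightarrow> b \<in> descents w"
  using state_ascent[OF assms(1,2)] on_top_push_commute[OF assms(3,4)] by (auto simp: descents_def)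

lemma descents_commute:
  assumes "s \<in> S" "b \<noteq> s" "\<not> nc b s"
  shows "b \<in> descents (w + s) \<longleftrightarrow> b \<in> descents w"
proof (cases "s \<in> descents w")
  case False then show ?thesis using descents_commute_ascent assms by blast
next
  case True
  from descents_commute_ascent[OF assms(1) ascent_after_descent[OF True] assms(2,3)]
  show ?thesis using assms gen_involution' by simp
qed

lemma descents_clique: "a \<in> descents w \<Longrightarrow> b \<in> descents w \<Longrightarrow> nc a b \<Longrightarrow> a = b"
  using on_top_unique unfolding descents_def by blast

lemma descents_empty_iff: "descents w = {} \<longleftrightarrow> w = 0"
proof
  assume *: "descents w = {}"
  have "reach (state w) w" by (simp add: reach_iff)
  then show "w = 0"
  proof cases
    case (step f v s)
    then have "s \<in> descents w" using on_top_push[of s f] by (auto simp: descents_def)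
    with * show ?thesis by simp
  qed
next
  show "w = 0 \<Longrightarrow> descents w = {}"
    using nc_refl by (auto simp: descents_def on_top_def state_zero)
qed

lemma len_descent: "s \<in> descents w \<Longrightarrow> Suc (len (w + s)) = len w"
  using len_ascent[of s "w + s"] ascent_after_descent[of s w] gen_involution' descents_subset
  by (metis subsetD)

text \<open>Each letter changes \<open>len\<close> by one up or down, so equality means that every
  letter was an ascent, and then the exponents add up along the word. Applied to a reduced
  expression this evaluates the monomial that the choice operator in \<open>growth_exponent\<close>
  hides.\<close>

lemma sum_list_len:
  assumes "ss \<in> lists S"
  shows "len (sum_list ss) \<le> length ss \<and>
    (len (sum_list ss) = length ss \<longrightarrow>
      exponent i (sum_list ss) = sum_list (map (\<lambda>s. Poly_Mapping.single (i s) 1) ss))"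
  using assms
proof (induction ss rule: rev_induct)
  case Nil then show ?case by simp
next
  case (snoc s ss)
  then have s: "s \<in> S" and IH: "len (sum_list ss) \<le> length ss"
     "len (sum_list ss) = length ss \<Longrightarrow>
      exponent i (sum_list ss) = sum_list (map (\<lambda>s. Poly_Mapping.single (i s) 1) ss)" by auto
  show ?case
  proof (cases "s \<in> descents (sum_list ss)")
    case True
    then show ?thesis using len_descent[OF True] IH by auto
  next
    case False
    then show ?thesis using len_ascent[OF s False] exponent_ascent[OF s False, of i] IH by auto
  qed
qed

text \<open>Descents are stripped until none is left, which happens only at \<open>0\<close>.
  Together with the previous bound this identifies \<open>len\<close> with the word length over
  \<open>S\<close>.\<close>

lemma word_of_length_len: "\<exists>ss \<in> lists S. sum_list ss = w \<and> length ss = len w"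
proof (induction "len w" arbitrary: w)
  case 0
  have "descents w = {}" using len_descent[of _ w] 0 by fastforce
  then show ?case using descents_empty_iff[of w] 0 by (intro bexI[of _ "[]"]) auto
next
  case (Suc n)
  then have "w \<noteq> 0" by auto
  then obtain s where s: "s \<in> descents w" using descents_empty_iff by blast
  then have "n = len (w + s)" using len_descent Suc(2) by fastforce
  from Suc(1)[OF this] obtain ss where ss: "ss \<in> lists S" "sum_list ss = w + s"
    "length ss = len (w + s)" by blast
  have "s \<in> S" using s descents_subset by blast
  then show ?case using ss gen_involution'[of s w] len_descent[OF s]
    by (intro bexI[of _ "ss @ [s]"]) auto
qed

lemma growth_exponent_eq: "growth_exponent S i w = exponent i w"
proof -
  obtain ss where ss: "ss \<in> lists S" "sum_list ss = w" "length ss = len w"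
    using word_of_length_len by blast
  have "reduced_expression S w ss"
    unfolding reduced_expression_def using ss sum_list_len by metis
  then have "reduced_expression S w (SOME ss. reduced_expression S w ss)"
    by (rule someI)
  moreover have "sum_list (map (\<lambda>s. Poly_Mapping.single (i s) 1) us) = exponent i w"
    if "reduced_expression S w us" for us
    using that sum_list_len[of us i] ss unfolding reduced_expression_def
    by (metis le_antisym)
  ultimately show ?thesis unfolding growth_exponent_def Let_def by blast
qed

lemma finite_len_le: "finite {w. len w \<le> n}"
proof (rule finite_subset)
  show "{w. len w \<le> n} \<subseteq> sum_list ` {ss. set ss \<subseteq> S \<and> length ss \<le> n}"
  proof
    fix w assume "w \<in> {w. len w \<le> n}"
    moreover obtain ss where "ss \<in> lists S" "sum_list ss = w" "length ss = len w"
      using word_of_length_len by blast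
    ultimately show "w \<in> sum_list ` {ss. set ss \<subseteq> S \<and> length ss \<le> n}" by auto
  qed
  show "finite (sum_list ` {ss. set ss \<subseteq> S \<and> length ss \<le> n})"
    using finite_lists_length_le[OF finite_gens] by simp
qed

text \<open>Finiteness of the subgroup is detected by lengths. Two distinct noncommuting members are
  never descents of the same element, so some member always lengthens it and lengths are unbounded.
  If all members commute, every product reduces to one with distinct factors, of length at most
  \<open>card S\<close>.\<close>

lemma nerve_iff: "\<sigma> \<in> nerve S \<longleftrightarrow> \<sigma> \<subseteq> S \<and> (\<forall>a\<in>\<sigma>. \<forall>b\<in>\<sigma>. nc a b \<longrightarrow> a = b)"
proof
  assume \<sigma>: "\<sigma> \<in> nerve S"
  have "a = b" if ab: "a \<in> \<sigma>" "b \<in> \<sigma>" "nc a b" for a b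
  proof (rule ccontr)
    assume "a \<noteq> b"
    have gen: "w + s \<in> generated_subgroup \<sigma>" if w: "w \<in> generated_subgroup \<sigma>" and s: "s \<in> \<sigma>" for w s
    proof -
      from w obtain u where "u \<in> lists (\<sigma> \<times> UNIV)" "w = word_value u"
        unfolding generated_subgroup_def by blast
      with s show ?thesis unfolding generated_subgroup_def
        by (intro image_eqI[of _ _ "u @ [(s, True)]"]) (auto simp: word_value_def)
    qed
    have "\<exists>w \<in> generated_subgroup \<sigma>. len w = n" for n
    proof (induction n)
      case 0
      then show ?case unfolding generated_subgroup_def
        by (intro bexI[of _ 0] image_eqI[of _ _ "[]"]) (auto simp: word_value_def)
    next
      case (Suc n)
      then obtain w where w: "w \<in> generated_subgroup \<sigma>" "len w = n" by blast
      obtain s where s: "s \<in> \<sigma>" "s \<notin> descents w"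
        using descents_clique[of a w b] ab \<open>a \<noteq> b\<close> by blast
      then have "s \<in> S" using \<sigma> by (auto simp: nerve_def)
      then show ?case using len_ascent[of s w] s w gen by blast
    qed
    then have "UNIV \<subseteq> len ` generated_subgroup \<sigma>" by (metis image_eqI subsetI)
    moreover have "finite (len ` generated_subgroup \<sigma>)" using \<sigma> by (simp add: nerve_def)
    ultimately show False using finite_subset infinite_UNIV_nat by blast
  qed
  then show "\<sigma> \<subseteq> S \<and> (\<forall>a\<in>\<sigma>. \<forall>b\<in>\<sigma>. nc a b \<longrightarrow> a = b)" using \<sigma> by (auto simp: nerve_def)
next
  assume \<sigma>: "\<sigma> \<subseteq> S \<and> (\<forall>a\<in>\<sigma>. \<forall>b\<in>\<sigma>. nc a b \<longrightarrow> a = b)"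
  then have sub: "\<sigma> \<subseteq> S" and cl: "\<And>a b. a \<in> \<sigma> \<Longrightarrow> b \<in> \<sigma> \<Longrightarrow> nc a b \<Longrightarrow> a = b" by auto
  have comm: "s + t = t + s" if "s \<in> \<sigma>" "t \<in> \<sigma>" for s t
    using gens_commute[of s t] cl[OF that] sub that by (cases "s = t") auto
  have comm_list: "s + sum_list l = sum_list l + s" if "s \<in> \<sigma>" "set l \<subseteq> \<sigma>" for s l
    using that(2)
  proof (induction l)
    case (Cons t l)
    then show ?case using comm[OF that(1), of t] by (simp add: add.assoc) (metis add.assoc)
  qed simp
  have closed: "\<exists>l'. distinct l' \<and> set l' \<subseteq> \<sigma> \<and> sum_list l + s = sum_list l'"
    if l: "distinct l" "set l \<subseteq> \<sigma>" and s: "s \<in> \<sigma>" for l s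
  proof (cases "s \<in> set l")
    case True
    then obtain l1 l2 where "l = l1 @ s # l2" by (meson split_list)
    moreover from this have "sum_list l + s = sum_list (l1 @ l2)"
      using comm_list[of s l2] l s gen_involution[of s] sub
      by (simp add: add.assoc) (metis add.assoc add_0 subsetD)
    ultimately show ?thesis using l by (intro exI[of _ "l1 @ l2"]) auto
  next
    case False
    then show ?thesis using l s by (intro exI[of _ "l @ [s]"]) auto
  qed
  have word: "\<exists>l. distinct l \<and> set l \<subseteq> \<sigma> \<and> word_value u = sum_list l" if "u \<in> lists (\<sigma> \<times> UNIV)" for u
    using that
  proof (induction u rule: rev_induct)
    case Nil
    show ?case by (intro exI[of _ "[]"]) (simp add: word_value_def)
  next
    case (snoc x u)
    obtain s b where x: "x = (s, b)" by force
    then have "word_value (u @ [x]) = word_value u + s" "s \<in> \<sigma>"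
      using snoc.prems sub gen_uminus by (auto simp: word_value_def)
    then show ?case using snoc closed by (metis append_in_lists_conv)
  qed
  have "len w \<le> card S" if w: "w \<in> generated_subgroup \<sigma>" for w
  proof -
    obtain l where l: "distinct l" "set l \<subseteq> \<sigma>" "w = sum_list l"
      using word w unfolding generated_subgroup_def by blast
    have "len w \<le> length l" using sum_list_len[of l] l sub by auto
    also have "\<dots> = card (set l)" using l distinct_card by metis
    also have "\<dots> \<le> card S" using l sub finite_gens by (intro card_mono) auto
    finally show ?thesis .
  qed
  then have "generated_subgroup \<sigma> \<subseteq> {w. len w \<le> card S}" by blast
  then show "\<sigma> \<in> nerve S" using finite_len_le[of "card S"] sub finite_subset
    unfolding nerve_def by blast
qed

end

section \<open>Laurent series\<close>

lemma laurent_eqI: "(\<And>c. laurent_coeff f c = laurent_coeff g c) \<Longrightarrow> f = g"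
  by (simp add: laurent_coeff_inject[symmetric] fun_eq_iff)

lemma laurent_coeff_zero [simp]: "laurent_coeff 0 c = 0"
  by (simp add: zero_laurent.rep_eq)

lemma laurent_coeff_one: "laurent_coeff 1 c = (if c = 0 then 1 else 0)"
  by (simp add: one_laurent.rep_eq)

lemma laurent_coeff_add [simp]: "laurent_coeff (f + g) c = laurent_coeff f c + laurent_coeff g c"
  by (simp add: plus_laurent.rep_eq)

lemma laurent_coeff_uminus [simp]: "laurent_coeff (- f) c = - laurent_coeff f c"
  by (simp add: uminus_laurent.rep_eq)

lemma laurent_coeff_diff [simp]: "laurent_coeff (f - g) c = laurent_coeff f c - laurent_coeff g c"
  by (subst minus_laurent_def) (simp only: laurent_coeff_add laurent_coeff_uminus diff_conv_add_uminus)

lemma laurent_coeff_sum: "laurent_coeff (sum F A) c = (\<Sum>x\<in>A. laurent_coeff (F x) c)"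
  by (induction A rule: infinite_finite_induct) auto

lemma bounded_support_laurent_coeff: obtains N where "bounded_support (laurent_coeff f) N"
  using laurent_coeff by blast

lemma finite_conv_support_laurent:
  fixes f g :: "('i, 'r::zero) laurent"
  shows "finite {a. laurent_coeff f a \<noteq> 0 \<and> laurent_coeff g (c - a) \<noteq> 0}"
proof -
  obtain M N where "bounded_support (laurent_coeff f) M" "bounded_support (laurent_coeff g) N"
    using bounded_support_laurent_coeff by metis
  then show ?thesis by (rule finite_conv_support)
qed

lemma laurent_coeff_mult:
  assumes "finite F" "{a. laurent_coeff f a \<noteq> 0 \<and> laurent_coeff g (c - a) \<noteq> 0} \<subseteq> F"
  shows "laurent_coeff (f * g) c = (\<Sum>a\<in>F. laurent_coeff f a * laurent_coeff g (c - a))"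
  unfolding times_laurent.rep_eq by (rule conv_eq_sum[OF assms])

lemma laurent_coeff_mult_monom:
  "laurent_coeff (f * laurent_monom r a) c = laurent_coeff f (c - a) * r"
  by (subst laurent_coeff_mult[of "{c - a}"]) (auto simp: laurent_coeff_monom)

lemma laurent_coeff_monom_mult:
  "laurent_coeff (laurent_monom r a * f) c = r * laurent_coeff f (c - a)"
  by (subst laurent_coeff_mult[of "{a}"]) (auto simp: laurent_coeff_monom)

lemma laurent_monom_zero [simp]: "laurent_monom 0 a = 0"
  by (rule laurent_eqI) (simp add: laurent_coeff_monom)

lemma laurent_monom_one: "laurent_monom 1 0 = 1"
  by (rule laurent_eqI) (simp add: laurent_coeff_monom laurent_coeff_one)

lemma laurent_monom_add: "laurent_monom (r + s) a = laurent_monom r a + laurent_monom (s :: 'r :: ring_1) a"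
  by (rule laurent_eqI) (simp add: laurent_coeff_monom)

instance laurent :: (type, comm_ring_1) comm_ring_1
proof
  fix f g :: "('a, 'b) laurent"
  show "f * g = g * f"
  proof (rule laurent_eqI)
    fix c
    let ?A = "{a. laurent_coeff f a \<noteq> 0 \<and> laurent_coeff g (c - a) \<noteq> 0}"
    let ?B = "{a. laurent_coeff g a \<noteq> 0 \<and> laurent_coeff f (c - a) \<noteq> 0}"
    have "laurent_coeff (f * g) c = (\<Sum>a\<in>?A. laurent_coeff f a * laurent_coeff g (c - a))"
      by (intro laurent_coeff_mult finite_conv_support_laurent) auto
    also have "\<dots> = (\<Sum>a\<in>?B. laurent_coeff g a * laurent_coeff f (c - a))"
      by (rule sum.reindex_bij_witness[of _ "\<lambda>a. c - a" "\<lambda>a. c - a"]) (auto simp: mult.commute)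
    also have "\<dots> = laurent_coeff (g * f) c"
      by (intro laurent_coeff_mult[symmetric] finite_conv_support_laurent) auto
    finally show "laurent_coeff (f * g) c = laurent_coeff (g * f) c" .
  qed
qed (simp_all add: distrib_right)

text \<open>Over a noncommutative group ring such elements can be moved freely through ordered
  products, which makes them suitable as denominators.\<close>

definition central :: "'a::ring_1 \<Rightarrow> bool" where
  "central z \<longleftrightarrow> (\<forall>x. z * x = x * z)"

lemma central_monom: "central r \<Longrightarrow> central (laurent_monom (r :: 'r :: ring_1) a)"
  unfolding central_def
  by (auto intro!: laurent_eqI simp: laurent_coeff_mult_monom laurent_coeff_monom_mult)

lemma central_1: "central 1"
  by (simp add: central_def)

lemma central_minus: "central x \<Longrightarrow> central (- x)"
  by (simp add: central_def)

lemma central_diff: "central x \<Longrightarrow> central y \<Longrightarrow> central (x - y)"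
  by (simp add: central_def left_diff_distrib right_diff_distrib)

lemma central_commute: "central z \<Longrightarrow> z * x = x * z"
  by (simp add: central_def)

lemma central_mult:
  assumes "central x" "central y"
  shows "central (x * y)"
  unfolding central_def
proof
  fix z
  have "x * y * z = x * (z * y)" using central_commute[OF assms(2), of z] by (simp add: mult.assoc)
  also have "\<dots> = z * (x * y)" using central_commute[OF assms(1), of z] by (simp flip: mult.assoc)
  finally show "x * y * z = z * (x * y)" .
qed

lemma central_prod_list: "(\<And>x. x \<in> set xs \<Longrightarrow> central x) \<Longrightarrow> central (prod_list xs)"
  by (induction xs) (auto simp: central_1 central_mult)

section \<open>Evaluation of polynomials\<close>

text \<open>The exponent map is a parameter, so that \<open>at_t\<close> and \<open>at_t_inv\<close>
  are two instances of one evaluation, multiplicative whenever \<open>h\<close> is additive.\<close>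

definition laurent_eval ::
  "(('i \<Rightarrow>\<^sub>0 nat) \<Rightarrow> ('i \<Rightarrow>\<^sub>0 int)) \<Rightarrow> (('i \<Rightarrow>\<^sub>0 nat) \<Rightarrow>\<^sub>0 'r::ring_1) \<Rightarrow> ('i, 'r) laurent" where
  "laurent_eval h p = (\<Sum>a\<in>Poly_Mapping.keys p. laurent_monom (Poly_Mapping.lookup p a) (h a))"

lemma at_t_eq_eval: "at_t = laurent_eval int_exponent"
  by (simp add: fun_eq_iff at_t_def laurent_eval_def)

lemma at_t_inv_eq_eval: "at_t_inv = laurent_eval (\<lambda>a. - int_exponent a)"
  by (simp add: fun_eq_iff at_t_inv_def laurent_eval_def)

lemma lookup_int_exponent: "Poly_Mapping.lookup (int_exponent a) i = int (Poly_Mapping.lookup a i)"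
  by (simp add: int_exponent_def Poly_Mapping.map.rep_eq when_def)

lemma int_exponent_add: "int_exponent (a + b) = int_exponent a + int_exponent b"
  by (rule poly_mapping_eqI) (simp add: lookup_int_exponent lookup_add)

lemma int_exponent_zero [simp]: "int_exponent 0 = 0"
  by (rule poly_mapping_eqI) (simp add: lookup_int_exponent)

lemma int_exponent_inject [simp]: "int_exponent a = int_exponent b \<longleftrightarrow> a = b"
proof
  assume *: "int_exponent a = int_exponent b"
  show "a = b"
  proof (rule poly_mapping_eqI)
    fix i
    from * have "int (Poly_Mapping.lookup a i) = int (Poly_Mapping.lookup b i)"
      by (simp flip: lookup_int_exponent)
    then show "Poly_Mapping.lookup a i = Poly_Mapping.lookup b i" by simp
  qed
qed simp

lemma laurent_eval_alt:
  assumes "finite A" "Poly_Mapping.keys p \<subseteq> A"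
  shows "laurent_eval h p = (\<Sum>a\<in>A. laurent_monom (Poly_Mapping.lookup p a) (h a))"
  unfolding laurent_eval_def using assms
  by (intro sum.mono_neutral_left) (auto simp: in_keys_iff)

lemma laurent_eval_add: "laurent_eval h (p + q) = laurent_eval h p + laurent_eval h q"
proof -
  let ?A = "Poly_Mapping.keys p \<union> Poly_Mapping.keys q"
  have "laurent_eval h (p + q) = (\<Sum>a\<in>?A. laurent_monom (Poly_Mapping.lookup (p + q) a) (h a))"
    by (rule laurent_eval_alt) (use keys_add[of p q] in auto)
  moreover have "laurent_eval h p = (\<Sum>a\<in>?A. laurent_monom (Poly_Mapping.lookup p a) (h a))"
    by (rule laurent_eval_alt) auto
  moreover have "laurent_eval h q = (\<Sum>a\<in>?A. laurent_monom (Poly_Mapping.lookup q a) (h a))"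
    by (rule laurent_eval_alt) auto
  ultimately show ?thesis by (simp add: lookup_add laurent_monom_add sum.distrib)
qed

lemma laurent_eval_zero [simp]: "laurent_eval h 0 = 0"
  by (simp add: laurent_eval_def)

lemma laurent_eval_single [simp]: "laurent_eval h (Poly_Mapping.single a r) = laurent_monom r (h a)"
  by (cases "r = 0") (simp_all add: laurent_eval_def)

lemma laurent_eval_uminus: "laurent_eval h (- p) = - laurent_eval h p"
  using laurent_eval_add[of h p "- p"] minus_unique[of "laurent_eval h p" "laurent_eval h (- p)"]
  by simp

lemma laurent_eval_diff: "laurent_eval h (p - q) = laurent_eval h p - laurent_eval h q"
  using laurent_eval_add[of h p "- q"] by (simp add: laurent_eval_uminus)

lemma laurent_eval_sum: "laurent_eval h (sum F A) = (\<Sum>x\<in>A. laurent_eval h (F x))"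
  by (induction A rule: infinite_finite_induct) (auto simp: laurent_eval_add)

lemma poly_mapping_sum_single:
  fixes p :: "'a \<Rightarrow>\<^sub>0 'b::comm_monoid_add"
  shows "p = (\<Sum>a\<in>Poly_Mapping.keys p. Poly_Mapping.single a (Poly_Mapping.lookup p a))"
  by (rule poly_mapping_eqI)
    (auto simp: lookup_sum lookup_single when_def in_keys_iff)

lemma poly_mapping_additive_induct [case_names add single]:
  fixes p :: "'a \<Rightarrow>\<^sub>0 'b::comm_monoid_add"
  assumes "\<And>p q. P p \<Longrightarrow> P q \<Longrightarrow> P (p + q)" "\<And>a r. P (Poly_Mapping.single a r)"
  shows "P p"
proof -
  have "P (\<Sum>a\<in>A. Poly_Mapping.single a (Poly_Mapping.lookup p a))" if "finite A" for A
    using that assms(2)[of undefined 0] by induction (auto intro: assms)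
  from this[of "Poly_Mapping.keys p"] poly_mapping_sum_single[of p] show ?thesis by simp
qed

lemma laurent_eval_mult:
  assumes "\<And>a b. h (a + b) = h a + h b"
  shows "laurent_eval h (p * q) = laurent_eval h p * laurent_eval h q"
proof (induction p rule: poly_mapping_additive_induct)
  case (add p p') then show ?case by (simp add: distrib_right laurent_eval_add)
next
  case (single a r)
  show ?case
    by (induction q rule: poly_mapping_additive_induct)
      (auto simp: distrib_left laurent_eval_add mult_single laurent_monom_mult assms)
qed

lemma laurent_eval_one: "h 0 = 0 \<Longrightarrow> laurent_eval h 1 = 1"
  using laurent_eval_single[of h 0 1] by (simp add: laurent_monom_one)

lemma laurent_coeff_at_t:
  "laurent_coeff (at_t p) (int_exponent a) = Poly_Mapping.lookup p a"
  by (auto simp: at_t_def laurent_coeff_sum laurent_coeff_monom in_keys_iff)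

lemma laurent_coeff_at_t_nonzero:
  "laurent_coeff (at_t p) c \<noteq> 0 \<Longrightarrow> \<exists>a. c = int_exponent a \<and> Poly_Mapping.lookup p a \<noteq> 0"
proof (rule ccontr)
  assume *: "laurent_coeff (at_t p) c \<noteq> 0"
    "\<nexists>a. c = int_exponent a \<and> Poly_Mapping.lookup p a \<noteq> 0"
  then have "laurent_coeff (at_t p) c = 0"
    unfolding at_t_def laurent_coeff_sum laurent_coeff_monom
    by (intro sum.neutral) (auto simp: in_keys_iff)
  with * show False by simp
qed

text \<open>The bridge to the inverted indeterminates: an identity of values at \<open>t\<close> is
  an identity of polynomials, and those may be evaluated at the inverses as well.\<close>

lemma at_t_inject: "at_t p = at_t q \<Longrightarrow> p = q"
  by (rule poly_mapping_eqI) (simp flip: laurent_coeff_at_t)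

lemmas at_t_simps =
  laurent_eval_add[of int_exponent, folded at_t_eq_eval]
  laurent_eval_diff[of int_exponent, folded at_t_eq_eval]
  laurent_eval_uminus[of int_exponent, folded at_t_eq_eval]
  laurent_eval_sum[of int_exponent, folded at_t_eq_eval]
  laurent_eval_zero[of int_exponent, folded at_t_eq_eval]
  laurent_eval_single[of int_exponent, folded at_t_eq_eval]
  laurent_eval_mult[of int_exponent, folded at_t_eq_eval, OF int_exponent_add]
  laurent_eval_one[of int_exponent, folded at_t_eq_eval, OF int_exponent_zero]

lemma uminus_int_exponent_add: "- int_exponent (a + b) = - int_exponent a + - int_exponent b"
  by (simp add: int_exponent_add)

lemma uminus_int_exponent_zero: "- int_exponent 0 = 0"
  by simp

lemmas at_t_inv_simps =
  laurent_eval_add[of "\<lambda>a. - int_exponent a", folded at_t_inv_eq_eval]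
  laurent_eval_diff[of "\<lambda>a. - int_exponent a", folded at_t_inv_eq_eval]
  laurent_eval_uminus[of "\<lambda>a. - int_exponent a", folded at_t_inv_eq_eval]
  laurent_eval_sum[of "\<lambda>a. - int_exponent a", folded at_t_inv_eq_eval]
  laurent_eval_zero[of "\<lambda>a. - int_exponent a", folded at_t_inv_eq_eval]
  laurent_eval_single[of "\<lambda>a. - int_exponent a", folded at_t_inv_eq_eval]
  laurent_eval_mult[of "\<lambda>a. - int_exponent a", folded at_t_inv_eq_eval, OF uminus_int_exponent_add]
  laurent_eval_one[of "\<lambda>a. - int_exponent a", folded at_t_inv_eq_eval, OF uminus_int_exponent_zero]

section \<open>Residual finiteness\<close>

text \<open>The points are the numbers below \<open>d\<close>, so that they can index the rows and
  columns of permutation matrices.\<close>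

locale finite_action =
  fixes d :: nat and act :: "'w::group_add \<Rightarrow> nat \<Rightarrow> nat"
  assumes act_less: "y < d \<Longrightarrow> act w y < d"
    and act_zero: "y < d \<Longrightarrow> act 0 y = y"
    and act_add: "y < d \<Longrightarrow> act (v + w) y = act w (act v y)"

context racg begin

text \<open>
  Over the field with two elements, let a generator \<open>s\<close> act as
  \<open>1 + T\<^sub>s\<close>, where \<open>T\<^sub>s\<close> sends the basis vector \<open>w\<close> to \<open>w + s\<close> if \<open>s\<close> is an ascent of \<open>w\<close>
  and to zero otherwise (the nil-Coxeter algebra). Truncated to a ball, this is an action on a
  finite set, and \<open>w\<close> moves the vector \<open>0\<close> to \<open>w\<close> plus basis vectors of smaller length.
\<close>

lemma separating_finite_action:
  obtains d and act :: "'w \<Rightarrow> nat \<Rightarrow> nat" and y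
  where "finite_action d act" "y < d" "inj_on (\<lambda>w. act w y) {w. len w \<le> n}"
proof -
  define B where "B = {w. len w \<le> n}"
  \<comment> \<open>A subset of the ball is a vector over the field with two elements, and
    \<open>\<noteq>\<close> is addition. The basis vector \<open>v\<close> receives a contribution
    from \<open>v + s\<close> exactly when \<open>s\<close> is an ascent of \<open>v + s\<close>,
    that is, a descent of \<open>v\<close>.\<close>
  define \<alpha> where "\<alpha> s A = {v \<in> B. (v \<in> A) \<noteq> (s \<in> descents v \<and> v + s \<in> A)}" for s and A :: "'w set"
  \<comment> \<open>The membership test for \<open>v\<close> consults only \<open>v\<close> and a
    shorter element, so truncation to the ball does not interfere with the relations.\<close>
  have B_descent: "v + s \<in> B" if "v \<in> B" "s \<in> descents v" for v s
    using len_descent[OF that(2)] that(1) by (simp add: B_def)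
  have closed: "\<alpha> s A \<in> Pow B" for s A by (auto simp: \<alpha>_def)
  \<comment> \<open>\<open>(1 + T)^2 = 1 + T^2\<close> in characteristic two, and
    \<open>T^2 = 0\<close> since \<open>s\<close> is never a descent of both \<open>v\<close> and
    \<open>v + s\<close>.\<close>
  have inv: "\<alpha> s (\<alpha> s A) = A" if "A \<in> Pow B" for s A
    using that ascent_after_descent[of s] B_descent unfolding \<alpha>_def by blast
  have comm: "\<alpha> a (\<alpha> b A) = \<alpha> b (\<alpha> a A)" if ab: "a \<in> S" "b \<in> S" "a \<noteq> b" "\<not> nc a b" for a b A
  proof -
    have "\<not> nc b a" using ab nc_sym by blast
    then have d: "b \<in> descents (v + a) \<longleftrightarrow> b \<in> descents v" "a \<in> descents (v + b) \<longleftrightarrow> a \<in> descents v"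
      "v + a + b = v + b + a" for v
      using descents_commute[of a b v] descents_commute[of b a v] gens_commute'[of a b v] ab by auto
    show ?thesis
      unfolding set_eq_iff
    proof
      fix v
      show "v \<in> \<alpha> a (\<alpha> b A) \<longleftrightarrow> v \<in> \<alpha> b (\<alpha> a A)"
        using B_descent[of v a] B_descent[of v b] d[of v]
        by (cases "a \<in> descents v"; cases "b \<in> descents v") (auto simp: \<alpha>_def)
    qed
  qed
  obtain act where act: "\<And>x. x \<in> Pow B \<Longrightarrow> act 0 x = x" "\<And>w x. x \<in> Pow B \<Longrightarrow> act w x \<in> Pow B"
    "\<And>w s x. s \<in> S \<Longrightarrow> x \<in> Pow B \<Longrightarrow> act (w + s) x = \<alpha> s (act w x)"
    "\<And>v w x. x \<in> Pow B \<Longrightarrow> act (v + w) x = act w (act v x)"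
  proof (rule right_action_exists[of "Pow B" \<alpha>])
    show "\<alpha> s x \<in> Pow B" for s x by (rule closed)
    show "\<alpha> s (\<alpha> s x) = x" if "x \<in> Pow B" for s x using inv that .
    show "\<alpha> a (\<alpha> b x) = \<alpha> b (\<alpha> a x)" if "a \<in> S" "b \<in> S" "a \<noteq> b" "\<not> nc a b" for a b x
      using comm that .
  qed blast
  have finB: "finite B" unfolding B_def by (rule finite_len_le)
  have 0: "{0} \<in> Pow B" by (simp add: B_def)
  have leading: "w \<in> act w {0} \<and> (\<forall>v \<in> act w {0}. v = w \<or> len v < len w)" if "len w \<le> n" for w
    using that
  proof (induction "len w" arbitrary: w)
    case 0
    then have "w = 0" using word_of_length_len[of w] by auto
    then show ?case using act(1)[OF \<open>{0} \<in> Pow B\<close>] by simp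
  next
    case (Suc k)
    then have "w \<noteq> 0" by auto
    then obtain s where s: "s \<in> descents w" using descents_empty_iff by blast
    define u where "u = w + s"
    have sS: "s \<in> S" using s descents_subset by blast
    have w: "w = u + s" using gen_involution'[OF sS] by (simp add: u_def)
    have lu: "Suc (len u) = len w" using len_descent[OF s] by (simp add: u_def)
    have IH: "u \<in> act u {0}" "\<And>v. v \<in> act u {0} \<Longrightarrow> v = u \<or> len v < len u"
      using Suc(1)[of u] Suc(2,3) lu by auto
    have eq: "act w {0} = \<alpha> s (act u {0})" unfolding w using act(3)[OF sS 0] .
    have "w \<notin> act u {0}" using IH(2)[of w] lu by auto
    then have "w \<in> act w {0}" unfolding eq using s IH(1) Suc.prems
      by (auto simp: \<alpha>_def B_def u_def)
    moreover have "v = w \<or> len v < len w" if v: "v \<in> act w {0}" for v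
    proof (cases "v \<in> act u {0}")
      case True then show ?thesis using IH(2)[of v] lu by auto
    next
      case False
      then have "s \<in> descents v" "v + s \<in> act u {0}" using v unfolding eq \<alpha>_def by auto
      then show ?thesis using IH(2)[of "v + s"] len_descent[of s v] lu w gen_involution'[OF sS, of v]
        by auto
    qed
    ultimately show ?case by blast
  qed
  \<comment> \<open>The unique longest member of the image recovers \<open>w\<close>.\<close>
  have inj: "inj_on (\<lambda>w. act w {0}) B"
  proof (rule inj_onI)
    fix v w assume "v \<in> B" "w \<in> B" "act v {0} = act w {0}"
    then show "v = w" using leading[of v] leading[of w] by (fastforce simp: B_def)
  qed
  obtain h where h: "bij_betw h {0..<card (Pow B)} (Pow B)"
    using ex_bij_betw_nat_finite finB by blast
  define g where "g = the_inv_into {0..<card (Pow B)} h"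
  have g: "g x < card (Pow B)" "h (g x) = x" if "x \<in> Pow B" for x
  proof -
    have "x \<in> h ` {0..<card (Pow B)}" "inj_on h {0..<card (Pow B)}"
      using h that by (simp_all add: bij_betw_def)
    then have "g x \<in> {0..<card (Pow B)}" unfolding g_def by (intro the_inv_into_into) auto
    then show "g x < card (Pow B)" by simp
    show "h (g x) = x" unfolding g_def by (rule f_the_inv_into_f_bij_betw[OF h that])
  qed
  have hg: "h y \<in> Pow B" "g (h y) = y" if "y < card (Pow B)" for y
  proof -
    have y: "y \<in> {0..<card (Pow B)}" using that by simp
    show "h y \<in> Pow B" using bij_betwE[OF h] y by blast
    show "g (h y) = y" unfolding g_def by (rule the_inv_into_f_f) (use h y in \<open>auto simp: bij_betw_def\<close>)
  qed
  show ?thesis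
  proof
    show "finite_action (card (Pow B)) (\<lambda>w y. g (act w (h y)))"
    proof
      fix y v w assume y: "y < card (Pow B)"
      show "g (act w (h y)) < card (Pow B)" by (intro g act hg y)
      show "g (act 0 (h y)) = y" using act(1)[OF hg(1)[OF y]] hg(2)[OF y] by simp
      show "g (act (v + w) (h y)) = g (act w (h (g (act v (h y)))))"
        using act(4)[OF hg(1)[OF y]] g(2)[OF act(2)[OF hg(1)[OF y]]] by simp
    qed
    show "g {0} < card (Pow B)" using g 0 by blast
    show "inj_on (\<lambda>w. g (act w (h (g {0})))) {w. len w \<le> n}"
    proof (rule inj_onI)
      fix v w assume vw: "v \<in> {w. len w \<le> n}" "w \<in> {w. len w \<le> n}"
        and "g (act v (h (g {0}))) = g (act w (h (g {0})))"
      then have "g (act v {0}) = g (act w {0})" using g(2)[OF 0] by simp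
      then have "act v {0} = act w {0}" using g(2)[OF act(2)[OF 0]] by metis
      then show "v = w" using inj vw by (auto simp: B_def inj_on_def)
    qed
  qed
qed

end

section \<open>Matrix representations\<close>

text \<open>Row and column indices of the flattened matrix are \<open>j * d + y\<close> for a row or column \<open>j\<close>
  of \<open>M\<close> and \<open>y < d\<close>.\<close>

definition flatten :: "nat \<Rightarrow> (nat \<Rightarrow> nat \<Rightarrow> 'a \<Rightarrow> 'b) \<Rightarrow> 'a mat \<Rightarrow> 'b mat" where
  "flatten d \<psi> M = mat (dim_row M * d) (dim_col M * d)
     (\<lambda>(p, q). \<psi> (p mod d) (q mod d) (M $$ (p div d, q div d)))"

text \<open>A ring homomorphism into \<open>d\<close> by \<open>d\<close> matrices, given by its
  entries, so that each entry can be applied separately to the coefficients of polynomials and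
  series.\<close>

locale matrix_hom =
  fixes d :: nat and \<psi> :: "nat \<Rightarrow> nat \<Rightarrow> 'a::ring_1 \<Rightarrow> 'b::ring_1"
  assumes add: "\<psi> y z (a + b) = \<psi> y z a + \<psi> y z b"
    and one: "y < d \<Longrightarrow> z < d \<Longrightarrow> \<psi> y z 1 = (if y = z then 1 else 0)"
    and mult: "y < d \<Longrightarrow> z < d \<Longrightarrow> \<psi> y z (a * b) = (\<Sum>x<d. \<psi> y x a * \<psi> x z b)"
begin

lemma zero [simp]: "\<psi> y z 0 = 0"
  using add[of y z 0 0] by simp

lemma sum: "\<psi> y z (sum f A) = (\<Sum>x\<in>A. \<psi> y z (f x))"
  by (induction A rule: infinite_finite_induct) (auto simp: add)

lemma diff: "\<psi> y z (a - b) = \<psi> y z a - \<psi> y z b"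
  using add[of y z "a - b" b] by simp

end

text \<open>The entry at \<open>(y, z)\<close> of the permutation representation. Rows are sources
  and columns are targets, so that a right action yields a homomorphism and not an
  antihomomorphism.\<close>

definition perm_coeff :: "('w::group_add \<Rightarrow> nat \<Rightarrow> nat) \<Rightarrow> nat \<Rightarrow> nat \<Rightarrow> ('w \<Rightarrow>\<^sub>0 rat) \<Rightarrow> rat" where
  "perm_coeff act y z x = (\<Sum>w\<in>Poly_Mapping.keys x. if act w y = z then Poly_Mapping.lookup x w else 0)"

lemma perm_coeff_alt:
  assumes "finite A" "Poly_Mapping.keys x \<subseteq> A"
  shows "perm_coeff act y z x = (\<Sum>w\<in>A. if act w y = z then Poly_Mapping.lookup x w else 0)"
  unfolding perm_coeff_def using assms
  by (intro sum.mono_neutral_left) (auto simp: in_keys_iff)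

lemma perm_coeff_add: "perm_coeff act y z (a + b) = perm_coeff act y z a + perm_coeff act y z b"
proof -
  let ?A = "Poly_Mapping.keys a \<union> Poly_Mapping.keys b"
  have "perm_coeff act y z c = (\<Sum>w\<in>?A. if act w y = z then Poly_Mapping.lookup c w else 0)"
    if "Poly_Mapping.keys c \<subseteq> ?A" for c
    by (rule perm_coeff_alt) (use that in auto)
  from this[of a] this[of b] this[of "a + b"] show ?thesis
    using keys_add[of a b] by (auto simp: lookup_add sum.distrib[symmetric] intro!: sum.cong)
qed

lemma perm_coeff_single [simp]:
  "perm_coeff act y z (Poly_Mapping.single w r) = (if act w y = z then r else 0)"
  by (cases "r = 0") (auto simp: perm_coeff_def)

lemma perm_coeff_zero [simp]: "perm_coeff act y z 0 = 0"
  by (simp add: perm_coeff_def)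

lemma (in finite_action) matrix_hom_perm_coeff: "matrix_hom d (perm_coeff act)"
proof
  fix y z :: nat and a b :: "'w \<Rightarrow>\<^sub>0 rat"
  show "perm_coeff act y z (a + b) = perm_coeff act y z a + perm_coeff act y z b"
    by (rule perm_coeff_add)
  assume yz: "y < d" "z < d"
  show "perm_coeff act y z 1 = (if y = z then 1 else 0)"
    using perm_coeff_single[of act y z 0 1] yz by (simp add: act_zero)
  show "perm_coeff act y z (a * b) = (\<Sum>x<d. perm_coeff act y x a * perm_coeff act x z b)"
  proof (induction a rule: poly_mapping_additive_induct)
    case (add p q) then show ?case by (simp add: distrib_right perm_coeff_add sum.distrib)
  next
    case (single v r)
    show ?case
    proof (induction b rule: poly_mapping_additive_induct)
      case (add p q) then show ?case by (simp add: distrib_left perm_coeff_add sum.distrib)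
    next
      case (single w s)
      have "(\<Sum>x<d. perm_coeff act y x (Poly_Mapping.single v r) * perm_coeff act x z (Poly_Mapping.single w s))
        = (\<Sum>x<d. if x = act v y then (if act w x = z then r * s else 0) else 0)"
        by (intro sum.cong) auto
      also have "\<dots> = (if act w (act v y) = z then r * s else 0)"
        using act_less[OF yz(1)] by simp
      finally show ?case using yz by (simp add: mult_single act_add)
    qed
  qed
qed

definition laurent_map :: "('r::zero \<Rightarrow> 's::zero) \<Rightarrow> ('i, 'r) laurent \<Rightarrow> ('i, 's) laurent" where
  "laurent_map \<phi> f = Abs_laurent (\<lambda>c. \<phi> (laurent_coeff f c))"

lemma laurent_coeff_map:
  assumes "\<phi> 0 = 0"
  shows "laurent_coeff (laurent_map \<phi> f) c = \<phi> (laurent_coeff f c)"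
proof -
  obtain N where "bounded_support (laurent_coeff f) N"
    using bounded_support_laurent_coeff by blast
  then have "bounded_support (\<lambda>c. \<phi> (laurent_coeff f c)) N"
    unfolding bounded_support_def using assms by metis
  then show ?thesis unfolding laurent_map_def by (subst Abs_laurent_inverse) auto
qed

lemma laurent_map_monom:
  "\<phi> 0 = 0 \<Longrightarrow> laurent_map \<phi> (laurent_monom r a) = laurent_monom (\<phi> r) a"
  by (rule laurent_eqI) (simp add: laurent_coeff_map laurent_coeff_monom)

context matrix_hom begin

lemma matrix_hom_laurent: "matrix_hom d (\<lambda>y z. laurent_map (\<psi> y z))"
proof
  fix y z :: nat and f g :: "('i, 'a) laurent"
  show "laurent_map (\<psi> y z) (f + g) = laurent_map (\<psi> y z) f + laurent_map (\<psi> y z) g"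
    by (rule laurent_eqI) (simp add: laurent_coeff_map add)
  assume yz: "y < d" "z < d"
  show "laurent_map (\<psi> y z) 1 = (if y = z then 1 else 0)"
    by (rule laurent_eqI) (simp add: laurent_coeff_map laurent_coeff_one one yz)
  show "laurent_map (\<psi> y z) (f * g) = (\<Sum>x<d. laurent_map (\<psi> y x) f * laurent_map (\<psi> x z) g)"
  proof (rule laurent_eqI)
    fix c
    \<comment> \<open>This set contains the corresponding set for every choice of entries, since
      entries of \<open>0\<close> vanish; one finite index set thus serves for all \<open>x\<close>,
      and the sums can be exchanged.\<close>
    let ?F = "{a. laurent_coeff f a \<noteq> 0 \<and> laurent_coeff g (c - a) \<noteq> 0}"
    have fin: "finite ?F" by (rule finite_conv_support_laurent)
    have "laurent_coeff (f * g) c = (\<Sum>a\<in>?F. laurent_coeff f a * laurent_coeff g (c - a))"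
      by (rule laurent_coeff_mult[OF fin]) simp
    then have "laurent_coeff (laurent_map (\<psi> y z) (f * g)) c =
        (\<Sum>a\<in>?F. \<Sum>x<d. \<psi> y x (laurent_coeff f a) * \<psi> x z (laurent_coeff g (c - a)))"
      by (simp add: laurent_coeff_map sum mult yz)
    also have "\<dots> = (\<Sum>x<d. \<Sum>a\<in>?F. \<psi> y x (laurent_coeff f a) * \<psi> x z (laurent_coeff g (c - a)))"
      by (rule sum.swap)
    also have "\<dots> = (\<Sum>x<d. laurent_coeff (laurent_map (\<psi> y x) f * laurent_map (\<psi> x z) g) c)"
    proof (rule sum.cong)
      fix x
      have "laurent_coeff (laurent_map (\<psi> y x) f * laurent_map (\<psi> x z) g) c =
          (\<Sum>a\<in>?F. laurent_coeff (laurent_map (\<psi> y x) f) a * laurent_coeff (laurent_map (\<psi> x z) g) (c - a))"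
        by (rule laurent_coeff_mult[OF fin]) (auto simp: laurent_coeff_map)
      then show "(\<Sum>a\<in>?F. \<psi> y x (laurent_coeff f a) * \<psi> x z (laurent_coeff g (c - a))) =
          laurent_coeff (laurent_map (\<psi> y x) f * laurent_map (\<psi> x z) g) c"
        by (simp add: laurent_coeff_map)
    qed simp
    finally show "laurent_coeff (laurent_map (\<psi> y z) (f * g)) c =
        laurent_coeff (\<Sum>x<d. laurent_map (\<psi> y x) f * laurent_map (\<psi> x z) g) c"
      by (simp add: laurent_coeff_sum)
  qed
qed

lemma flatten_carrier: "M \<in> carrier_mat nr nc \<Longrightarrow> flatten d \<psi> M \<in> carrier_mat (nr * d) (nc * d)"
  by (auto simp: flatten_def)

lemma sum_div_mod: "(\<Sum>r<n * d. f (r div d) (r mod d)) = (\<Sum>k<n. \<Sum>x<d. f k x)"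
proof -
  have "(\<Sum>r<n * d. f (r div d) (r mod d)) = (\<Sum>k<n. \<Sum>r\<in>{k * d..<k * d + d}. f (r div d) (r mod d))"
    by (rule sum.nat_group[symmetric])
  also have "\<dots> = (\<Sum>k<n. \<Sum>x<d. f k x)"
  proof (rule sum.cong[OF HOL.refl])
    fix k
    show "(\<Sum>r\<in>{k * d..<k * d + d}. f (r div d) (r mod d)) = (\<Sum>x<d. f k x)"
      using sum.shift_bounds_nat_ivl[of "\<lambda>r. f (r div d) (r mod d)" 0 "k * d" d]
      by (simp add: lessThan_atLeast0 add.commute)
  qed
  finally show ?thesis .
qed

lemma flatten_mult:
  assumes A: "A \<in> carrier_mat n1 n2" and B: "B \<in> carrier_mat n2 n3"
  shows "flatten d \<psi> (A * B) = flatten d \<psi> A * flatten d \<psi> B"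
proof (rule eq_matI)
  show "dim_row (flatten d \<psi> (A * B)) = dim_row (flatten d \<psi> A * flatten d \<psi> B)"
    "dim_col (flatten d \<psi> (A * B)) = dim_col (flatten d \<psi> A * flatten d \<psi> B)"
    by (simp_all add: flatten_def)
  fix p q assume "p < dim_row (flatten d \<psi> A * flatten d \<psi> B)" "q < dim_col (flatten d \<psi> A * flatten d \<psi> B)"
  then have pq: "p < n1 * d" "q < n3 * d" using A B by (auto simp: flatten_def)
  then have d: "d > 0" by (cases d) auto
  have pq': "p div d < n1" "q div d < n3" "p mod d < d" "q mod d < d"
    using pq d by (auto simp: less_mult_imp_div_less)
  have "flatten d \<psi> (A * B) $$ (p, q) =
      (\<Sum>k<n2. \<Sum>x<d. \<psi> (p mod d) x (A $$ (p div d, k)) * \<psi> x (q mod d) (B $$ (k, q div d)))"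
    using A B pq pq' by (simp add: flatten_def scalar_prod_def sum mult lessThan_atLeast0)
  also have "\<dots> = (\<Sum>r<n2 * d. \<psi> (p mod d) (r mod d) (A $$ (p div d, r div d)) *
      \<psi> (r mod d) (q mod d) (B $$ (r div d, q div d)))"
    by (rule sum_div_mod[symmetric])
  also have "\<dots> = (flatten d \<psi> A * flatten d \<psi> B) $$ (p, q)"
    using A B pq by (simp add: flatten_def scalar_prod_def lessThan_atLeast0)
  finally show "flatten d \<psi> (A * B) $$ (p, q) = (flatten d \<psi> A * flatten d \<psi> B) $$ (p, q)" .
qed

lemma flatten_one: "flatten d \<psi> (1\<^sub>m n) = 1\<^sub>m (n * d)"
proof (rule eq_matI)
  fix p q assume "p < dim_row (1\<^sub>m (n * d) :: 'b mat)" "q < dim_col (1\<^sub>m (n * d) :: 'b mat)"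
  then have pq: "p < n * d" "q < n * d" by auto
  then have d: "d > 0" by (cases d) auto
  have pq': "p div d < n" "q div d < n" "p mod d < d" "q mod d < d"
    using pq d by (auto simp: less_mult_imp_div_less)
  have "p = q \<longleftrightarrow> p div d = q div d \<and> p mod d = q mod d" by (metis div_mult_mod_eq)
  then show "flatten d \<psi> (1\<^sub>m n) $$ (p, q) = 1\<^sub>m (n * d) $$ (p, q)"
    using pq pq' by (auto simp: flatten_def one)
qed (auto simp: flatten_def)

lemma flatten_entry:
  assumes "M \<in> carrier_mat nr nc" "j < nr" "l < nc" "y < d" "z < d"
  shows "flatten d \<psi> M $$ (j * d + y, l * d + z) = \<psi> y z (M $$ (j, l))"
proof -
  have "j * d + y < nr * d" "l * d + z < nc * d"
    using assms mult_le_mono1[of "Suc j" nr d] mult_le_mono1[of "Suc l" nc d] by auto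
  then show ?thesis using assms by (simp add: flatten_def div_nat_eqI mod_nat_eqI)
qed

end

section \<open>Invertible matrices\<close>

lemma inverse_matrix_eqI:
  fixes M :: "'a::ring_1 mat"
  assumes M: "M \<in> carrier_mat n n" and N: "N \<in> carrier_mat n n"
    and MN: "M * N = 1\<^sub>m n" and NM: "N * M = 1\<^sub>m n"
  shows "inverse_matrix M = N"
  unfolding inverse_matrix_def
proof (rule the_equality)
  show "inverts_mat M N \<and> inverts_mat N M" using assms by (auto simp: inverts_mat_def)
  fix N' assume N': "inverts_mat M N' \<and> inverts_mat N' M"
  then have eqs: "M * N' = 1\<^sub>m n" "N' * M = 1\<^sub>m (dim_row N')"
    using M by (auto simp: inverts_mat_def)
  \<comment> \<open>\<open>inverts_mat\<close> leaves the shape of \<open>N'\<close> open; it is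
    read off the two identity matrices.\<close>
  have "dim_col N' = n" using arg_cong[OF eqs(1), of dim_col] by simp
  moreover have "dim_row N' = n" using arg_cong[OF eqs(2), of dim_col] M by simp
  ultimately have N'c: "N' \<in> carrier_mat n n" by auto
  have "N' = (N * M) * N'" using NM N'c by simp
  also have "\<dots> = N * (M * N')" using M N N'c by simp
  also have "\<dots> = N" using eqs N by simp
  finally show "N' = N" .
qed

lemma inverse_matrix_of_invertible:
  fixes M :: "'a::ring_1 mat"
  assumes M: "M \<in> carrier_mat n n" and inv: "invertible_mat M"
  shows "inverse_matrix M \<in> carrier_mat n n \<and> M * inverse_matrix M = 1\<^sub>m n \<and>
    inverse_matrix M * M = 1\<^sub>m n"
proof -
  from inv obtain N where "inverts_mat M N" "inverts_mat N M"
    unfolding invertible_mat_def by blast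
  then have eqs: "M * N = 1\<^sub>m n" "N * M = 1\<^sub>m (dim_row N)"
    using M by (auto simp: inverts_mat_def)
  have "dim_col N = n" using arg_cong[OF eqs(1), of dim_col] by simp
  moreover have r: "dim_row N = n" using arg_cong[OF eqs(2), of dim_col] M by simp
  ultimately have "N \<in> carrier_mat n n" by auto
  with inverse_matrix_eqI[OF M this] eqs r show ?thesis by auto
qed

section \<open>The filtration of power series by total degree, and the geometric series\<close>

definition total_degree :: "('i \<Rightarrow>\<^sub>0 nat) \<Rightarrow> nat" where
  "total_degree a = (\<Sum>i\<in>Poly_Mapping.keys a. Poly_Mapping.lookup a i)"

lemma total_degree_alt:
  assumes "finite A" "Poly_Mapping.keys a \<subseteq> A"
  shows "total_degree a = (\<Sum>i\<in>A. Poly_Mapping.lookup a i)"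
  unfolding total_degree_def using assms
  by (intro sum.mono_neutral_left) (auto simp: in_keys_iff)

lemma total_degree_add: "total_degree (a + b) = total_degree a + total_degree b"
proof -
  let ?A = "Poly_Mapping.keys a \<union> Poly_Mapping.keys b"
  have "total_degree c = (\<Sum>i\<in>?A. Poly_Mapping.lookup c i)" if "Poly_Mapping.keys c \<subseteq> ?A" for c
    by (rule total_degree_alt) (use that in auto)
  from this[of a] this[of b] this[of "a + b"] show ?thesis
    using keys_add[of a b] by (simp add: lookup_add sum.distrib)
qed

lemma total_degree_zero [simp]: "total_degree 0 = 0"
  by (simp add: total_degree_def)

lemma total_degree_single [simp]: "total_degree (Poly_Mapping.single i n) = n"
  by (cases "n = 0") (auto simp: total_degree_def)

lemma total_degree_pos: "a \<noteq> 0 \<Longrightarrow> 1 \<le> total_degree a"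
proof -
  assume "a \<noteq> 0"
  then obtain i where i: "i \<in> Poly_Mapping.keys a" by (metis keys_eq_empty equals0I)
  then have "1 \<le> Poly_Mapping.lookup a i" by (simp add: in_keys_iff)
  also have "\<dots> \<le> total_degree a" unfolding total_degree_def using i by (intro member_le_sum) auto
  finally show ?thesis .
qed

text \<open>For \<open>n = 0\<close> this singles out the power series among the Laurent series;
  larger \<open>n\<close> give the descending filtration in which the geometric series
  converges.\<close>

definition order_ge :: "nat \<Rightarrow> ('i, 'r::zero) laurent \<Rightarrow> bool" where
  "order_ge n f \<longleftrightarrow>
     (\<forall>c. laurent_coeff f c \<noteq> 0 \<longrightarrow> (\<exists>a. c = int_exponent a \<and> n \<le> total_degree a))"

lemma order_ge_zero [simp]: "order_ge n (0 :: ('i, 'r::ring_1) laurent)"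
  by (simp add: order_ge_def)

lemma order_ge_one: "order_ge 0 (1 :: ('i, 'r::ring_1) laurent)"
  unfolding order_ge_def laurent_coeff_one by (metis int_exponent_zero le0)

lemma order_ge_add:
  "order_ge n f \<Longrightarrow> order_ge n g \<Longrightarrow> order_ge n (f + g :: ('i, 'r::ring_1) laurent)"
  unfolding order_ge_def laurent_coeff_add by (metis add_0)

lemma order_ge_diff:
  "order_ge n f \<Longrightarrow> order_ge n g \<Longrightarrow> order_ge n (f - g :: ('i, 'r::ring_1) laurent)"
  unfolding order_ge_def laurent_coeff_diff by (metis diff_0_right)

lemma order_ge_sum:
  "(\<And>x. x \<in> A \<Longrightarrow> order_ge n (F x)) \<Longrightarrow> order_ge n (sum F A :: ('i, 'r::ring_1) laurent)"
  by (induction A rule: infinite_finite_induct) (auto simp: order_ge_add)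

lemma order_ge_mult:
  fixes f g :: "('i, 'r::ring_1) laurent"
  assumes f: "order_ge n f" and g: "order_ge k g"
  shows "order_ge (n + k) (f * g)"
  unfolding order_ge_def
proof (intro allI impI)
  fix c assume nz: "laurent_coeff (f * g) c \<noteq> 0"
  have "laurent_coeff (f * g) c = (\<Sum>a | laurent_coeff f a \<noteq> 0 \<and> laurent_coeff g (c - a) \<noteq> 0.
      laurent_coeff f a * laurent_coeff g (c - a))"
    by (intro laurent_coeff_mult finite_conv_support_laurent order_refl)
  then have "{a. laurent_coeff f a \<noteq> 0 \<and> laurent_coeff g (c - a) \<noteq> 0} \<noteq> {}"
    using nz by (metis sum.empty)
  then obtain a where "laurent_coeff f a \<noteq> 0" "laurent_coeff g (c - a) \<noteq> 0" by blast
  then obtain a' b' where ab: "a = int_exponent a'" "n \<le> total_degree a'"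
    "c - a = int_exponent b'" "k \<le> total_degree b'" using f g unfolding order_ge_def by blast
  then have "c = int_exponent (a' + b')" by (simp add: int_exponent_add) (metis add_diff_cancel_left' add_diff_eq)
  then show "\<exists>a. c = int_exponent a \<and> n + k \<le> total_degree a"
    using ab by (intro exI[of _ "a' + b'"]) (simp add: total_degree_add)
qed

lemma order_ge_mono: "order_ge n f \<Longrightarrow> k \<le> n \<Longrightarrow> order_ge k f"
  unfolding order_ge_def by (meson order_trans)

lemma order_ge_all:
  fixes f :: "('i, 'r::ring_1) laurent"
  assumes "\<And>n. order_ge n f"
  shows "f = 0"
proof (rule laurent_eqI)
  fix c
  show "laurent_coeff f c = laurent_coeff 0 c"
  proof (rule ccontr)
    assume "laurent_coeff f c \<noteq> laurent_coeff 0 c"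
    then have nz: "laurent_coeff f c \<noteq> 0" by simp
    then obtain a where "c = int_exponent a" using assms unfolding order_ge_def by blast
    with nz assms[of "Suc (total_degree a)"] show False by (auto simp: order_ge_def)
  qed
qed

lemma order_ge_at_t: "Poly_Mapping.lookup p 0 = 0 \<Longrightarrow> order_ge 1 (at_t p)"
  unfolding order_ge_def using laurent_coeff_at_t_nonzero[of p] total_degree_pos by metis

text \<open>The geometric series of a matrix of positive order. The two equations say that its limit
  is a right and a left inverse, respectively, of the identity minus \<open>M\<close>.\<close>

lemma neumann_matrix:
  fixes M :: "nat \<Rightarrow> nat \<Rightarrow> ('i, 'r::ring_1) laurent"
  assumes M: "\<And>j l. j < n \<Longrightarrow> l < n \<Longrightarrow> order_ge 1 (M j l)"
  obtains V where
    "\<And>j l. j < n \<Longrightarrow> l < n \<Longrightarrow> V j l = (if j = l then 1 else 0) + (\<Sum>k<n. M j k * V k l)"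
    "\<And>j l. j < n \<Longrightarrow> l < n \<Longrightarrow> V j l = (if j = l then 1 else 0) + (\<Sum>k<n. V j k * M k l)"
proof -
  let ?\<delta> = "\<lambda>j l :: nat. if j = l then 1 else 0 :: ('i, 'r) laurent"
  \<comment> \<open>\<open>P p\<close> is the sum of the powers of \<open>M\<close> up to the
    exponent \<open>p\<close>. The recursion multiplies from the left; \<open>PS'\<close> supplies
    the other side.\<close>
  define P where "P = rec_nat ?\<delta> (\<lambda>_ A j l. ?\<delta> j l + (\<Sum>k<n. M j k * A k l))"
  have P0: "P 0 j l = ?\<delta> j l" and PS: "P (Suc p) j l = ?\<delta> j l + (\<Sum>k<n. M j k * P p k l)" for p j l
    by (simp_all add: P_def)
  have PS': "P (Suc p) j l = ?\<delta> j l + (\<Sum>k<n. P p j k * M k l)" if "j < n" "l < n" for p j l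
    using that
  proof (induction p arbitrary: j l)
    case 0
    have "(\<Sum>k<n. M j k * ?\<delta> k l) = (\<Sum>k<n. if k = l then M j k else 0)"
      by (rule sum.cong) auto
    also have "\<dots> = M j l" using 0 by simp
    also have "\<dots> = (\<Sum>k<n. if k = j then M k l else 0)" using 0 by simp
    also have "\<dots> = (\<Sum>k<n. ?\<delta> j k * M k l)"
      by (rule sum.cong) auto
    finally show ?case unfolding PS P0 by (rule arg_cong)
  next
    case (Suc p)
    have "(\<Sum>k<n. M j k * P (Suc p) k l) = (\<Sum>k<n. M j k * (?\<delta> k l + (\<Sum>r<n. P p k r * M r l)))"
      using Suc by (intro sum.cong HOL.refl) simp
    also have "\<dots> = (\<Sum>k<n. (if k = l then M j k else 0) + (\<Sum>r<n. M j k * P p k r * M r l))"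
      by (intro sum.cong HOL.refl) (simp add: distrib_left sum_distrib_left mult.assoc)
    also have "\<dots> = M j l + (\<Sum>k<n. \<Sum>r<n. M j k * P p k r * M r l)"
      using Suc.prems by (simp add: sum.distrib)
    also have "\<dots> = M j l + (\<Sum>r<n. \<Sum>k<n. M j k * P p k r * M r l)"
      by (subst sum.swap) simp
    also have "\<dots> = (\<Sum>r<n. (if r = j then M r l else 0) + (\<Sum>k<n. M j k * P p k r * M r l))"
      using Suc.prems by (simp add: sum.distrib)
    also have "\<dots> = (\<Sum>r<n. P (Suc p) j r * M r l)"
      unfolding PS by (intro sum.cong HOL.refl) (simp add: distrib_right sum_distrib_right)
    finally show ?case unfolding PS[of "Suc p"] by simp
  qed
  have P_ge0: "order_ge 0 (P p j l)" if "j < n" "l < n" for p j l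
    using that
  proof (induction p arbitrary: j l)
    case 0 then show ?case by (simp add: P0 order_ge_one)
  next
    case (Suc p)
    have "order_ge 0 (M j k * P p k l)" if "k < n" for k
      using order_ge_mult[OF M[of j k] Suc.IH[of k l]] that Suc.prems order_ge_mono by blast
    then show ?case unfolding PS by (intro order_ge_add order_ge_sum) (auto simp: order_ge_one)
  qed
  have D: "order_ge (Suc p) (P (Suc p) j l - P p j l)" if "j < n" "l < n" for p j l
    using that
  proof (induction p arbitrary: j l)
    case 0
    have "P (Suc 0) j l - P 0 j l = (\<Sum>k<n. M j k * P 0 k l)" unfolding PS P0 by simp
    moreover have "order_ge 1 (M j k * P 0 k l)" if "k < n" for k
      using order_ge_mult[OF M[of j k] P_ge0[of k l 0]] that 0 by simp
    ultimately show ?case by (auto intro!: order_ge_sum)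
  next
    case (Suc p)
    have "P (Suc (Suc p)) j l - P (Suc p) j l = (\<Sum>k<n. M j k * (P (Suc p) k l - P p k l))"
      unfolding PS[of "Suc p"] PS[of p j l] by (simp add: right_diff_distrib sum_subtractf)
    moreover have "order_ge (Suc (Suc p)) (M j k * (P (Suc p) k l - P p k l))" if "k < n" for k
      using order_ge_mult[OF M[of j k] Suc.IH[of k l]] that Suc.prems by simp
    ultimately show ?case by (auto intro!: order_ge_sum)
  qed
  \<comment> \<open>Later partial sums change only coefficients of larger total degree, so the
    coefficient at \<open>a\<close> is final from step \<open>total_degree a\<close> on.\<close>
  have stable: "laurent_coeff (P (total_degree a + q) j l) (int_exponent a) =
      laurent_coeff (P (total_degree a) j l) (int_exponent a)" if jl: "j < n" "l < n" for a q j l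
  proof (induction q)
    case (Suc q)
    have "laurent_coeff (P (Suc (total_degree a + q)) j l - P (total_degree a + q) j l) (int_exponent a) = 0"
    proof (rule ccontr)
      assume nz: "laurent_coeff (P (Suc (total_degree a + q)) j l - P (total_degree a + q) j l) (int_exponent a) \<noteq> 0"
      obtain b where "int_exponent a = int_exponent b" "Suc (total_degree a + q) \<le> total_degree b"
        using D[OF jl, of "total_degree a + q", unfolded order_ge_def, rule_format, OF nz] by blast
      then show False by simp
    qed
    then show ?case using Suc by simp
  qed simp
  define g where "g j l c = (if \<exists>a. c = int_exponent a
      then laurent_coeff (P (total_degree (THE a. c = int_exponent a)) j l) c else 0)" for j l c
  define V where "V j l = Abs_laurent (g j l)" for j l
  have V: "laurent_coeff (V j l) c = g j l c" for j l c
  proof -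
    have "bounded_support (g j l) 0"
      by (auto simp: bounded_support_def g_def lookup_int_exponent)
    then show ?thesis unfolding V_def by (subst Abs_laurent_inverse) auto
  qed
  have VP: "order_ge (Suc p) (V j l - P p j l)" if "j < n" "l < n" for p j l
    unfolding order_ge_def
  proof (intro allI impI)
    fix c assume nz: "laurent_coeff (V j l - P p j l) c \<noteq> 0"
    have ex: "\<exists>a. c = int_exponent a"
    proof (rule ccontr)
      assume n: "\<nexists>a. c = int_exponent a"
      then have "laurent_coeff (P p j l) c = 0" using P_ge0[OF that, of p] by (auto simp: order_ge_def)
      with n nz show False by (simp add: V g_def)
    qed
    then obtain a where a: "c = int_exponent a" by blast
    have "\<not> total_degree a \<le> p"
    proof
      assume "total_degree a \<le> p"
      then obtain q where "p = total_degree a + q" using le_Suc_ex by blast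
      then have "laurent_coeff (P p j l) c = laurent_coeff (P (total_degree a) j l) c"
        using stable[OF that] a by simp
      then show False using nz ex a by (simp add: V g_def)
    qed
    then show "\<exists>a. c = int_exponent a \<and> Suc p \<le> total_degree a" using a by auto
  qed
  \<comment> \<open>Comparing \<open>V\<close> with two consecutive partial sums shows that the
    error lies in every step of the filtration, hence vanishes.\<close>
  have left: "V j l - (?\<delta> j l + (\<Sum>k<n. M j k * V k l)) = 0" if jl: "j < n" "l < n" for j l
  proof (rule order_ge_all)
    fix p
    have eq: "V j l - (?\<delta> j l + (\<Sum>k<n. M j k * V k l)) =
        (V j l - P (Suc p) j l) - (\<Sum>k<n. M j k * (V k l - P p k l))"
      unfolding PS by (simp add: right_diff_distrib sum_subtractf)
    have "order_ge p (V j l - P (Suc p) j l)"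
      using order_ge_mono[OF VP[OF jl]] by simp
    moreover have "order_ge p (M j k * (V k l - P p k l))" if "k < n" for k
      using order_ge_mono[OF order_ge_mult[OF M[of j k] VP[of k l p]]] jl that by simp
    ultimately show "order_ge p (V j l - (?\<delta> j l + (\<Sum>k<n. M j k * V k l)))"
      unfolding eq by - (rule order_ge_diff, assumption, rule order_ge_sum, simp)
  qed
  have right: "V j l - (?\<delta> j l + (\<Sum>k<n. V j k * M k l)) = 0" if jl: "j < n" "l < n" for j l
  proof (rule order_ge_all)
    fix p
    have eq: "V j l - (?\<delta> j l + (\<Sum>k<n. V j k * M k l)) =
        (V j l - P (Suc p) j l) - (\<Sum>k<n. (V j k - P p j k) * M k l)"
      unfolding PS'[OF jl] by (simp add: left_diff_distrib sum_subtractf)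
    have "order_ge p (V j l - P (Suc p) j l)"
      using order_ge_mono[OF VP[OF jl]] by simp
    moreover have "order_ge p ((V j k - P p j k) * M k l)" if "k < n" for k
      using order_ge_mono[OF order_ge_mult[OF VP[of j k p] M[of k l]]] jl that by simp
    ultimately show "order_ge p (V j l - (?\<delta> j l + (\<Sum>k<n. V j k * M k l)))"
      unfolding eq by - (rule order_ge_diff, assumption, rule order_ge_sum, simp)
  qed
  show ?thesis by (rule that[of V]) (use left right in auto)
qed

lemma one_minus_matrix_inverse:
  fixes M :: "('i, 'r::ring_1) laurent mat"
  assumes M: "M \<in> carrier_mat n n" and ge: "\<And>j l. j < n \<Longrightarrow> l < n \<Longrightarrow> order_ge 1 (M $$ (j, l))"
  obtains V where "V \<in> carrier_mat n n" "(1\<^sub>m n - M) * V = 1\<^sub>m n" "V * (1\<^sub>m n - M) = 1\<^sub>m n"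
proof -
  obtain V where V: "\<And>j l. j < n \<Longrightarrow> l < n \<Longrightarrow>
      V j l = (if j = l then 1 else 0) + (\<Sum>k<n. M $$ (j, k) * V k l)"
    "\<And>j l. j < n \<Longrightarrow> l < n \<Longrightarrow>
      V j l = (if j = l then 1 else 0) + (\<Sum>k<n. V j k * M $$ (k, l))"
    using neumann_matrix[of n "\<lambda>j l. M $$ (j, l)"] ge by blast
  define W where "W = mat n n (\<lambda>(j, l). V j l)"
  have W: "W \<in> carrier_mat n n" by (simp add: W_def)
  have "(1\<^sub>m n - M) * W = W - M * W"
    using minus_mult_distrib_mat[OF one_carrier_mat M W] W by simp
  also have "\<dots> = 1\<^sub>m n"
  proof (rule eq_matI)
    fix j l assume "j < dim_row (1\<^sub>m n :: ('i, 'r) laurent mat)" "l < dim_col (1\<^sub>m n :: ('i, 'r) laurent mat)"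
    then have jl: "j < n" "l < n" by auto
    have "(M * W) $$ (j, l) = (\<Sum>k<n. M $$ (j, k) * V k l)"
      using M W jl by (simp add: W_def scalar_prod_def lessThan_atLeast0)
    moreover have "W $$ (j, l) = V j l" using jl by (simp add: W_def)
    ultimately show "(W - M * W) $$ (j, l) = 1\<^sub>m n $$ (j, l)"
      using V(1)[OF jl] W M jl by auto
  qed (use M W in auto)
  finally have 1: "(1\<^sub>m n - M) * W = 1\<^sub>m n" .
  have "W * (1\<^sub>m n - M) = W - W * M"
    using mult_minus_distrib_mat[OF W one_carrier_mat M] W by simp
  also have "\<dots> = 1\<^sub>m n"
  proof (rule eq_matI)
    fix j l assume "j < dim_row (1\<^sub>m n :: ('i, 'r) laurent mat)" "l < dim_col (1\<^sub>m n :: ('i, 'r) laurent mat)"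
    then have jl: "j < n" "l < n" by auto
    have "(W * M) $$ (j, l) = (\<Sum>k<n. V j k * M $$ (k, l))"
      using M W jl by (simp add: W_def scalar_prod_def lessThan_atLeast0)
    moreover have "W $$ (j, l) = V j l" using jl by (simp add: W_def)
    ultimately show "(W - W * M) $$ (j, l) = 1\<^sub>m n $$ (j, l)"
      using V(2)[OF jl] W M jl by auto
  qed (use M W in auto)
  finally have 2: "W * (1\<^sub>m n - M) = 1\<^sub>m n" .
  show ?thesis using that[OF W 1 2] .
qed

lemma one_minus_inverse:
  fixes f :: "('i, 'r::ring_1) laurent"
  assumes "order_ge 1 f"
  obtains g where "(1 - f) * g = 1" "g * (1 - f) = 1"
proof -
  obtain V :: "nat \<Rightarrow> nat \<Rightarrow> ('i, 'r) laurent" where V: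
    "\<And>j l. j < 1 \<Longrightarrow> l < 1 \<Longrightarrow> V j l = (if j = l then 1 else 0) + (\<Sum>k<1. f * V k l)"
    "\<And>j l. j < 1 \<Longrightarrow> l < 1 \<Longrightarrow> V j l = (if j = l then 1 else 0) + (\<Sum>k<1. V j k * f)"
    by (rule neumann_matrix[of 1 "\<lambda>_ _. f", OF assms]) blast
  have 1: "V 0 0 = 1 + f * V 0 0" and 2: "V 0 0 = 1 + V 0 0 * f"
    by (rule HOL.trans[OF V(1)]; simp) (rule HOL.trans[OF V(2)]; simp)
  show ?thesis
  proof (rule that[of "V 0 0"])
    have "(1 - f) * V 0 0 = V 0 0 - f * V 0 0" by (simp add: left_diff_distrib)
    also have "\<dots> = 1" using 1 by (simp only: diff_eq_eq)
    finally show "(1 - f) * V 0 0 = 1" .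
    have "V 0 0 * (1 - f) = V 0 0 - V 0 0 * f" by (simp add: right_diff_distrib)
    also have "\<dots> = 1" using 2 by (simp only: diff_eq_eq)
    finally show "V 0 0 * (1 - f) = 1" .
  qed
qed

section \<open>Transfer between two specializations\<close>

text \<open>Cramer's rule: clearing the denominator \<open>det P\<close> turns the hypothesis into an identity over
  the source ring, which can then be mapped by the second homomorphism.\<close>

lemma specialization_transfer:
  fixes h1 h2 :: "'t::comm_ring_1 \<Rightarrow> 'l::comm_ring_1"
  assumes h1: "comm_ring_hom h1" and h2: "comm_ring_hom h2" and inj: "inj h1"
    and P: "P \<in> carrier_mat n n" and a: "a \<in> carrier_mat r n" and b: "b \<in> carrier_mat n r'"
    and c: "c \<in> carrier_mat r r'" and V: "V \<in> carrier_mat n n" and X: "X \<in> carrier_mat n n"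
    and VP: "V * map_mat h1 P = 1\<^sub>m n"
    and XP: "X * map_mat h2 P = 1\<^sub>m n"
    and eq: "map_mat h1 a * V * map_mat h1 b = map_mat h1 c"
  shows "map_mat h2 a * X * map_mat h2 b = map_mat h2 c"
proof -
  interpret h1: comm_ring_hom h1 by fact
  interpret h2: comm_ring_hom h2 by fact
  define J where "J = adj_mat P"
  define \<delta> where "\<delta> = det P"
  have J: "J \<in> carrier_mat n n" and PJ: "P * J = \<delta> \<cdot>\<^sub>m 1\<^sub>m n"
    using adj_mat[OF P] by (auto simp: J_def \<delta>_def)
  have cramer: "map_mat h a * (map_mat h J * map_mat h b) = h \<delta> \<cdot>\<^sub>m (map_mat h a * Y * map_mat h b)"
    if h: "comm_ring_hom h" and Y: "Y \<in> carrier_mat n n" and YP: "Y * map_mat h P = 1\<^sub>m n"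
    for h :: "'t \<Rightarrow> 'l" and Y
  proof -
    interpret h: comm_ring_hom h by fact
    have "map_mat h J = (Y * map_mat h P) * map_mat h J" using YP J by simp
    also have "\<dots> = Y * (map_mat h (P * J))"
      using Y P J by (simp add: h.mat_hom_mult[of _ n n _ n])
    also have "\<dots> = Y * (h \<delta> \<cdot>\<^sub>m 1\<^sub>m n)"
      unfolding PJ by (intro arg_cong[of _ _ "\<lambda>Z. Y * Z"] eq_matI) auto
    also have "\<dots> = h \<delta> \<cdot>\<^sub>m Y" using Y by (simp add: mult_smult_distrib[of _ n n _ n])
    finally have "map_mat h J = h \<delta> \<cdot>\<^sub>m Y" .
    then have "map_mat h J * map_mat h b = h \<delta> \<cdot>\<^sub>m (Y * map_mat h b)"
      using b Y by (simp add: mult_smult_assoc_mat[of _ n n _ r'])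
    then have "map_mat h a * (map_mat h J * map_mat h b) = h \<delta> \<cdot>\<^sub>m (map_mat h a * (Y * map_mat h b))"
      using a b Y by (simp add: mult_smult_distrib[of _ r n _ r'])
    then show ?thesis using a b Y by (simp add: assoc_mult_mat[of _ r n _ n _ r'])
  qed
  have "map_mat h1 (a * (J * b)) = map_mat h1 (\<delta> \<cdot>\<^sub>m c)"
  proof -
    have "map_mat h1 (a * (J * b)) = map_mat h1 a * (map_mat h1 J * map_mat h1 b)"
      using a J b by (simp add: h1.mat_hom_mult[of _ n n _ r'] h1.mat_hom_mult[of _ r n _ r'])
    also have "\<dots> = h1 \<delta> \<cdot>\<^sub>m map_mat h1 c" unfolding cramer[OF h1 V VP] eq ..
    also have "\<dots> = map_mat h1 (\<delta> \<cdot>\<^sub>m c)" using c by (intro eq_matI) (auto simp: h1.hom_mult)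
    finally show ?thesis .
  qed
  then have "a * (J * b) = \<delta> \<cdot>\<^sub>m c"
    using a J b c inj by (auto simp: mat_eq_iff inj_eq)
  then have "h2 \<delta> \<cdot>\<^sub>m (map_mat h2 a * X * map_mat h2 b) = map_mat h2 (\<delta> \<cdot>\<^sub>m c)"
    using cramer[OF h2 X XP] a J b
    by (simp add: h2.mat_hom_mult[of _ n n _ r', symmetric] h2.mat_hom_mult[of _ r n _ r', symmetric])
  also have "\<dots> = h2 \<delta> \<cdot>\<^sub>m map_mat h2 c" using c by (intro eq_matI) (auto simp: h2.hom_mult)
  finally have scaled: "h2 \<delta> \<cdot>\<^sub>m (map_mat h2 a * X * map_mat h2 b) = h2 \<delta> \<cdot>\<^sub>m map_mat h2 c" .
  \<comment> \<open>\<open>h2 \<delta>\<close> has to be a unit to be cancelled, since the target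
    may have zero divisors; the left inverse \<open>X\<close> provides its inverse
    \<open>det X\<close>.\<close>
  have unit: "det X * h2 \<delta> = 1"
    using arg_cong[OF XP, of det] det_mult[OF X, of "map_mat h2 P"] P by (simp add: \<delta>_def h2.hom_det)
  have cancel: "Z = det X \<cdot>\<^sub>m (h2 \<delta> \<cdot>\<^sub>m Z)" for Z :: "'l mat"
    using unit by (intro eq_matI) (simp_all flip: mult.assoc)
  show ?thesis using cancel scaled by metis
qed

lemma comm_ring_hom_at_t: "comm_ring_hom (at_t :: _ \<Rightarrow> ('i, 'r::comm_ring_1) laurent)"
  by unfold_locales (simp_all add: at_t_simps)

lemma comm_ring_hom_at_t_inv: "comm_ring_hom (at_t_inv :: _ \<Rightarrow> ('i, 'r::comm_ring_1) laurent)"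
  by unfold_locales (simp_all add: at_t_inv_simps)

lemma inj_at_t: "inj at_t"
  using at_t_inject by (rule injI)

lemma lookup_map_zero:
  "\<phi> 0 = 0 \<Longrightarrow> Poly_Mapping.lookup (Poly_Mapping.map \<phi> p) a = \<phi> (Poly_Mapping.lookup p a)"
  by (simp add: Poly_Mapping.map.rep_eq when_def)

context matrix_hom begin

lemma laurent_map_eval:
  "laurent_map (\<psi> y z) (laurent_eval h p) = laurent_eval h (Poly_Mapping.map (\<psi> y z) p)"
proof -
  interpret L: matrix_hom d "\<lambda>y z. laurent_map (\<psi> y z)" by (rule matrix_hom_laurent)
  have "Poly_Mapping.keys (Poly_Mapping.map (\<psi> y z) p) \<subseteq> Poly_Mapping.keys p"
    by (auto simp: in_keys_iff lookup_map_zero)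
  then have "laurent_eval h (Poly_Mapping.map (\<psi> y z) p) =
      (\<Sum>a\<in>Poly_Mapping.keys p. laurent_monom (\<psi> y z (Poly_Mapping.lookup p a)) (h a))"
    by (subst laurent_eval_alt[of "Poly_Mapping.keys p"]) (auto simp: lookup_map_zero)
  then show ?thesis by (simp add: laurent_eval_def L.sum laurent_map_monom)
qed

lemma flatten_eval:
  "flatten d (\<lambda>y z. laurent_map (\<psi> y z)) (map_mat (laurent_eval h) M) =
    map_mat (laurent_eval h) (flatten d (\<lambda>y z. Poly_Mapping.map (\<psi> y z)) M)"
  by (rule eq_matI) (auto simp: flatten_def laurent_map_eval less_mult_imp_div_less)

end

text \<open>Only finitely many group elements occur in the two coefficients at \<open>c\<close>. If
  an action moves a point \<open>y\<close> to different points under all of them, the matrix entry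
  at \<open>y\<close> and \<open>act w y\<close> is the coefficient of \<open>w\<close>.\<close>

lemma (in racg) separation:
  fixes f g :: "('i, 'w \<Rightarrow>\<^sub>0 rat) laurent"
  assumes eq: "\<And>d act y z. finite_action d act \<Longrightarrow> y < d \<Longrightarrow> z < d \<Longrightarrow>
    laurent_map (perm_coeff act y z) f = laurent_map (perm_coeff act y z) g"
  shows "f = g"
proof (rule laurent_eqI, rule poly_mapping_eqI, rule ccontr)
  fix c w
  let ?u = "laurent_coeff f c" and ?v = "laurent_coeff g c"
  assume ne: "Poly_Mapping.lookup ?u w \<noteq> Poly_Mapping.lookup ?v w"
  define A where "A = Poly_Mapping.keys ?u \<union> Poly_Mapping.keys ?v"
  have wA: "w \<in> A" using ne by (auto simp: A_def in_keys_iff)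
  have finA: "finite A" by (simp add: A_def)
  obtain d y and act :: "'w \<Rightarrow> nat \<Rightarrow> nat" where act: "finite_action d act" "y < d"
    "inj_on (\<lambda>w. act w y) {w. len w \<le> Max (len ` A)}"
    by (rule separating_finite_action)
  have inj: "inj_on (\<lambda>w. act w y) A"
    by (rule inj_on_subset[OF act(3)]) (use finA in auto)
  have val: "perm_coeff act y (act w y) x = Poly_Mapping.lookup x w" if "Poly_Mapping.keys x \<subseteq> A" for x
  proof -
    have "perm_coeff act y (act w y) x = (\<Sum>v\<in>A. if v = w then Poly_Mapping.lookup x v else 0)"
      unfolding perm_coeff_alt[OF finA that] using inj wA
      by (intro sum.cong HOL.refl) (auto simp: inj_on_def)
    then show ?thesis using finA wA by simp
  qed
  have "act w y < d" using act finite_action.act_less by blast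
  from arg_cong[OF eq[OF act(1,2) this], of "\<lambda>f. laurent_coeff f c"]
  have "perm_coeff act y (act w y) ?u = perm_coeff act y (act w y) ?v"
    by (simp add: laurent_coeff_map)
  then show False using val[of ?u] val[of ?v] ne by (simp add: A_def)
qed

text \<open>Every finite action turns matrices over the group ring into larger matrices of
  polynomials or Laurent series over the rationals, where determinants are available; the
  conclusions for all actions are then combined by \<open>separation\<close>.\<close>

lemma (in racg) specialization_transfer_group_ring:
  fixes P a b c :: "(('i \<Rightarrow>\<^sub>0 nat) \<Rightarrow>\<^sub>0 ('w \<Rightarrow>\<^sub>0 rat)) mat"
  assumes P: "P \<in> carrier_mat n n" and a: "a \<in> carrier_mat r n" and b: "b \<in> carrier_mat n r'"
    and c: "c \<in> carrier_mat r r'" and V: "V \<in> carrier_mat n n" and X: "X \<in> carrier_mat n n"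
    and VP: "V * map_mat at_t P = 1\<^sub>m n"
    and XP: "X * map_mat at_t_inv P = 1\<^sub>m n"
    and eq: "map_mat at_t a * V * map_mat at_t b = map_mat at_t c"
  shows "map_mat at_t_inv a * X * map_mat at_t_inv b = map_mat at_t_inv c"
proof (rule eq_matI)
  show "dim_row (map_mat at_t_inv a * X * map_mat at_t_inv b) = dim_row (map_mat at_t_inv c)"
    "dim_col (map_mat at_t_inv a * X * map_mat at_t_inv b) = dim_col (map_mat at_t_inv c)"
    using a b c by auto
  fix j l assume "j < dim_row (map_mat at_t_inv c)" "l < dim_col (map_mat at_t_inv c)"
  then have jl: "j < r" "l < r'" using c by auto
  show "(map_mat at_t_inv a * X * map_mat at_t_inv b) $$ (j, l) = map_mat at_t_inv c $$ (j, l)"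
  proof (rule separation)
    fix d and act :: "'w \<Rightarrow> nat \<Rightarrow> nat" and y z
    assume "finite_action d act" and yz: "y < d" "z < d"
    then interpret finite_action d act by simp
    interpret \<psi>: matrix_hom d "perm_coeff act" by (rule matrix_hom_perm_coeff)
    interpret L: matrix_hom d "\<lambda>y z. laurent_map (perm_coeff act y z)"
      by (rule \<psi>.matrix_hom_laurent)
    let ?L = "flatten d (\<lambda>y z. laurent_map (perm_coeff act y z) ::
      ('i, 'w \<Rightarrow>\<^sub>0 rat) laurent \<Rightarrow> ('i, rat) laurent)"
    let ?p = "flatten d (\<lambda>y z. Poly_Mapping.map (perm_coeff act y z) ::
      (('i \<Rightarrow>\<^sub>0 nat) \<Rightarrow>\<^sub>0 ('w \<Rightarrow>\<^sub>0 rat)) \<Rightarrow> (('i \<Rightarrow>\<^sub>0 nat) \<Rightarrow>\<^sub>0 rat))"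
    note flat = \<psi>.flatten_eval[of int_exponent, folded at_t_eq_eval]
      \<psi>.flatten_eval[of "\<lambda>a. - int_exponent a", folded at_t_inv_eq_eval]
    have p_carrier: "?p M \<in> carrier_mat (nr * d) (nc * d)" if "M \<in> carrier_mat nr nc" for M nr nc
      using that by (auto simp: flatten_def)
    have "?L V * map_mat at_t (?p P) = 1\<^sub>m (n * d)"
      using arg_cong[OF VP, of ?L] L.flatten_mult[OF V, of "map_mat at_t P" n] P
      by (simp add: flat L.flatten_one)
    moreover have "?L X * map_mat at_t_inv (?p P) = 1\<^sub>m (n * d)"
      using arg_cong[OF XP, of ?L] L.flatten_mult[OF X, of "map_mat at_t_inv P" n] P
      by (simp add: flat L.flatten_one)
    moreover have "map_mat at_t (?p a) * ?L V * map_mat at_t (?p b) = map_mat at_t (?p c)"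
      using arg_cong[OF eq, of ?L] L.flatten_mult[of "map_mat at_t a * V" r n "map_mat at_t b" r']
        L.flatten_mult[of "map_mat at_t a" r n V n] a b V
      by (simp add: flat)
    ultimately have "map_mat at_t_inv (?p a) * ?L X * map_mat at_t_inv (?p b) = map_mat at_t_inv (?p c)"
      by (intro specialization_transfer[OF comm_ring_hom_at_t comm_ring_hom_at_t_inv inj_at_t
            p_carrier[OF P] p_carrier[OF a] p_carrier[OF b] p_carrier[OF c]
            L.flatten_carrier[OF V] L.flatten_carrier[OF X]])
    then have fl: "?L (map_mat at_t_inv a * X * map_mat at_t_inv b) = ?L (map_mat at_t_inv c)"
      using L.flatten_mult[of "map_mat at_t_inv a * X" r n "map_mat at_t_inv b" r']
        L.flatten_mult[of "map_mat at_t_inv a" r n X n] a b X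
      by (simp add: flat)
    have "map_mat at_t_inv a * X * map_mat at_t_inv b \<in> carrier_mat r r'"
      "map_mat at_t_inv c \<in> carrier_mat r r'" using a b c X by auto
    from this[THEN L.flatten_entry, OF jl yz] fl
    show "laurent_map (perm_coeff act y z) ((map_mat at_t_inv a * X * map_mat at_t_inv b) $$ (j, l)) =
        laurent_map (perm_coeff act y z) (map_mat at_t_inv c $$ (j, l))"
      by metis
  qed
qed

section \<open>Values of rational expressions at the inverted indeterminates\<close>

definition poly_constant :: "rat \<Rightarrow> ('i \<Rightarrow>\<^sub>0 nat) \<Rightarrow>\<^sub>0 ('w::group_add \<Rightarrow>\<^sub>0 rat)" where
  "poly_constant r = Poly_Mapping.single 0 (Poly_Mapping.single 0 r)"

lemma at_t_constant: "at_t (poly_constant r) = rat_constant r"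
  by (simp add: poly_constant_def rat_constant_def at_t_simps)

lemma at_t_inv_constant: "at_t_inv (poly_constant r) = rat_constant r"
  by (simp add: poly_constant_def rat_constant_def at_t_inv_simps)

lemma semiring_hom_at_t: "semiring_hom (at_t :: _ \<Rightarrow> ('i, 'r::ring_1) laurent)"
  by unfold_locales (simp_all add: at_t_simps)

lemma semiring_hom_at_t_inv: "semiring_hom (at_t_inv :: _ \<Rightarrow> ('i, 'r::ring_1) laurent)"
  by unfold_locales (simp_all add: at_t_inv_simps)

text \<open>Both kernels are values of the single polynomial matrix \<open>1\<^sub>m n - Q\<close>,
  as a transfer between the two specializations requires.\<close>

lemma kernel_eq_map:
  assumes "Q \<in> carrier_mat n n"
  shows "kernel_at_t Q = map_mat at_t (1\<^sub>m n - Q)" "kernel_at_t_inv Q = map_mat at_t_inv (1\<^sub>m n - Q)"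
  using assms by (auto simp: kernel_at_t_def kernel_at_t_inv_def at_t_simps at_t_inv_simps intro!: eq_matI)

lemma kernel_at_t_invertible:
  assumes Q: "Q \<in> carrier_mat n n"
    and Q0: "\<And>j l. j < n \<Longrightarrow> l < n \<Longrightarrow> Poly_Mapping.lookup (Q $$ (j, l)) 0 = 0"
  shows "inverse_matrix (kernel_at_t Q) \<in> carrier_mat n n \<and>
    inverse_matrix (kernel_at_t Q) * kernel_at_t Q = 1\<^sub>m n"
proof -
  have "order_ge 1 (map_mat at_t Q $$ (j, l))" if "j < n" "l < n" for j l
    using Q order_ge_at_t[OF Q0[OF that]] that by simp
  then obtain V where V: "V \<in> carrier_mat n n" "(1\<^sub>m n - map_mat at_t Q) * V = 1\<^sub>m n"
    "V * (1\<^sub>m n - map_mat at_t Q) = 1\<^sub>m n"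
    using one_minus_matrix_inverse[of "map_mat at_t Q" n] Q by auto
  have k: "kernel_at_t Q = 1\<^sub>m n - map_mat at_t Q" using Q by (simp add: kernel_at_t_def)
  have "inverse_matrix (kernel_at_t Q) = V"
    unfolding k using V Q by (intro inverse_matrix_eqI) auto
  then show ?thesis using V k by simp
qed

text \<open>The polynomial \<open>N\<close> is absorbed into the row \<open>A\<close>, which gives
  the relation the shape of the transfer. If \<open>at_t_inv N\<close> is a unit, the value is
  thereby determined by \<open>N\<close> and \<open>D\<close> alone, whatever the
  expression.\<close>

lemma (in racg) value_of_expression_at_t_inv:
  fixes N D :: "('i \<Rightarrow>\<^sub>0 nat) \<Rightarrow>\<^sub>0 ('w \<Rightarrow>\<^sub>0 rat)"
  assumes expr: "is_expression f n A Q B" and inv: "invertible_mat (kernel_at_t_inv Q)"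
    and frac: "at_t N * f = at_t D"
  shows "at_t_inv N * sandwich A (kernel_at_t_inv Q) B = at_t_inv D"
proof -
  have A: "A \<in> carrier_mat 1 n" and Q: "Q \<in> carrier_mat n n" and B: "B \<in> carrier_mat n 1"
    and Q0: "\<And>j l. j < n \<Longrightarrow> l < n \<Longrightarrow> Poly_Mapping.lookup (Q $$ (j, l)) 0 = 0"
    and f: "f = sandwich A (kernel_at_t Q) B"
    using expr unfolding is_expression_def by auto
  define V where "V = inverse_matrix (kernel_at_t Q)"
  define X where "X = inverse_matrix (kernel_at_t_inv Q)"
  define P where "P = 1\<^sub>m n - Q"
  have P: "P \<in> carrier_mat n n" unfolding P_def using Q by (rule minus_carrier_mat)
  note k = kernel_eq_map[OF Q, folded P_def]
  have V: "V \<in> carrier_mat n n" "V * map_mat at_t P = 1\<^sub>m n"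
    using kernel_at_t_invertible[OF Q Q0] k(1) by (auto simp: V_def)
  have X: "X \<in> carrier_mat n n" "X * map_mat at_t_inv P = 1\<^sub>m n"
    using inverse_matrix_of_invertible[OF _ inv, of n] k(2) P by (auto simp: X_def)
  let ?N = "mat 1 1 (\<lambda>_. N)" and ?D = "mat 1 1 (\<lambda>_. D)"
  let ?A = "map_mat poly_constant A" and ?B = "map_mat poly_constant B"
  interpret p: semiring_hom "at_t :: _ \<Rightarrow> ('i, 'w \<Rightarrow>\<^sub>0 rat) laurent" by (rule semiring_hom_at_t)
  interpret m: semiring_hom "at_t_inv :: _ \<Rightarrow> ('i, 'w \<Rightarrow>\<^sub>0 rat) laurent" by (rule semiring_hom_at_t_inv)
  have cA: "map_mat at_t ?A = map_mat rat_constant A" "map_mat at_t_inv ?A = map_mat rat_constant A"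
    and cB: "map_mat at_t ?B = map_mat rat_constant B" "map_mat at_t_inv ?B = map_mat rat_constant B"
    by (auto simp: at_t_constant at_t_inv_constant intro!: eq_matI)
  have N: "?N \<in> carrier_mat 1 1" and A': "?A \<in> carrier_mat 1 n" and B': "?B \<in> carrier_mat n 1"
    using A B by auto
  have hN: "map_mat at_t ?N = mat 1 1 (\<lambda>_. at_t N)" "map_mat at_t_inv ?N = mat 1 1 (\<lambda>_. at_t_inv N)"
    "map_mat at_t ?D = mat 1 1 (\<lambda>_. at_t D)" "map_mat at_t_inv ?D = mat 1 1 (\<lambda>_. at_t_inv D)"
    by (auto intro!: eq_matI)
  have prod: "mat 1 1 (\<lambda>_. u) * map_mat rat_constant A * Y * map_mat rat_constant B =
      mat 1 1 (\<lambda>_. u * (map_mat rat_constant A * Y * map_mat rat_constant B) $$ (0, 0))"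
    if Y: "Y \<in> carrier_mat n n" for u :: "('i, 'w \<Rightarrow>\<^sub>0 rat) laurent" and Y
  proof -
    have "mat 1 1 (\<lambda>_. u) * map_mat rat_constant A * Y * map_mat rat_constant B =
        mat 1 1 (\<lambda>_. u) * (map_mat rat_constant A * Y * map_mat rat_constant B)"
      using A B Y by (simp add: assoc_mult_mat[of _ 1 1 _ n _ n] assoc_mult_mat[of _ 1 1 _ n _ 1]
          assoc_mult_mat[of _ 1 n _ n _ 1])
    also have "\<dots> = mat 1 1 (\<lambda>_. u * (map_mat rat_constant A * Y * map_mat rat_constant B) $$ (0, 0))"
      using A B Y by (intro eq_matI) (auto simp: scalar_prod_def)
    finally show ?thesis .
  qed
  have "map_mat at_t (?N * ?A) * V * map_mat at_t ?B = map_mat at_t ?D"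
    unfolding p.mat_hom_mult[OF N A'] hN cA cB prod[OF V(1)]
    using frac unfolding f sandwich_def V_def[symmetric] by simp
  from specialization_transfer_group_ring[OF P mult_carrier_mat[OF N A'] B' _ V(1) X(1) V(2) X(2) this]
  have "map_mat at_t_inv (?N * ?A) * X * map_mat at_t_inv ?B = map_mat at_t_inv ?D" by simp
  then have "mat 1 1 (\<lambda>_. at_t_inv N * (map_mat rat_constant A * X * map_mat rat_constant B) $$ (0, 0)) =
      mat 1 1 (\<lambda>_. at_t_inv D)"
    unfolding m.mat_hom_mult[OF N A'] hN cA cB prod[OF X(1)] .
  from arg_cong[OF this, of "\<lambda>M. M $$ (0, 0)"] show ?thesis
    by (simp add: sandwich_def X_def)
qed

section \<open>Ordered products and sums over faces\<close>

lemma prod_list_central_mult: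
  fixes u f :: "'a \<Rightarrow> 'b::ring_1"
  assumes "\<And>s. s \<in> set L \<Longrightarrow> central (u s)"
  shows "prod_list (map (\<lambda>s. u s * f s) L) = prod_list (map u L) * prod_list (map f L)"
  using assms
proof (induction L)
  case (Cons s L)
  have c: "central (prod_list (map u L))" using Cons.prems by (intro central_prod_list) auto
  have "prod_list (map (\<lambda>s. u s * f s) (s # L)) =
      u s * (f s * prod_list (map u L)) * prod_list (map f L)"
    using Cons by (simp add: mult.assoc)
  also have "f s * prod_list (map u L) = prod_list (map u L) * f s"
    using central_commute[OF c] by simp
  finally show ?case by (simp add: mult.assoc)
qed simp

text \<open>The factors indexed by \<open>\<sigma>\<close> are multiplied out in the order of
  \<open>L\<close>, because nothing is assumed to commute. Letters outside \<open>\<sigma>\<close>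
  and letters of \<open>\<sigma>\<close> outside \<open>\<tau>\<close> both contribute
  \<open>b s\<close>, so the summand depends on \<open>\<tau>\<close> alone; this permits regrouping
  by \<open>\<tau>\<close> later.\<close>

lemma prod_list_signed_subsets:
  fixes a b :: "'a \<Rightarrow> 'b::ring_1"
  assumes "distinct L" "\<sigma> \<subseteq> set L"
  shows "prod_list (map (\<lambda>s. if s \<in> \<sigma> then - (b s + a s) else b s) L) =
    (- 1) ^ card \<sigma> * (\<Sum>\<tau>\<in>Pow \<sigma>. prod_list (map (\<lambda>s. if s \<in> \<tau> then a s else b s) L))"
  using assms
proof (induction L arbitrary: \<sigma>)
  case Nil then show ?case by simp
next
  case (Cons s L)
  define \<sigma>' where "\<sigma>' = \<sigma> - {s}"
  let ?T = "\<lambda>\<tau> L. prod_list (map (\<lambda>s. if s \<in> \<tau> then a s else b s) L)"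
  let ?F = "\<lambda>\<sigma> L. prod_list (map (\<lambda>s. if s \<in> \<sigma> then - (b s + a s) else b s) L)"
  have sL: "s \<notin> set L" using Cons.prems by simp
  have fin: "finite \<sigma>'" using Cons.prems finite_subset by (auto simp: \<sigma>'_def)
  have "\<sigma>' \<subseteq> set L" using Cons.prems by (auto simp: \<sigma>'_def)
  with Cons have IH: "?F \<sigma>' L = (- 1) ^ card \<sigma>' * (\<Sum>\<tau>\<in>Pow \<sigma>'. ?T \<tau> L)" by simp
  have F: "?F \<sigma> L = ?F \<sigma>' L"
    using sL by (intro arg_cong[of _ _ prod_list] map_cong) (auto simp: \<sigma>'_def)
  have T: "?T \<tau> (s # L) = b s * ?T \<tau> L" "?T (insert s \<tau>) (s # L) = a s * ?T \<tau> L"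
    if "\<tau> \<in> Pow \<sigma>'" for \<tau>
  proof -
    have "?T (insert s \<tau>) L = ?T \<tau> L"
      using sL by (intro arg_cong[of _ _ prod_list] map_cong) auto
    then show "?T (insert s \<tau>) (s # L) = a s * ?T \<tau> L"
      by (simp only: list.map prod_list.Cons insertI1 if_True)
    show "?T \<tau> (s # L) = b s * ?T \<tau> L" using that by (auto simp: \<sigma>'_def)
  qed
  have sign: "x * ((- 1) ^ n * y) = (- 1) ^ n * (x * y)" for x y :: 'b and n
    by (cases "even n") simp_all
  show ?case
  proof (cases "s \<in> \<sigma>")
    case False
    then have "\<sigma>' = \<sigma>" by (auto simp: \<sigma>'_def)
    then have "?F \<sigma> (s # L) = b s * ((- 1) ^ card \<sigma> * (\<Sum>\<tau>\<in>Pow \<sigma>. ?T \<tau> L))"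
      using False IH by simp
    also have "\<dots> = (- 1) ^ card \<sigma> * (\<Sum>\<tau>\<in>Pow \<sigma>. b s * ?T \<tau> L)"
      by (simp add: sign sum_distrib_left)
    also have "(\<Sum>\<tau>\<in>Pow \<sigma>. b s * ?T \<tau> L) = (\<Sum>\<tau>\<in>Pow \<sigma>. ?T \<tau> (s # L))"
      using T \<open>\<sigma>' = \<sigma>\<close> by (intro sum.cong HOL.refl) simp
    finally show ?thesis .
  next
    case True
    then have \<sigma>: "\<sigma> = insert s \<sigma>'" "s \<notin> \<sigma>'" by (auto simp: \<sigma>'_def)
    have inj: "inj_on (insert s) (Pow \<sigma>')" using \<sigma>(2) by (auto simp: inj_on_def)
    have "(\<Sum>\<tau>\<in>Pow \<sigma>. ?T \<tau> (s # L)) =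
        (\<Sum>\<tau>\<in>Pow \<sigma>'. ?T \<tau> (s # L)) + (\<Sum>\<tau>\<in>insert s ` Pow \<sigma>'. ?T \<tau> (s # L))"
      unfolding \<sigma>(1) Pow_insert using fin \<sigma>(2) by (intro sum.union_disjoint) auto
    also have "(\<Sum>\<tau>\<in>insert s ` Pow \<sigma>'. ?T \<tau> (s # L)) = (\<Sum>\<tau>\<in>Pow \<sigma>'. ?T (insert s \<tau>) (s # L))"
      unfolding sum.reindex[OF inj] comp_def ..
    also have "\<dots> = (\<Sum>\<tau>\<in>Pow \<sigma>'. a s * ?T \<tau> L)" using T by (intro sum.cong HOL.refl) simp
    also have "(\<Sum>\<tau>\<in>Pow \<sigma>'. ?T \<tau> (s # L)) = (\<Sum>\<tau>\<in>Pow \<sigma>'. b s * ?T \<tau> L)"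
      using T by (intro sum.cong HOL.refl) simp
    finally have "(\<Sum>\<tau>\<in>Pow \<sigma>. ?T \<tau> (s # L)) = (b s + a s) * (\<Sum>\<tau>\<in>Pow \<sigma>'. ?T \<tau> L)"
      by (simp only: sum_distrib_left[symmetric] distrib_right)
    moreover have "?F \<sigma> (s # L) = - (b s + a s) * ((- 1) ^ card \<sigma>' * (\<Sum>\<tau>\<in>Pow \<sigma>'. ?T \<tau> L))"
      using True F IH by simp
    moreover have "card \<sigma> = Suc (card \<sigma>')" using \<sigma> fin by simp
    ultimately show ?thesis by (simp only: sign power_Suc mult_minus_left mult_1 mult_minus_right)
  qed
qed

lemma alternating_sum_Pow:
  assumes "finite A"
  shows "(\<Sum>\<sigma>\<in>Pow A. (- 1) ^ card \<sigma>) = (if A = {} then 1 else 0 :: 'a::ring_1)"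
  using assms
proof (induction A rule: finite_induct)
  case (insert x A)
  have inj: "inj_on (insert x) (Pow A)" using insert(2) by (auto simp: inj_on_def)
  have "(\<Sum>\<sigma>\<in>Pow (insert x A). (- 1) ^ card \<sigma> :: 'a) =
      (\<Sum>\<sigma>\<in>Pow A. (- 1) ^ card \<sigma>) + (\<Sum>\<sigma>\<in>insert x ` Pow A. (- 1) ^ card \<sigma>)"
    unfolding Pow_insert using insert by (intro sum.union_disjoint) auto
  also have "(\<Sum>\<sigma>\<in>insert x ` Pow A. (- 1) ^ card \<sigma> :: 'a) = (\<Sum>\<sigma>\<in>Pow A. (- 1) ^ card (insert x \<sigma>))"
    unfolding sum.reindex[OF inj] comp_def ..
  also have "\<dots> = (\<Sum>\<sigma>\<in>Pow A. - ((- 1) ^ card \<sigma>))"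
  proof (rule sum.cong)
    fix \<sigma> assume "\<sigma> \<in> Pow A"
    then have "x \<notin> \<sigma>" "finite \<sigma>" using insert finite_subset by auto
    then show "(- 1) ^ card (insert x \<sigma>) = - ((- 1) ^ card \<sigma> :: 'a)" by simp
  qed simp
  finally show ?case by (simp add: sum_negf)
qed simp

lemma (in racg) finite_nerve: "finite (nerve S)"
  using finite_gens by (auto simp: nerve_def intro: finite_subset[of _ "Pow S"])

lemma (in racg) nerve_subset: "\<sigma> \<in> nerve S \<Longrightarrow> \<tau> \<subseteq> \<sigma> \<Longrightarrow> \<tau> \<in> nerve S"
  unfolding nerve_iff by blast

lemma (in racg) descents_in_nerve: "descents w \<in> nerve S"
  unfolding nerve_iff using descents_subset descents_clique by blast

lemma neg_one_power_of_int: "of_int (neg_one_power k) = neg_one_power k"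
  by (simp add: neg_one_power_def)

text \<open>Deleting \<open>\<tau>\<close> maps the faces above it bijectively to its link. A factor
  \<open>- 1\<close> arises as dimension is cardinality minus one, and the dimension of
  \<open>\<tau>\<close> cancels, so the sign is the same for every face, the empty one
  included.\<close>

lemma (in racg) alternating_sum_over_star:
  assumes sphere: "eulerian_sphere k (nerve S)" and \<tau>: "\<tau> \<in> nerve S"
  shows "(\<Sum>\<sigma>\<in>{\<sigma> \<in> nerve S. \<tau> \<subseteq> \<sigma>}. (- 1) ^ card \<sigma>) = (neg_one_power (k + 1) :: int)"
proof -
  have fin: "finite \<sigma>" if "\<sigma> \<in> nerve S" for \<sigma>
    using that finite_gens finite_subset by (auto simp: nerve_def)
  have "(\<Sum>\<sigma>\<in>{\<sigma> \<in> nerve S. \<tau> \<subseteq> \<sigma>}. (- 1) ^ card \<sigma> :: int) =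
      (\<Sum>\<rho>\<in>link (nerve S) \<tau>. (- 1) ^ (card \<rho> + card \<tau>))"
  proof (rule sum.reindex_bij_witness[of _ "\<lambda>\<rho>. \<rho> \<union> \<tau>" "\<lambda>\<sigma>. \<sigma> - \<tau>"])
    fix \<sigma> assume "\<sigma> \<in> {\<sigma> \<in> nerve S. \<tau> \<subseteq> \<sigma>}"
    then have \<sigma>: "\<sigma> \<in> nerve S" "\<tau> \<subseteq> \<sigma>" by auto
    then show "\<sigma> - \<tau> \<union> \<tau> = \<sigma>" by auto
    then show "\<sigma> - \<tau> \<in> link (nerve S) \<tau>"
      using \<sigma> nerve_subset[of \<sigma> "\<sigma> - \<tau>"] by (auto simp: link_def)
    have "card (\<sigma> - \<tau>) + card \<tau> = card \<sigma>"
      using \<sigma> fin[OF \<sigma>(1)] card_mono[OF fin[OF \<sigma>(1)] \<sigma>(2)] finite_subset[OF \<sigma>(2)]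
      by (simp add: card_Diff_subset)
    then show "(- 1) ^ (card (\<sigma> - \<tau>) + card \<tau>) = (- 1 :: int) ^ card \<sigma>" by simp
  qed (auto simp: link_def)
  also have "\<dots> = - ((- 1) ^ card \<tau> * euler_bar (link (nerve S) \<tau>))"
    by (auto simp: euler_bar_def sum_distrib_left sum_negf[symmetric] neg_one_power_def simplex_dim_def
        power_add minus_one_power_iff intro!: sum.cong)
  also have "euler_bar (link (nerve S) \<tau>) = neg_one_power (k - 1 - simplex_dim \<tau>)"
    using sphere \<tau> by (simp add: eulerian_sphere_def)
  also have "- ((- 1) ^ card \<tau> * neg_one_power (k - 1 - simplex_dim \<tau>)) = (neg_one_power (k + 1) :: int)"
    by (auto simp: neg_one_power_def simplex_dim_def minus_one_power_iff)
  finally show ?thesis .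
qed

lemma nat_exponent_add_eq_zero: "a + b = 0 \<longleftrightarrow> a = 0 \<and> b = (0 :: 'i \<Rightarrow>\<^sub>0 nat)"
  by (auto simp: poly_mapping_eq_iff fun_eq_iff lookup_add)

text \<open>Natural exponents cannot cancel, so only the two constant terms contribute.\<close>

lemma lookup_mult_zero:
  fixes p q :: "('i \<Rightarrow>\<^sub>0 nat) \<Rightarrow>\<^sub>0 'r::ring_1"
  shows "Poly_Mapping.lookup (p * q) 0 = Poly_Mapping.lookup p 0 * Poly_Mapping.lookup q 0"
proof (induction p rule: poly_mapping_additive_induct)
  case (add p p') then show ?case by (simp add: distrib_right lookup_add)
next
  case (single a r)
  show ?case
    by (induction q rule: poly_mapping_additive_induct)
      (auto simp: distrib_left lookup_add mult_single lookup_single when_def nat_exponent_add_eq_zero)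
qed

lemma lookup_prod_list_zero:
  fixes xs :: "(('i \<Rightarrow>\<^sub>0 nat) \<Rightarrow>\<^sub>0 'r::ring_1) list"
  shows "Poly_Mapping.lookup (prod_list xs) 0 = prod_list (map (\<lambda>p. Poly_Mapping.lookup p 0) xs)"
  by (induction xs) (auto simp: lookup_mult_zero)

lemma at_t_prod_list: "at_t (prod_list (map f xs)) = prod_list (map (\<lambda>x. at_t (f x)) xs)"
  by (induction xs) (auto simp: at_t_simps)

lemma at_t_inv_prod_list: "at_t_inv (prod_list (map f xs)) = prod_list (map (\<lambda>x. at_t_inv (f x)) xs)"
  by (induction xs) (auto simp: at_t_inv_simps)

section \<open>The denominator of the complete growth series\<close>

text \<open>The list \<open>L\<close> fixes the order of the factors in products over all
  generators, which matters over the group ring.\<close>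

locale weighted_racg = racg S m for S :: "'w::group_add set" and m +
  fixes i :: "'w \<Rightarrow> 'i" and L :: "'w list"
  assumes distinct_gens: "distinct L" and set_gens: "set L = S"
begin

lemma total_degree_exponent: "total_degree (exponent i w) = len w"
proof -
  have "total_degree (\<Sum>s\<in>A. Poly_Mapping.single (i s) (length (state w s s))) =
      (\<Sum>s\<in>A. length (state w s s))" if "finite A" for A
    using that by induction (simp_all add: total_degree_add)
  then show ?thesis using finite_gens by (simp add: exponent_def len_def)
qed

lemma finite_exponent_fibre: "finite {w. int_exponent (growth_exponent S i w) = c}"
proof (cases "\<exists>a. c = int_exponent a")
  case True
  then obtain a where "c = int_exponent a" by blast
  then have "{w. int_exponent (growth_exponent S i w) = c} \<subseteq> {w. len w \<le> total_degree a}"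
    by (auto simp: growth_exponent_eq simp flip: total_degree_exponent)
  then show ?thesis using finite_len_le finite_subset by blast
next
  case False
  then have "{w. int_exponent (growth_exponent S i w) = c} = {}" by auto
  then show ?thesis by (metis finite.emptyI)
qed

lemma weighted_growth_add:
  "weighted_growth S i f + weighted_growth S i g = weighted_growth S i (\<lambda>w. f w + g w :: 'r::ring_1)"
  by (rule laurent_eqI) (simp add: laurent_coeff_weighted_growth sum.distrib)

text \<open>Right multiplication by \<open>s\<close> is a bijection from the elements without the
  descent \<open>s\<close> onto those with it, and it raises the exponent of the indeterminate of
  \<open>s\<close> by one; \<open>f\<close> is supported on the former.\<close>

lemma weighted_growth_mult_gen:
  fixes f :: "'w \<Rightarrow> 'w \<Rightarrow>\<^sub>0 rat"
  assumes s: "s \<in> S" and f: "\<And>w. s \<in> descents w \<Longrightarrow> f w = 0"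
  shows "weighted_growth S i f * at_t (Poly_Mapping.single (Poly_Mapping.single (i s) 1) (Poly_Mapping.single s 1)) =
    weighted_growth S i (\<lambda>w. if s \<in> descents w then f (w + s) * Poly_Mapping.single s 1 else 0)"
proof (rule laurent_eqI)
  fix c
  let ?e = "\<lambda>w. int_exponent (exponent i w)"
  let ?a = "int_exponent (Poly_Mapping.single (i s) 1)"
  have fin: "finite {w. ?e w = c}" for c using finite_exponent_fibre[of c] by (simp add: growth_exponent_eq)
  have "laurent_coeff (weighted_growth S i f * at_t (Poly_Mapping.single (Poly_Mapping.single (i s) 1) (Poly_Mapping.single s 1))) c =
      (\<Sum>w | ?e w = c - ?a. f w * Poly_Mapping.single s 1)"
    by (simp add: at_t_simps laurent_coeff_mult_monom laurent_coeff_weighted_growth growth_exponent_eq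
        sum_distrib_right)
  also have "\<dots> = (\<Sum>w | ?e w = c - ?a \<and> s \<notin> descents w. f w * Poly_Mapping.single s 1)"
    using fin f by (intro sum.mono_neutral_right) auto
  also have "\<dots> = (\<Sum>w | ?e w = c \<and> s \<in> descents w. f (w + s) * Poly_Mapping.single s 1)"
  proof (rule sum.reindex_bij_witness[of _ "\<lambda>w. w + s" "\<lambda>w. w + s"])
    fix w assume "w \<in> {w. ?e w = c - ?a \<and> s \<notin> descents w}"
    then have w: "?e w = c - ?a" "s \<notin> descents w" by auto
    show "w + s + s = w" using gen_involution'[OF s] .
    then show "f (w + s + s) * Poly_Mapping.single s 1 = f w * Poly_Mapping.single s 1" by simp
    show "w + s \<in> {w. ?e w = c \<and> s \<in> descents w}"
      using w descent_after_ascent[OF s w(2)] exponent_ascent[OF s w(2), of i] by (simp add: int_exponent_add)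
  next
    fix w assume "w \<in> {w. ?e w = c \<and> s \<in> descents w}"
    then have w: "?e w = c" "s \<in> descents w" by auto
    show "w + s + s = w" using gen_involution'[OF s] .
    then show "w + s \<in> {w. ?e w = c - ?a \<and> s \<notin> descents w}"
      using w ascent_after_descent[OF w(2)] exponent_ascent[OF s ascent_after_descent[OF w(2)], of i]
      by (auto simp: int_exponent_add)
  qed
  also have "\<dots> = (\<Sum>w | ?e w = c. if s \<in> descents w then f (w + s) * Poly_Mapping.single s 1 else 0)"
    using fin by (intro sum.mono_neutral_cong_left) auto
  finally show "laurent_coeff (weighted_growth S i f * at_t (Poly_Mapping.single (Poly_Mapping.single (i s) 1) (Poly_Mapping.single s 1))) c =
      laurent_coeff (weighted_growth S i (\<lambda>w. if s \<in> descents w then f (w + s) * Poly_Mapping.single s 1 else 0)) c"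
    by (simp add: laurent_coeff_weighted_growth growth_exponent_eq)
qed

definition partial_growth :: "'w set \<Rightarrow> ('i, 'w \<Rightarrow>\<^sub>0 rat) laurent" where
  "partial_growth \<sigma> = weighted_growth S i (\<lambda>w. if \<sigma> \<subseteq> descents w then Poly_Mapping.single w 1 else 0)"

lemma partial_growth_empty: "partial_growth {} = complete_growth_series S i"
  by (simp add: partial_growth_def complete_growth_series_def)

definition gen_poly :: "'w \<Rightarrow> ('i \<Rightarrow>\<^sub>0 nat) \<Rightarrow>\<^sub>0 ('w \<Rightarrow>\<^sub>0 rat)" where
  "gen_poly s = Poly_Mapping.single (Poly_Mapping.single (i s) 1) (Poly_Mapping.single s 1)"

definition square_poly :: "'w \<Rightarrow> ('i \<Rightarrow>\<^sub>0 nat) \<Rightarrow>\<^sub>0 ('w \<Rightarrow>\<^sub>0 rat)" where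
  "square_poly s = Poly_Mapping.single (Poly_Mapping.single (i s) 2) 1"

text \<open>The square \<open>t^2\<close> is central. Extending the fraction
  \<open>- s t / (1 + s t)\<close> by \<open>1 - s t\<close> therefore produces a central
  denominator \<open>1 - t^2\<close> and the numerator \<open>t^2 - s t\<close>.\<close>

lemma gen_poly_square: "s \<in> S \<Longrightarrow> gen_poly s * gen_poly s = square_poly s"
  by (simp add: gen_poly_def square_poly_def mult_single gen_involution numeral_2_eq_2 flip: single_add)

text \<open>The fraction \<open>- s t / (1 + s t)\<close>, for \<open>t\<close> the indeterminate of \<open>s\<close>, is the quotient of
  \<open>numer s\<close> by the central polynomial \<open>denom s\<close>.\<close>

definition denom :: "'w \<Rightarrow> ('i \<Rightarrow>\<^sub>0 nat) \<Rightarrow>\<^sub>0 ('w \<Rightarrow>\<^sub>0 rat)" where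
  "denom s = 1 - square_poly s"

definition numer :: "'w \<Rightarrow> ('i \<Rightarrow>\<^sub>0 nat) \<Rightarrow>\<^sub>0 ('w \<Rightarrow>\<^sub>0 rat)" where
  "numer s = square_poly s - gen_poly s"

lemma central_denom: "central (at_t (denom s))"
  unfolding denom_def square_poly_def
  by (simp add: at_t_simps central_diff central_1 central_monom)

lemma partial_growth_step:
  assumes s: "s \<in> S" "s \<notin> \<sigma>" and \<sigma>: "insert s \<sigma> \<in> nerve S"
  shows "partial_growth \<sigma> * at_t (numer s) = - (partial_growth (insert s \<sigma>) * at_t (denom s))"
proof -
  let ?Y = "at_t (gen_poly s)"
  let ?f = "\<lambda>w. if \<sigma> \<subseteq> descents w \<and> s \<notin> descents w then Poly_Mapping.single w 1 else 0 :: 'w \<Rightarrow>\<^sub>0 rat"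
  \<comment> \<open>The members of \<open>\<sigma>\<close> differ from \<open>s\<close> and commute
    with it, as they lie in a common face.\<close>
  have desc: "\<sigma> \<subseteq> descents (w + s) \<longleftrightarrow> \<sigma> \<subseteq> descents w" for w
  proof -
    have "b \<in> descents (w + s) \<longleftrightarrow> b \<in> descents w" if "b \<in> \<sigma>" for b
      using descents_commute[OF s(1), of b w] \<sigma> s(2) that unfolding nerve_iff by blast
    then show ?thesis by blast
  qed
  have "weighted_growth S i ?f * ?Y = partial_growth (insert s \<sigma>)"
    unfolding gen_poly_def partial_growth_def
  proof (subst weighted_growth_mult_gen[OF s(1)])
    show "weighted_growth S i (\<lambda>w. if s \<in> descents w then ?f (w + s) * Poly_Mapping.single s 1 else 0) =
        weighted_growth S i (\<lambda>w. if insert s \<sigma> \<subseteq> descents w then Poly_Mapping.single w 1 else 0)"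
      by (rule arg_cong[of _ _ "weighted_growth S i"])
        (auto simp: fun_eq_iff desc mult_single gen_involution'[OF s(1)] ascent_after_descent)
  qed simp
  moreover have "partial_growth \<sigma> = partial_growth (insert s \<sigma>) + weighted_growth S i ?f"
    unfolding partial_growth_def weighted_growth_add
    by (rule arg_cong[of _ _ "weighted_growth S i"]) (auto simp: fun_eq_iff)
  ultimately have step: "partial_growth \<sigma> * ?Y = partial_growth (insert s \<sigma>) * (1 + ?Y)"
    by (simp add: distrib_left distrib_right add.commute)
  \<comment> \<open>The recursion is multiplied by \<open>- (1 - ?Y)\<close> to pass from
    \<open>1 + ?Y\<close> to the central denominator.\<close>
  have "numer s = - (gen_poly s * (1 - gen_poly s))"
    using gen_poly_square[OF s(1)] by (simp add: numer_def right_diff_distrib)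
  then have n: "at_t (numer s) = - (?Y * (1 - ?Y))" by (simp add: at_t_simps)
  have "denom s = (1 + gen_poly s) * (1 - gen_poly s)"
    using gen_poly_square[OF s(1)] by (simp add: denom_def right_diff_distrib distrib_right)
  then have d: "at_t (denom s) = (1 + ?Y) * (1 - ?Y)" by (simp add: at_t_simps)
  have "partial_growth \<sigma> * at_t (numer s) = - (partial_growth \<sigma> * ?Y * (1 - ?Y))"
    unfolding n by (simp add: mult.assoc)
  also have "\<dots> = - (partial_growth (insert s \<sigma>) * at_t (denom s))"
    unfolding step d by (simp add: mult.assoc)
  finally show ?thesis .
qed

text \<open>The product of the fractions \<open>x\<^sub>s\<close> over \<open>\<sigma>\<close>,
  multiplied by the denominators of all generators and not only of those in \<open>\<sigma>\<close>,
  so that all faces share one denominator.\<close>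

definition face_poly :: "'w set \<Rightarrow> ('i \<Rightarrow>\<^sub>0 nat) \<Rightarrow>\<^sub>0 ('w \<Rightarrow>\<^sub>0 rat)" where
  "face_poly \<sigma> = prod_list (map (\<lambda>s. if s \<in> \<sigma> then numer s else denom s) L)"

text \<open>The common denominator of the faces becomes the numerator of the series, since the
  series is the inverse of their sum.\<close>

definition growth_numer :: "('i \<Rightarrow>\<^sub>0 nat) \<Rightarrow>\<^sub>0 ('w \<Rightarrow>\<^sub>0 rat)" where
  "growth_numer = prod_list (map denom L)"

definition growth_denom :: "('i \<Rightarrow>\<^sub>0 nat) \<Rightarrow>\<^sub>0 ('w \<Rightarrow>\<^sub>0 rat)" where
  "growth_denom = (\<Sum>\<sigma>\<in>nerve S. face_poly \<sigma>)"

lemma central_growth_numer: "central (at_t growth_numer)"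
  unfolding growth_numer_def at_t_prod_list by (rule central_prod_list) (auto simp: central_denom)

text \<open>The step for one generator is iterated along the list, \<open>\<tau>\<close> collecting
  the members of \<open>\<sigma>\<close> already passed. Each \<open>denom s\<close> is central and
  is moved out of the way of the remaining factors.\<close>

lemma partial_growth_chain:
  assumes "distinct xs" "set xs \<subseteq> S" "\<tau> \<inter> set xs = {}" "\<tau> \<union> (\<sigma> \<inter> set xs) \<in> nerve S"
  shows "partial_growth \<tau> * prod_list (map (\<lambda>s. if s \<in> \<sigma> then at_t (numer s) else at_t (denom s)) xs) =
    (- 1) ^ card (\<sigma> \<inter> set xs) * partial_growth (\<tau> \<union> (\<sigma> \<inter> set xs)) * prod_list (map (\<lambda>s. at_t (denom s)) xs)"
  using assms
proof (induction xs arbitrary: \<tau>)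
  case Nil then show ?case by simp
next
  case (Cons s xs)
  let ?R = "prod_list (map (\<lambda>s. if s \<in> \<sigma> then at_t (numer s) else at_t (denom s)) xs)"
  let ?D = "prod_list (map (\<lambda>s. at_t (denom s)) xs)"
  note comm = central_commute[OF central_denom[of s]]
  show ?case
  proof (cases "s \<in> \<sigma>")
    case True
    have n: "insert s \<tau> \<in> nerve S" by (rule nerve_subset[OF Cons.prems(4)]) (use True in auto)
    have eq: "insert s \<tau> \<union> (\<sigma> \<inter> set xs) = \<tau> \<union> (\<sigma> \<inter> set (s # xs))" using True by auto
    have IH: "partial_growth (insert s \<tau>) * ?R =
        (- 1) ^ card (\<sigma> \<inter> set xs) * partial_growth (\<tau> \<union> (\<sigma> \<inter> set (s # xs))) * ?D"
      using Cons.IH[of "insert s \<tau>"] Cons.prems unfolding eq by auto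
    have c: "card (\<sigma> \<inter> set (s # xs)) = Suc (card (\<sigma> \<inter> set xs))" using True Cons.prems by simp
    have "partial_growth \<tau> * (at_t (numer s) * ?R) = - (partial_growth (insert s \<tau>) * (at_t (denom s) * ?R))"
      using partial_growth_step[of s \<tau>] Cons.prems n by (simp flip: mult.assoc)
    also have "\<dots> = - (partial_growth (insert s \<tau>) * ?R * at_t (denom s))"
      by (simp add: comm mult.assoc)
    also have "\<dots> = - ((- 1) ^ card (\<sigma> \<inter> set xs) * partial_growth (\<tau> \<union> (\<sigma> \<inter> set (s # xs))) * (at_t (denom s) * ?D))"
      unfolding IH by (simp add: comm mult.assoc)
    finally show ?thesis using True unfolding c by (simp add: mult.assoc)
  next
    case False
    have eq: "\<tau> \<union> (\<sigma> \<inter> set (s # xs)) = \<tau> \<union> (\<sigma> \<inter> set xs)" "\<sigma> \<inter> set (s # xs) = \<sigma> \<inter> set xs"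
      using False by auto
    have IH: "partial_growth \<tau> * ?R = (- 1) ^ card (\<sigma> \<inter> set xs) * partial_growth (\<tau> \<union> (\<sigma> \<inter> set xs)) * ?D"
      using Cons.IH[of \<tau>] Cons.prems eq by auto
    have "partial_growth \<tau> * (at_t (denom s) * ?R) = partial_growth \<tau> * ?R * at_t (denom s)"
      by (simp add: comm mult.assoc)
    also have "\<dots> = (- 1) ^ card (\<sigma> \<inter> set xs) * partial_growth (\<tau> \<union> (\<sigma> \<inter> set xs)) * (at_t (denom s) * ?D)"
      unfolding IH by (simp add: comm mult.assoc)
    finally show ?thesis using False unfolding eq by simp
  qed
qed

lemma partial_growth_alternating_sum: "(\<Sum>\<sigma>\<in>nerve S. (- 1) ^ card \<sigma> * partial_growth \<sigma>) = 1"
proof (rule laurent_eqI)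
  fix c
  let ?F = "{w. int_exponent (growth_exponent S i w) = c}"
  have coeff_sign: "laurent_coeff ((- 1) ^ n * f) c = (- 1) ^ n * laurent_coeff f c"
    for n and f :: "('i, 'w \<Rightarrow>\<^sub>0 rat) laurent"
    by (cases "even n") simp_all
  have "laurent_coeff (\<Sum>\<sigma>\<in>nerve S. (- 1) ^ card \<sigma> * partial_growth \<sigma>) c =
      (\<Sum>\<sigma>\<in>nerve S. \<Sum>w\<in>?F. if \<sigma> \<subseteq> descents w then (- 1) ^ card \<sigma> * Poly_Mapping.single w 1 else 0)"
    unfolding laurent_coeff_sum coeff_sign partial_growth_def laurent_coeff_weighted_growth sum_distrib_left
    by (intro sum.cong HOL.refl) auto
  also have "\<dots> = (\<Sum>w\<in>?F. \<Sum>\<sigma>\<in>nerve S. if \<sigma> \<subseteq> descents w then (- 1) ^ card \<sigma> * Poly_Mapping.single w 1 else 0)"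
    by (rule sum.swap)
  \<comment> \<open>Every subset of \<open>descents w\<close> is a face, so the inner sum runs over
    a full power set.\<close>
  also have "\<dots> = (\<Sum>w\<in>?F. (\<Sum>\<sigma>\<in>Pow (descents w). (- 1) ^ card \<sigma>) * Poly_Mapping.single w 1)"
  proof (rule sum.cong)
    fix w
    have "(\<Sum>\<sigma>\<in>nerve S. if \<sigma> \<subseteq> descents w then (- 1) ^ card \<sigma> * Poly_Mapping.single w 1 else 0 :: 'w \<Rightarrow>\<^sub>0 rat) =
        (\<Sum>\<sigma>\<in>Pow (descents w). (- 1) ^ card \<sigma> * Poly_Mapping.single w 1)"
      using finite_nerve descents_in_nerve[of w] nerve_subset
      by (intro sum.mono_neutral_cong_right) auto
    then show "(\<Sum>\<sigma>\<in>nerve S. if \<sigma> \<subseteq> descents w then (- 1) ^ card \<sigma> * Poly_Mapping.single w 1 else 0 :: 'w \<Rightarrow>\<^sub>0 rat) =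
        (\<Sum>\<sigma>\<in>Pow (descents w). (- 1) ^ card \<sigma>) * Poly_Mapping.single w 1"
      by (simp add: sum_distrib_right)
  qed simp
  also have "\<dots> = (\<Sum>w\<in>?F. if w = 0 then 1 else 0)"
    by (intro sum.cong HOL.refl) (simp add: alternating_sum_Pow finite_descents descents_empty_iff)
  also have "\<dots> = laurent_coeff 1 c"
    using finite_exponent_fibre[of c] by (auto simp: laurent_coeff_one growth_exponent_eq)
  finally show "laurent_coeff (\<Sum>\<sigma>\<in>nerve S. (- 1) ^ card \<sigma> * partial_growth \<sigma>) c = laurent_coeff 1 c" .
qed

lemma growth_times_denom: "complete_growth_series S i * at_t growth_denom = at_t growth_numer"
proof -
  have "complete_growth_series S i * at_t (face_poly \<sigma>) =
      (- 1) ^ card \<sigma> * partial_growth \<sigma> * at_t growth_numer" if "\<sigma> \<in> nerve S" for \<sigma>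
  proof -
    have \<sigma>: "\<sigma> \<inter> S = \<sigma>" using that by (auto simp: nerve_def)
    have "at_t (face_poly \<sigma>) = prod_list (map (\<lambda>s. if s \<in> \<sigma> then at_t (numer s) else at_t (denom s)) L)"
      unfolding face_poly_def at_t_prod_list by (intro arg_cong[of _ _ prod_list] map_cong) auto
    then show ?thesis
      using partial_growth_chain[of L "{}" \<sigma>] distinct_gens set_gens \<sigma> that
      by (simp add: partial_growth_empty growth_numer_def at_t_prod_list)
  qed
  then have "complete_growth_series S i * at_t growth_denom =
      (\<Sum>\<sigma>\<in>nerve S. (- 1) ^ card \<sigma> * partial_growth \<sigma> * at_t growth_numer)"
    unfolding growth_denom_def at_t_simps sum_distrib_left by (intro sum.cong HOL.refl)
  also have "\<dots> = (\<Sum>\<sigma>\<in>nerve S. (- 1) ^ card \<sigma> * partial_growth \<sigma>) * at_t growth_numer"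
    by (rule sum_distrib_right[symmetric])
  finally show ?thesis by (simp add: partial_growth_alternating_sum)
qed

section \<open>Inverting the indeterminates in numerator and denominator\<close>

definition inv_unit :: "'w \<Rightarrow> ('i, 'w \<Rightarrow>\<^sub>0 rat) laurent" where
  "inv_unit s = laurent_monom (- 1) (- int_exponent (Poly_Mapping.single (i s) 2))"

definition inversion_factor :: "('i, 'w \<Rightarrow>\<^sub>0 rat) laurent" where
  "inversion_factor = prod_list (map inv_unit L)"

lemma central_inv_unit: "central (inv_unit s)"
  unfolding inv_unit_def by (intro central_monom central_minus central_1)

lemma central_inversion_factor: "central inversion_factor"
  unfolding inversion_factor_def by (rule central_prod_list) (auto simp: central_inv_unit)

lemma inversion_factor_invertible: "\<exists>V. V * inversion_factor = 1"
proof -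
  let ?v = "\<lambda>s. laurent_monom (- 1) (int_exponent (Poly_Mapping.single (i s) 2)) :: ('i, 'w \<Rightarrow>\<^sub>0 rat) laurent"
  have v: "central (?v s)" for s by (intro central_monom central_minus central_1)
  have "?v s * inv_unit s = 1" for s
    by (simp add: inv_unit_def laurent_monom_mult laurent_monom_one)
  then have "prod_list (map (\<lambda>s. ?v s * inv_unit s) xs) = 1" for xs
    by (induction xs) simp_all
  then have "prod_list (map ?v L) * inversion_factor = 1"
    unfolding inversion_factor_def using prod_list_central_mult[of L ?v inv_unit] v by simp
  then show ?thesis by blast
qed

text \<open>The unit comes from \<open>1 - t^(-2) = - t^(-2) (1 - t^2)\<close>.\<close>

lemma at_t_inv_denom: "at_t_inv (denom s) = inv_unit s * at_t (denom s)"
  by (simp add: denom_def square_poly_def at_t_simps at_t_inv_simps inv_unit_def right_diff_distrib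
      laurent_monom_mult laurent_monom_one) (rule laurent_eqI, simp add: laurent_coeff_monom laurent_coeff_one)

text \<open>Divided by the previous identity this is the rule that \<open>x\<^sub>s\<close> becomes
  \<open>- 1 - x\<^sub>s\<close>, in a form without denominators.\<close>

lemma at_t_inv_numer: "at_t_inv (numer s) = inv_unit s * (- (at_t (denom s) + at_t (numer s)))"
proof -
  have e: "int_exponent (Poly_Mapping.single (i s) 2) =
      int_exponent (Poly_Mapping.single (i s) 1) + int_exponent (Poly_Mapping.single (i s) 1)"
    by (simp add: numeral_2_eq_2 flip: int_exponent_add single_add)
  have "at_t (denom s) + at_t (numer s) = 1 - at_t (gen_poly s)"
    by (simp add: denom_def numer_def at_t_simps)
  then have "inv_unit s * (- (at_t (denom s) + at_t (numer s))) =
      laurent_monom (- 1) (- int_exponent (Poly_Mapping.single (i s) 2)) * at_t (gen_poly s)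
      - laurent_monom (- 1) (- int_exponent (Poly_Mapping.single (i s) 2))"
    by (simp add: inv_unit_def right_diff_distrib)
  also have "\<dots> = at_t_inv (numer s)"
    by (rule laurent_eqI)
      (auto simp: numer_def square_poly_def gen_poly_def at_t_simps at_t_inv_simps laurent_monom_mult
        laurent_coeff_monom e)
  finally show ?thesis by simp
qed

lemma at_t_inv_growth_numer: "at_t_inv growth_numer = inversion_factor * at_t growth_numer"
  unfolding growth_numer_def at_t_prod_list at_t_inv_prod_list at_t_inv_denom inversion_factor_def
  by (rule prod_list_central_mult) (rule central_inv_unit)

lemma at_t_face_poly:
  "at_t (face_poly \<tau>) = prod_list (map (\<lambda>s. if s \<in> \<tau> then at_t (numer s) else at_t (denom s)) L)"
  unfolding face_poly_def at_t_prod_list by (intro arg_cong[of _ _ prod_list] map_cong) auto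

lemma at_t_inv_face_poly:
  assumes "\<sigma> \<in> nerve S"
  shows "at_t_inv (face_poly \<sigma>) = inversion_factor * ((- 1) ^ card \<sigma> * (\<Sum>\<tau>\<in>Pow \<sigma>. at_t (face_poly \<tau>)))"
proof -
  have \<sigma>: "\<sigma> \<subseteq> set L" using assms set_gens by (simp add: nerve_def)
  let ?f = "\<lambda>s. if s \<in> \<sigma> then - (at_t (denom s) + at_t (numer s)) else at_t (denom s)"
  have "at_t_inv (face_poly \<sigma>) = prod_list (map (\<lambda>s. inv_unit s * ?f s) L)"
    unfolding face_poly_def at_t_inv_prod_list
    by (intro arg_cong[of _ _ prod_list] map_cong) (auto simp: at_t_inv_numer at_t_inv_denom)
  also have "\<dots> = inversion_factor * prod_list (map ?f L)"
    unfolding inversion_factor_def by (rule prod_list_central_mult) (rule central_inv_unit)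
  also have "prod_list (map ?f L) = (- 1) ^ card \<sigma> * (\<Sum>\<tau>\<in>Pow \<sigma>. at_t (face_poly \<tau>))"
    unfolding at_t_face_poly by (rule prod_list_signed_subsets[OF distinct_gens \<sigma>])
  finally show ?thesis .
qed

text \<open>The sum of signs over the faces above \<open>\<tau>\<close> does not depend on
  \<open>\<tau>\<close>, so after exchanging the two summations it factors out and the original sum
  over faces reappears.\<close>

lemma at_t_inv_growth_denom:
  assumes sphere: "eulerian_sphere k (nerve S)"
  shows "at_t_inv growth_denom = neg_one_power (k + 1) * (inversion_factor * at_t growth_denom)"
proof -
  have "at_t_inv growth_denom = (\<Sum>\<sigma>\<in>nerve S. inversion_factor *
      (\<Sum>\<tau>\<in>{\<tau> \<in> nerve S. \<tau> \<subseteq> \<sigma>}. (- 1) ^ card \<sigma> * at_t (face_poly \<tau>)))"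
    unfolding growth_denom_def at_t_inv_simps
  proof (rule sum.cong)
    fix \<sigma> assume \<sigma>: "\<sigma> \<in> nerve S"
    then have "Pow \<sigma> = {\<tau> \<in> nerve S. \<tau> \<subseteq> \<sigma>}" using nerve_subset by blast
    then show "at_t_inv (face_poly \<sigma>) = inversion_factor *
        (\<Sum>\<tau>\<in>{\<tau> \<in> nerve S. \<tau> \<subseteq> \<sigma>}. (- 1) ^ card \<sigma> * at_t (face_poly \<tau>))"
      unfolding at_t_inv_face_poly[OF \<sigma>] by (simp add: sum_distrib_left)
  qed simp
  also have "\<dots> = inversion_factor *
      (\<Sum>\<sigma>\<in>nerve S. \<Sum>\<tau>\<in>{\<tau> \<in> nerve S. \<tau> \<subseteq> \<sigma>}. (- 1) ^ card \<sigma> * at_t (face_poly \<tau>))"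
    by (rule sum_distrib_left[symmetric])
  also have "(\<Sum>\<sigma>\<in>nerve S. \<Sum>\<tau>\<in>{\<tau> \<in> nerve S. \<tau> \<subseteq> \<sigma>}. (- 1) ^ card \<sigma> * at_t (face_poly \<tau>)) =
      (\<Sum>\<tau>\<in>nerve S. \<Sum>\<sigma>\<in>{\<sigma> \<in> nerve S. \<tau> \<subseteq> \<sigma>}. (- 1) ^ card \<sigma> * at_t (face_poly \<tau>))"
    by (rule sum.swap_restrict) (rule finite_nerve)+
  also have "\<dots> = (\<Sum>\<tau>\<in>nerve S. neg_one_power (k + 1) * at_t (face_poly \<tau>))"
  proof (rule sum.cong)
    fix \<tau> assume \<tau>: "\<tau> \<in> nerve S"
    \<comment> \<open>The sign is known as an integer and is carried into the Laurent ring by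
      \<open>of_int\<close>.\<close>
    have "(\<Sum>\<sigma>\<in>{\<sigma> \<in> nerve S. \<tau> \<subseteq> \<sigma>}. (- 1) ^ card \<sigma>) =
        (of_int (\<Sum>\<sigma>\<in>{\<sigma> \<in> nerve S. \<tau> \<subseteq> \<sigma>}. (- 1) ^ card \<sigma>) :: ('i, 'w \<Rightarrow>\<^sub>0 rat) laurent)"
      by simp
    also have "\<dots> = neg_one_power (k + 1)"
      unfolding alternating_sum_over_star[OF sphere \<tau>] by (rule neg_one_power_of_int)
    finally show "(\<Sum>\<sigma>\<in>{\<sigma> \<in> nerve S. \<tau> \<subseteq> \<sigma>}. (- 1) ^ card \<sigma> * at_t (face_poly \<tau>)) =
        neg_one_power (k + 1) * at_t (face_poly \<tau>)"
      by (simp flip: sum_distrib_right)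
  qed simp
  also have "\<dots> = neg_one_power (k + 1) * at_t growth_denom"
    by (simp add: growth_denom_def at_t_simps sum_distrib_left)
  finally show ?thesis by (simp add: neg_one_power_def)
qed

section \<open>Constant terms and invertibility of the denominator\<close>

lemma lookup_denom_zero: "Poly_Mapping.lookup (denom s) 0 = 1"
proof -
  have "Poly_Mapping.single (i s) (2::nat) \<noteq> 0" by (metis lookup_single_eq lookup_zero zero_neq_numeral)
  then show ?thesis by (simp add: denom_def square_poly_def lookup_minus lookup_one lookup_single when_def)
qed

lemma lookup_numer_zero: "Poly_Mapping.lookup (numer s) 0 = 0"
proof -
  have "Poly_Mapping.single (i s) (n::nat) \<noteq> 0" if "n > 0" for n
    using that by (metis lookup_single_eq lookup_zero less_numeral_extra(3))
  then show ?thesis by (simp add: numer_def square_poly_def gen_poly_def lookup_minus lookup_single when_def)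
qed

lemma lookup_growth_numer_zero: "Poly_Mapping.lookup growth_numer 0 = 1"
proof -
  have "prod_list (map (\<lambda>s. Poly_Mapping.lookup (denom s) 0) xs) = 1" for xs
    by (induction xs) (auto simp: lookup_denom_zero)
  then show ?thesis by (simp add: growth_numer_def lookup_prod_list_zero comp_def)
qed

text \<open>Each \<open>numer s\<close> has constant term zero, so only the empty face contributes.
  The value one yields an inverse among the power series and an admissible entry
  \<open>1 - growth_denom\<close> of a kernel.\<close>

lemma lookup_growth_denom_zero: "Poly_Mapping.lookup growth_denom 0 = 1"
proof -
  have p: "prod_list (map (\<lambda>s. Poly_Mapping.lookup (if s \<in> \<sigma> then numer s else denom s) 0) xs) =
      (if \<sigma> \<inter> set xs = {} then 1 else 0)" for \<sigma> xs
    by (induction xs) (auto simp: lookup_denom_zero lookup_numer_zero)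
  have "Poly_Mapping.lookup (face_poly \<sigma>) 0 = (if \<sigma> = {} then 1 else 0)" if "\<sigma> \<in> nerve S" for \<sigma>
  proof -
    have "\<sigma> \<inter> set L = \<sigma>" using that set_gens by (auto simp: nerve_def)
    then show ?thesis using p[of \<sigma> L] by (simp add: face_poly_def lookup_prod_list_zero comp_def)
  qed
  then have "Poly_Mapping.lookup growth_denom 0 = (\<Sum>\<sigma>\<in>nerve S. if \<sigma> = {} then 1 else 0)"
    unfolding growth_denom_def lookup_sum by (intro sum.cong HOL.refl)
  moreover have "{} \<in> nerve S" by (simp add: nerve_iff)
  ultimately show ?thesis using finite_nerve by simp
qed

lemma growth_denom_inverse:
  obtains g where "at_t growth_denom * g = 1" "g * at_t growth_denom = 1"
proof -
  have "order_ge 1 (at_t (1 - growth_denom))"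
    by (rule order_ge_at_t) (simp add: lookup_minus lookup_growth_denom_zero)
  then obtain g where "(1 - at_t (1 - growth_denom)) * g = 1" "g * (1 - at_t (1 - growth_denom)) = 1"
    by (rule one_minus_inverse)
  then show ?thesis using that by (simp add: at_t_simps)
qed

lemma growth_eq:
  assumes "at_t growth_denom * g = 1"
  shows "complete_growth_series S i = g * at_t growth_numer"
proof -
  have "complete_growth_series S i = complete_growth_series S i * (at_t growth_denom * g)"
    using assms by simp
  also have "\<dots> = at_t growth_numer * g"
    unfolding mult.assoc[symmetric] growth_times_denom ..
  also have "\<dots> = g * at_t growth_numer" by (rule central_commute[OF central_growth_numer])
  finally show ?thesis .
qed

text \<open>The descent recursion multiplies from the right, the transfer of values from the left;
  centrality of \<open>growth_numer\<close> mediates between the two.\<close>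

lemma denom_times_growth: "at_t growth_denom * complete_growth_series S i = at_t growth_numer"
proof -
  obtain g where g: "at_t growth_denom * g = 1" by (rule growth_denom_inverse)
  then show ?thesis unfolding growth_eq[OF g] by (simp flip: mult.assoc)
qed

end

text \<open>The fraction \<open>N\<^sup>-\<^sup>1 D\<close> is the value of an expression of size two.\<close>

definition fraction_kernel :: "(('i \<Rightarrow>\<^sub>0 nat) \<Rightarrow>\<^sub>0 'r::ring_1) \<Rightarrow> (('i \<Rightarrow>\<^sub>0 nat) \<Rightarrow>\<^sub>0 'r) \<Rightarrow> (('i \<Rightarrow>\<^sub>0 nat) \<Rightarrow>\<^sub>0 'r) mat" where
  "fraction_kernel N D = mat 2 2 (\<lambda>(j, l). if j = 0 then (if l = 0 then 1 - N else D - 1) else 0)"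

definition upper_triangular_mat :: "'a::ring_1 \<Rightarrow> 'a \<Rightarrow> 'a mat" where
  "upper_triangular_mat a b = mat 2 2 (\<lambda>(j, l). if j = 0 then (if l = 0 then a else b) else if l = 0 then 0 else 1)"

lemma upper_triangular_mat_mult:
  "upper_triangular_mat a b * upper_triangular_mat a' b' = upper_triangular_mat (a * a') (a * b' + b)"
proof (rule eq_matI)
  fix j l assume "j < dim_row (upper_triangular_mat (a * a') (a * b' + b))"
    "l < dim_col (upper_triangular_mat (a * a') (a * b' + b))"
  then have "j < 2" "l < 2" by (simp_all add: upper_triangular_mat_def)
  then show "(upper_triangular_mat a b * upper_triangular_mat a' b') $$ (j, l) =
      upper_triangular_mat (a * a') (a * b' + b) $$ (j, l)"
    by (simp add: upper_triangular_mat_def scalar_prod_def numeral_2_eq_2)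
qed (simp_all add: upper_triangular_mat_def)

lemma upper_triangular_mat_inverse:
  assumes "a * g = 1" "g * a = 1"
  shows "upper_triangular_mat a b * upper_triangular_mat g (- (g * b)) = 1\<^sub>m 2"
    and "upper_triangular_mat g (- (g * b)) * upper_triangular_mat a b = 1\<^sub>m 2"
proof -
  have one: "upper_triangular_mat 1 0 = (1\<^sub>m 2 :: 'a mat)"
    by (rule eq_matI) (auto simp: upper_triangular_mat_def less_2_cases_iff)
  have "a * (- (g * b)) + b = 0" using assms by (simp flip: mult.assoc)
  then show "upper_triangular_mat a b * upper_triangular_mat g (- (g * b)) = 1\<^sub>m 2"
    unfolding upper_triangular_mat_mult assms one[symmetric] by simp
  show "upper_triangular_mat g (- (g * b)) * upper_triangular_mat a b = 1\<^sub>m 2"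
    unfolding upper_triangular_mat_mult assms one[symmetric] by simp
qed

lemma upper_triangular_mat_carrier: "upper_triangular_mat a b \<in> carrier_mat 2 2"
  by (simp add: upper_triangular_mat_def)

lemma kernel_fraction:
  "kernel_at_t (fraction_kernel N D) = upper_triangular_mat (at_t N) (1 - at_t D)"
  "kernel_at_t_inv (fraction_kernel N D) = upper_triangular_mat (at_t_inv N) (1 - at_t_inv D)"
  by (auto simp: kernel_at_t_def kernel_at_t_inv_def fraction_kernel_def upper_triangular_mat_def
      at_t_simps at_t_inv_simps intro!: eq_matI)

text \<open>The first row of the inverse kernel consists of \<open>g\<close> and
  \<open>- g (1 - D)\<close>, with sum \<open>g D\<close>. Row and column admit only rational
  constants, so \<open>D\<close> has to sit inside \<open>Q\<close>; entering it as
  \<open>D - 1\<close> removes the constant term, and the summand \<open>g\<close> makes up for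
  it.\<close>

lemma fraction_expression:
  fixes N D :: "('i \<Rightarrow>\<^sub>0 nat) \<Rightarrow>\<^sub>0 ('w::group_add \<Rightarrow>\<^sub>0 rat)"
  assumes g: "at_t N * g = 1" "g * at_t N = 1"
    and 1: "Poly_Mapping.lookup N 0 = 1" "Poly_Mapping.lookup D 0 = 1"
  shows "is_expression (g * at_t D) 2 (mat 1 2 (\<lambda>(j, l). if l = 0 then 1 else 0))
    (fraction_kernel N D) (mat 2 1 (\<lambda>_. 1))"
proof -
  let ?A = "mat 1 2 (\<lambda>(j, l). if l = 0 then 1 else 0) :: rat mat"
  let ?B = "mat 2 1 (\<lambda>_. 1) :: rat mat"
  have inv: "inverse_matrix (kernel_at_t (fraction_kernel N D)) =
      upper_triangular_mat g (- (g * (1 - at_t D)))"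
    unfolding kernel_fraction
    by (rule inverse_matrix_eqI[OF upper_triangular_mat_carrier upper_triangular_mat_carrier
          upper_triangular_mat_inverse[OF g]])
  have const: "rat_constant 0 = (0 :: ('i, 'w \<Rightarrow>\<^sub>0 rat) laurent)"
    "rat_constant 1 = (1 :: ('i, 'w \<Rightarrow>\<^sub>0 rat) laurent)"
    by (simp_all add: rat_constant_def laurent_monom_one)
  have "sandwich ?A (kernel_at_t (fraction_kernel N D)) ?B = g * at_t D"
    unfolding sandwich_def inv
    by (simp add: upper_triangular_mat_def scalar_prod_def numeral_2_eq_2 const right_diff_distrib)
  moreover have "Poly_Mapping.lookup (fraction_kernel N D $$ (j, l)) 0 = 0" if "j < 2" "l < 2" for j l
    using that 1 by (auto simp: fraction_kernel_def lookup_minus)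
  ultimately show ?thesis unfolding is_expression_def by (auto simp: fraction_kernel_def)
qed

context weighted_racg begin

lemma complete_growth_reciprocity:
  assumes sphere: "eulerian_sphere k (nerve S)"
  shows "(\<exists>n A Q B. is_expression (complete_growth_series S i) n A Q B \<and>
         invertible_mat (kernel_at_t_inv Q)) \<and>
      (\<forall>n A Q B. is_expression (complete_growth_series S i) n A Q B \<and>
         invertible_mat (kernel_at_t_inv Q) \<longrightarrow>
         sandwich A (kernel_at_t_inv Q) B
           = neg_one_power (k + 1) * complete_growth_series S i)"
proof
  let ?e = "neg_one_power (k + 1) :: ('i, 'w \<Rightarrow>\<^sub>0 rat) laurent"
  let ?N = "growth_denom" and ?D = "growth_numer"
  have ee: "?e * ?e = 1" by (simp add: neg_one_power_def)
  obtain g where g: "at_t ?N * g = 1" "g * at_t ?N = 1" by (rule growth_denom_inverse)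
  obtain V where V: "V * inversion_factor = 1" using inversion_factor_invertible by blast
  then have V': "inversion_factor * V = 1" using central_commute[OF central_inversion_factor] by metis
  note N_inv = at_t_inv_growth_denom[OF sphere]
  have 1: "at_t_inv ?N * (?e * (g * V)) = 1"
  proof -
    have "at_t_inv ?N * (?e * (g * V)) = (?e * ?e) * (inversion_factor * (at_t ?N * g) * V)"
      unfolding N_inv by (cases "even k") (simp_all add: neg_one_power_def mult.assoc)
    then show ?thesis by (simp add: ee g V')
  qed
  have 2: "?e * (g * V) * at_t_inv ?N = 1"
  proof -
    have "?e * (g * V) * at_t_inv ?N = (?e * ?e) * (g * (V * inversion_factor) * at_t ?N)"
      unfolding N_inv by (cases "even k") (simp_all add: neg_one_power_def mult.assoc)
    then show ?thesis by (simp add: ee g V)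
  qed
  have "invertible_mat (kernel_at_t_inv (fraction_kernel ?N ?D))"
    unfolding invertible_mat_def kernel_fraction inverts_mat_def
    using upper_triangular_mat_inverse[OF 1 2]
    by (intro conjI exI) (auto simp: upper_triangular_mat_def)
  moreover have "is_expression (complete_growth_series S i) 2
      (mat 1 2 (\<lambda>(j, l). if l = 0 then 1 else 0)) (fraction_kernel ?N ?D) (mat 2 1 (\<lambda>_. 1))"
    unfolding growth_eq[OF g(1)]
    by (rule fraction_expression[OF g lookup_growth_denom_zero lookup_growth_numer_zero])
  ultimately show "\<exists>n A Q B. is_expression (complete_growth_series S i) n A Q B \<and>
      invertible_mat (kernel_at_t_inv Q)" by blast
  show "\<forall>n A Q B. is_expression (complete_growth_series S i) n A Q B \<and>
      invertible_mat (kernel_at_t_inv Q) \<longrightarrow>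
      sandwich A (kernel_at_t_inv Q) B = neg_one_power (k + 1) * complete_growth_series S i"
  proof (intro allI impI, elim conjE)
    fix n A Q B
    assume "is_expression (complete_growth_series S i) n A Q B" "invertible_mat (kernel_at_t_inv Q)"
    from value_of_expression_at_t_inv[OF this denom_times_growth]
    have v: "at_t_inv ?N * sandwich A (kernel_at_t_inv Q) B = at_t_inv ?D" .
    \<comment> \<open>The claimed value solves the same linear equation: numerator and denominator
      both acquire \<open>inversion_factor\<close>, but only the denominator acquires the
      sign.\<close>
    have "at_t_inv ?N * (?e * complete_growth_series S i) =
        (?e * ?e) * (inversion_factor * (at_t ?N * complete_growth_series S i))"
      unfolding N_inv by (cases "even k") (simp_all add: neg_one_power_def mult.assoc)
    also have "\<dots> = at_t_inv ?D" by (simp add: ee denom_times_growth at_t_inv_growth_numer)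
    finally have "at_t_inv ?N * sandwich A (kernel_at_t_inv Q) B =
        at_t_inv ?N * (?e * complete_growth_series S i)" using v by simp
    then have "?e * (g * V) * at_t_inv ?N * sandwich A (kernel_at_t_inv Q) B =
        ?e * (g * V) * at_t_inv ?N * (?e * complete_growth_series S i)" by (simp only: mult.assoc)
    then show "sandwich A (kernel_at_t_inv Q) B = ?e * complete_growth_series S i"
      unfolding 2 by simp
  qed
qed

text \<open>The augmentation of the group ring is the representation on one point.\<close>

lemma growth_reciprocity:
  assumes sphere: "eulerian_sphere k (nerve S)"
  shows "(\<exists>p q. expansion_of_fraction (growth_series S i) p q) \<and>
      (\<forall>p q. expansion_of_fraction (growth_series S i) p q \<longrightarrow>
         at_t_inv p * at_t q = neg_one_power (k + 1) * at_t p * at_t_inv q)"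
proof -
  interpret finite_action 1 "\<lambda>(w :: 'w) y. y" by unfold_locales auto
  define \<epsilon> where "\<epsilon> = perm_coeff (\<lambda>(w :: 'w) y. y) 0 0"
  interpret \<psi>: matrix_hom 1 "perm_coeff (\<lambda>(w :: 'w) y. y)" by (rule matrix_hom_perm_coeff)
  interpret E: matrix_hom 1 "\<lambda>y z. laurent_map (perm_coeff (\<lambda>(w :: 'w) y. y) y z)"
    by (rule \<psi>.matrix_hom_laurent)
  define E where "E = (laurent_map \<epsilon> :: ('i, 'w \<Rightarrow>\<^sub>0 rat) laurent \<Rightarrow> ('i, rat) laurent)"
  have E_mult: "E (f * g) = E f * E g" and E_one: "E 1 = 1" and E_diff: "E (f - g) = E f - E g" for f g
    using E.mult[of 0 0 f g] E.one[of 0 0] E.diff[of 0 0 f g] by (simp_all add: E_def \<epsilon>_def)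
  have E_zero: "E 0 = 0" using E_diff[of 0 0] by simp
  have E_sign: "E (neg_one_power j) = neg_one_power j" for j
    using E_diff[of 0 1] by (simp add: neg_one_power_def E_one E_zero)
  have E_at_t: "E (at_t p) = at_t (Poly_Mapping.map \<epsilon> p)"
    and E_at_t_inv: "E (at_t_inv p) = at_t_inv (Poly_Mapping.map \<epsilon> p)" for p
    unfolding E_def \<epsilon>_def at_t_eq_eval at_t_inv_eq_eval by (rule \<psi>.laurent_map_eval)+
  have \<epsilon>_single: "\<epsilon> (Poly_Mapping.single w r) = r" for w r by (simp add: \<epsilon>_def)
  have \<epsilon>_sum: "\<epsilon> (sum f A) = (\<Sum>x\<in>A. \<epsilon> (f x))" for f :: "'w \<Rightarrow> _" and A
    unfolding \<epsilon>_def by (rule \<psi>.sum)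
  have E_growth: "E (complete_growth_series S i) = growth_series S i"
    unfolding E_def complete_growth_series_def growth_series_def
    by (rule laurent_eqI, subst laurent_coeff_map)
      (simp_all add: laurent_coeff_weighted_growth \<epsilon>_sum \<epsilon>_single, simp add: \<epsilon>_def)
  let ?\<gamma> = "growth_series S i"
  let ?s = "neg_one_power (k + 1) :: ('i, rat) laurent"
  define q where "q = Poly_Mapping.map \<epsilon> growth_denom"
  define p where "p = Poly_Mapping.map \<epsilon> growth_numer"
  define U where "U = E inversion_factor"
  have q\<gamma>: "at_t q * ?\<gamma> = at_t p"
    using arg_cong[OF denom_times_growth, of E] by (simp add: E_mult E_at_t E_growth p_def q_def)
  obtain g where "at_t growth_denom * g = 1" by (rule growth_denom_inverse)
  then have qg: "at_t q * E g = 1"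
    using arg_cong[of _ _ E] by (metis E_mult E_one E_at_t q_def)
  then have q0: "q \<noteq> 0" by (auto simp: at_t_simps)
  obtain V where "V * inversion_factor = 1" using inversion_factor_invertible by blast
  then have VU: "E V * U = 1" by (metis E_mult E_one U_def)
  have p_inv: "at_t_inv p = U * at_t p"
    using arg_cong[OF at_t_inv_growth_numer, of E] by (simp add: E_mult E_at_t E_at_t_inv p_def U_def)
  have q_inv: "at_t_inv q = ?s * (U * at_t q)"
    using arg_cong[OF at_t_inv_growth_denom[OF sphere], of E]
    by (simp add: E_mult E_at_t E_at_t_inv E_sign q_def U_def)
  have ss: "?s * ?s = 1" by (simp add: neg_one_power_def)
  have "at_t_inv p' * at_t q' = ?s * at_t p' * at_t_inv q'" if "expansion_of_fraction ?\<gamma> p' q'" for p' q'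
  proof -
    have e: "at_t q' * ?\<gamma> = at_t p'" using that by (simp add: expansion_of_fraction_def)
    \<comment> \<open>Two fractions with the same expansion agree after cross-multiplication, as
      polynomials, so an arbitrary pair can be compared with the known one at the inverses.\<close>
    have "at_t (p' * q) = at_t (q' * p)"
      unfolding at_t_simps e[symmetric] q\<gamma>[symmetric] by (simp add: ac_simps)
    then have "at_t_inv (p' * q) = at_t_inv (q' * p)" using at_t_inject by metis
    then have "at_t_inv p' * (?s * (U * at_t q)) = at_t_inv q' * (U * at_t p)"
      by (simp add: at_t_inv_simps p_inv q_inv)
    \<comment> \<open>The factors \<open>?s\<close>, \<open>U\<close> and \<open>at_t q\<close> are
      units with inverses \<open>?s\<close>, \<open>E V\<close> and \<open>E g\<close>; multiplying
      by these cancels them.\<close>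
    then have "?s * E V * E g * (at_t_inv p' * (?s * (U * at_t q))) =
        ?s * E V * E g * (at_t_inv q' * (U * (at_t q * ?\<gamma>)))" by (simp add: q\<gamma>)
    then have "(?s * ?s) * (E V * U) * (at_t q * E g) * at_t_inv p' =
        (E V * U) * (at_t q * E g) * (?s * at_t_inv q' * ?\<gamma>)" by (simp add: ac_simps)
    then have "at_t_inv p' = ?s * at_t_inv q' * ?\<gamma>" by (simp add: ss VU qg)
    then show ?thesis by (simp add: e[symmetric] ac_simps)
  qed
  moreover have "expansion_of_fraction ?\<gamma> p q" using q0 q\<gamma> by (simp add: expansion_of_fraction_def)
  ultimately show ?thesis by blast
qed

end

theorem corollary9p2:
  fixes S :: "'w::group_add set"
    and m :: "'w \<Rightarrow> 'w \<Rightarrow> enat"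
    and i :: "'w \<Rightarrow> 'i"
    and k :: int
  assumes "finite S"
    and "coxeter_system S m"
    and "right_angled S m"
    and "constant_on_conjugacy_classes S i"
    and "eulerian_sphere k (nerve S)"
  shows
    "((\<exists>p q. expansion_of_fraction (growth_series S i) p q) \<and>
      (\<forall>p q. expansion_of_fraction (growth_series S i) p q \<longrightarrow>
         at_t_inv p * at_t q = neg_one_power (k + 1) * at_t p * at_t_inv q)) \<and>
     ((\<exists>n A Q B. is_expression (complete_growth_series S i) n A Q B \<and>
         invertible_mat (kernel_at_t_inv Q)) \<and>
      (\<forall>n A Q B. is_expression (complete_growth_series S i) n A Q B \<and>
         invertible_mat (kernel_at_t_inv Q) \<longrightarrow>
         sandwich A (kernel_at_t_inv Q) B
           = neg_one_power (k + 1) * complete_growth_series S i))"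
proof -
  obtain L where "distinct L" "set L = S" using finite_distinct_list[OF assms(1)] by blast
  then interpret weighted_racg S m i L using assms by unfold_locales
  show ?thesis
    using growth_reciprocity[OF assms(5)] complete_growth_reciprocity[OF assms(5)] by blast
qed

end
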